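(* Let $G$ be a connected real Lie group, $g$ a left invariant Riemannian metric on $G$, $X$ a left invariant vector field on $G$ with $\|X\|_g<1$, and let $F(x,y)=\sqrt{g(y,y)}+g(X(x),y)$ be the corresponding left invariant Randers metric on $G$. Let $F^{v}((x,y),\tilde z)=\sqrt{\tilde g(\tilde z,\tilde z)}+\tilde g(X^{v}(x,y),\tilde z)$ be its vertical lift, a left invariant Randers metric on $TG$. Then $F$ is a Douglas metric if and only if $F^v$ is a Douglas metric.
   Context: Tangent Lie group: if $\mu:G\times G\to G$ is the multiplication of $G$, then $T\mu(v,w)=T_hl_g w+T_g r_h v$ (for $v\in T_gG$, $w\in T_hG$, with $l$, $r$ the left and right translations) makes $TG$ a Lie group with identity $0_e\in T_eG$. Lifts: for a vector field $X$ on $G$ with local expression $X=\sum_i\xi^i\frac{\partial}{\partial x^i}$, in the induced coordinates $(x^i,y^i)$ of $TG$ the vertical lift is $X^v=\sum_i\xi^i\frac{\partial}{\partial y^i}$ and the complete lift is $X^c=\sum_i\xi^i\frac{\partial}{\partial x^i}+\sum_{i,j}\frac{\partial\xi^i}{\partial x^j}y^j\frac{\partial}{\partial y^i}$. If $X$ is left invariant on $G$, then $X^c,X^v$ are left invariant on $TG$. They satisfy $[X^v,Y^v]=0$, $[X^c,Y^c]=[X,Y]^c$, $[X^v,Y^c]=[X,Y]^v$. Lifted metric: $\tilde g$ is the left invariant Riemannian metric on $TG$ determined by $\tilde g(X^c,Y^c)=g(X,Y)$, $\tilde g(X^v,Y^v)=g(X,Y)$, $\tilde g(X^c,Y^v)=0$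 for left invariant vector fields $X,Y$ on $G$. Douglas metric: the spray coefficients of a Finsler metric $F$ are $G^i=\frac14 g^{il}\left([F^2]_{x^my^l}y^m-[F^2]_{x^l}\right)$, where $g_{ij}=\frac12[F^2]_{y^iy^j}$. $F$ is a Douglas metric if locally $G^i=\frac12\Gamma^i_{jk}(x)y^jy^k+P(x,y)y^i$ with $P$ a local function positively homogeneous of degree one in $y$. *)

theory Defs
  imports "HOL-Analysis.Analysis" "HOL-Algebra.Group"
begin

section \<open>Smooth functions on open subsets of normed spaces\<close>

primrec Ck_on :: "nat \<Rightarrow> ('a::real_normed_vector \<Rightarrow> 'b::real_normed_vector) \<Rightarrow> 'a set \<Rightarrow> bool" where
  "Ck_on 0 f S \<longleftrightarrow> continuous_on S f"
| "Ck_on (Suc k) f S \<longleftrightarrow>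
     (\<forall>x\<in>S. f differentiable (at x)) \<and> (\<forall>v. Ck_on k (\<lambda>x. frechet_derivative f (at x) v) S)"

text \<open>Only used for open \<open>S\<close>.\<close>

definition smooth_on :: "('a::real_normed_vector \<Rightarrow> 'b::real_normed_vector) \<Rightarrow> 'a set \<Rightarrow> bool" where
  "smooth_on f S \<longleftrightarrow> (\<forall>k. Ck_on k f S)"


section \<open>Smooth manifolds\<close>

text \<open>
  A chart is a pair of its domain and its coordinate map; the values of the map outside the
  domain carry no meaning. A manifold is given by an atlas: its underlying set is the union of the
  chart domains and its topology is the one that makes all the charts homeomorphisms onto open
  sets. The model space is an arbitrary Euclidean space \<open>'e\<close>, and the coordinates
  \<open>x\<^sup>i\<close> are the components with respect to \<open>Basis\<close>.
\<close>

type_synonym ('a, 'e) chart = "'a set \<times> ('a \<Rightarrow> 'e)"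

abbreviation cdom :: "('a, 'e) chart \<Rightarrow> 'a set" where
  "cdom c \<equiv> fst c"

abbreviation coord :: "('a, 'e) chart \<Rightarrow> 'a \<Rightarrow> 'e" where
  "coord c \<equiv> snd c"

abbreviation param :: "('a, 'e) chart \<Rightarrow> 'e \<Rightarrow> 'a" where
  "param c \<equiv> inv_into (cdom c) (coord c)"

definition points :: "('a, 'e) chart set \<Rightarrow> 'a set" where
  "points A = (\<Union>c\<in>A. cdom c)"

definition atlas_topology :: "('a, 'e::euclidean_space) chart set \<Rightarrow> 'a topology" where
  "atlas_topology A =
     topology (\<lambda>W. W \<subseteq> points A \<and> (\<forall>c\<in>A. open (coord c ` (W \<inter> cdom c))))"

definition smooth_manifold :: "('a, 'e::euclidean_space) chart set \<Rightarrow> bool" where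
  "smooth_manifold A \<longleftrightarrow>
     (\<forall>c\<in>A. inj_on (coord c) (cdom c) \<and> open (coord c ` cdom c)) \<and>
     (\<forall>c\<in>A. \<forall>d\<in>A. open (coord c ` (cdom c \<inter> cdom d)) \<and>
        smooth_on (coord d \<circ> param c) (coord c ` (cdom c \<inter> cdom d))) \<and>
     Hausdorff_space (atlas_topology A) \<and> second_countable (atlas_topology A)"

lemma openin_atlas_topology:
  assumes "\<And>c. c \<in> A \<Longrightarrow> inj_on (coord c) (cdom c)"
  shows "openin (atlas_topology A) W \<longleftrightarrow>
     W \<subseteq> points A \<and> (\<forall>c\<in>A. open (coord c ` (W \<inter> cdom c)))"
proof -
  have "istopology (\<lambda>W. W \<subseteq> points A \<and> (\<forall>c\<in>A. open (coord c ` (W \<inter> cdom c))))"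
    unfolding istopology_def
  proof (rule conjI; intro allI impI; rule conjI; (intro ballI)?)
    fix S T c
    assume S: "S \<subseteq> points A \<and> (\<forall>c\<in>A. open (coord c ` (S \<inter> cdom c)))"
      and T: "T \<subseteq> points A \<and> (\<forall>c\<in>A. open (coord c ` (T \<inter> cdom c)))" and c: "c \<in> A"
    have "coord c ` ((S \<inter> T) \<inter> cdom c) = coord c ` (S \<inter> cdom c) \<inter> coord c ` (T \<inter> cdom c)"
      using assms[OF c] by (auto simp: inj_on_def)
    then show "open (coord c ` ((S \<inter> T) \<inter> cdom c))"
      using S T c by auto
  next
    fix K c
    assume K: "\<forall>S\<in>K. S \<subseteq> points A \<and> (\<forall>c\<in>A. open (coord c ` (S \<inter> cdom c)))" and c: "c \<in> A"
    have "coord c ` (\<Union>K \<inter> cdom c) = (\<Union>S\<in>K. coord c ` (S \<inter> cdom c))"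
      by auto
    then show "open (coord c ` (\<Union>K \<inter> cdom c))"
      using K c by auto
  qed auto
  then show ?thesis
    by (simp add: atlas_topology_def topology_inverse')
qed

definition smooth_map ::
  "('a, 'e::euclidean_space) chart set \<Rightarrow> ('b, 'f::euclidean_space) chart set \<Rightarrow> ('a \<Rightarrow> 'b) \<Rightarrow> bool" where
  "smooth_map A B f \<longleftrightarrow> f ` points A \<subseteq> points B \<and>
     (\<forall>c\<in>A. \<forall>d\<in>B. open (coord c ` (cdom c \<inter> f -` cdom d)) \<and>
        smooth_on (coord d \<circ> f \<circ> param c) (coord c ` (cdom c \<inter> f -` cdom d)))"

definition prod_atlas ::
  "('a, 'e) chart set \<Rightarrow> ('b, 'f) chart set \<Rightarrow> ('a \<times> 'b, 'e \<times> 'f) chart set" where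
  "prod_atlas A B = {(cdom c \<times> cdom d, map_prod (coord c) (coord d)) | c d. c \<in> A \<and> d \<in> B}"


section \<open>The tangent bundle\<close>

text \<open>
  A tangent vector at \<open>p\<close> is recorded as \<open>(p, S)\<close>, where \<open>S\<close> is
  the set of all pairs \<open>(c, w)\<close> of a chart \<open>c\<close> around \<open>p\<close> and
  the components \<open>w\<close> of the vector in that chart. The components in different
  charts are related by the derivative of the transition map.
\<close>

type_synonym ('a, 'e) tvec = "'a \<times> (('a, 'e) chart \<times> 'e) set"

definition tvec ::
  "('a, 'e::euclidean_space) chart set \<Rightarrow> 'a \<Rightarrow> ('a, 'e) chart \<Rightarrow> 'e \<Rightarrow> ('a, 'e) tvec" where
  "tvec A p c w =
     (p, {(d, frechet_derivative (coord d \<circ> param c) (at (coord c p)) w) | d. d \<in> A \<and> p \<in> cdom d})"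

definition comps :: "('a, 'e) chart \<Rightarrow> ('a, 'e) tvec \<Rightarrow> 'e" where
  "comps c v = (THE w. (c, w) \<in> snd v)"

definition tangent_space :: "('a, 'e::euclidean_space) chart set \<Rightarrow> 'a \<Rightarrow> ('a, 'e) tvec set" where
  "tangent_space A p = {tvec A p c w | c w. c \<in> A \<and> p \<in> cdom c}"

definition zero_vec :: "('a, 'e::euclidean_space) chart set \<Rightarrow> 'a \<Rightarrow> ('a, 'e) tvec" where
  "zero_vec A p = (p, {(c, 0) | c. c \<in> A \<and> p \<in> cdom c})"

text \<open>Addition and scaling in a tangent space; the arguments of \<open>add_vec\<close> are assumed to have the same base point.\<close>

definition add_vec :: "('a, 'e::euclidean_space) tvec \<Rightarrow> ('a, 'e) tvec \<Rightarrow> ('a, 'e) tvec" where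
  "add_vec u v = (fst u, {(c, a + b) | c a b. (c, a) \<in> snd u \<and> (c, b) \<in> snd v})"

definition scale_vec :: "real \<Rightarrow> ('a, 'e::euclidean_space) tvec \<Rightarrow> ('a, 'e) tvec" where
  "scale_vec r v = (fst v, {(c, r *\<^sub>R a) | c a. (c, a) \<in> snd v})"

definition tangent_bundle :: "('a, 'e::euclidean_space) chart set \<Rightarrow> ('a, 'e) tvec set" where
  "tangent_bundle A = (\<Union>p\<in>points A. tangent_space A p)"

text \<open>The induced coordinates \<open>(x\<^sup>i, y\<^sup>i)\<close> on the tangent bundle.\<close>

definition tangent_chart ::
  "('a, 'e::euclidean_space) chart set \<Rightarrow> ('a, 'e) chart \<Rightarrow> (('a, 'e) tvec, 'e \<times> 'e) chart" where
  "tangent_chart A c =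
     ({v \<in> tangent_bundle A. fst v \<in> cdom c}, \<lambda>v. (coord c (fst v), comps c v))"

definition tangent_atlas ::
  "('a, 'e::euclidean_space) chart set \<Rightarrow> (('a, 'e) tvec, 'e \<times> 'e) chart set" where
  "tangent_atlas A = tangent_chart A ` A"

definition tangent_map ::
  "('b, 'f::euclidean_space) chart set \<Rightarrow> ('a \<Rightarrow> 'b) \<Rightarrow> ('a, 'e::euclidean_space) tvec \<Rightarrow> ('b, 'f) tvec" where
  "tangent_map B f v =
     (f (fst v),
      {(d, frechet_derivative (coord d \<circ> f \<circ> param c) (at (coord c (fst v))) w) | c w d.
         (c, w) \<in> snd v \<and> d \<in> B \<and> f (fst v) \<in> cdom d})"

definition vector_field ::
  "('a, 'e::euclidean_space) chart set \<Rightarrow> ('a \<Rightarrow> ('a, 'e) tvec) \<Rightarrow> bool" where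
  "vector_field A X \<longleftrightarrow>
     (\<forall>p\<in>points A. X p \<in> tangent_space A p) \<and>
     (\<forall>c\<in>A. smooth_on (\<lambda>x. comps c (X (param c x))) (coord c ` cdom c))"

text \<open>
  The vertical and complete lifts are vector fields on the tangent bundle. In the induced chart of
  \<open>c\<close>, with \<open>\<xi>\<close> the local expression of \<open>X\<close> in \<open>c\<close>, their
  components at \<open>(x, y)\<close> are \<open>(0, \<xi> x)\<close> and \<open>(\<xi> x, D\<xi>(x) y)\<close>.
\<close>

definition vertical_lift ::
  "('a, 'e::euclidean_space) chart set \<Rightarrow> ('a \<Rightarrow> ('a, 'e) tvec) \<Rightarrow> ('a, 'e) tvec
     \<Rightarrow> (('a, 'e) tvec, 'e \<times> 'e) tvec" where
  "vertical_lift A X u =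
     (u, {(tangent_chart A c, (0, comps c (X (fst u)))) | c. c \<in> A \<and> fst u \<in> cdom c})"

definition complete_lift ::
  "('a, 'e::euclidean_space) chart set \<Rightarrow> ('a \<Rightarrow> ('a, 'e) tvec) \<Rightarrow> ('a, 'e) tvec
     \<Rightarrow> (('a, 'e) tvec, 'e \<times> 'e) tvec" where
  "complete_lift A X u =
     (u, {(tangent_chart A c,
           (comps c (X (fst u)),
            frechet_derivative (\<lambda>x. comps c (X (param c x))) (at (coord c (fst u))) (comps c u)))
          | c. c \<in> A \<and> fst u \<in> cdom c})"


section \<open>Riemannian metrics\<close>

text \<open>A metric takes two tangent vectors; only its values on pairs with a common base point matter.\<close>

definition riemannian_metric ::
  "('a, 'e::euclidean_space) chart set \<Rightarrow> (('a, 'e) tvec \<Rightarrow> ('a, 'e) tvec \<Rightarrow> real) \<Rightarrow> bool" where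
  "riemannian_metric A g \<longleftrightarrow>
     (\<forall>p\<in>points A. \<forall>u\<in>tangent_space A p. \<forall>v\<in>tangent_space A p.
        g u v = g v u \<and>
        (\<forall>w\<in>tangent_space A p. g (add_vec u w) v = g u v + g w v) \<and>
        (\<forall>r. g (scale_vec r u) v = r * g u v)) \<and>
     (\<forall>p\<in>points A. \<forall>u\<in>tangent_space A p. u \<noteq> zero_vec A p \<longrightarrow> g u u > 0) \<and>
     (\<forall>c\<in>A. \<forall>i\<in>Basis. \<forall>j\<in>Basis.
        smooth_on (\<lambda>x. g (tvec A (param c x) c i) (tvec A (param c x) c j)) (coord c ` cdom c))"


section \<open>Finsler metrics, sprays and Douglas metrics\<close>

definition partial_deriv :: "'v::real_normed_vector \<Rightarrow> ('v \<Rightarrow> real) \<Rightarrow> 'v \<Rightarrow> real" where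
  "partial_deriv b f z = deriv (\<lambda>t. f (z + t *\<^sub>R b)) 0"

definition finsler_coord ::
  "('a, 'e::euclidean_space) chart set \<Rightarrow> (('a, 'e) tvec \<Rightarrow> real) \<Rightarrow> ('a, 'e) chart \<Rightarrow> 'e \<times> 'e \<Rightarrow> real" where
  "finsler_coord A F c = (\<lambda>(x, y). F (tvec A (param c x) c y))"

text \<open>The argument \<open>L\<close> of \<open>fundamental_tensor\<close> and \<open>spray_coeff\<close> is \<open>F\<^sup>2\<close> in induced coordinates \<open>z = (x, y)\<close>.\<close>

definition fundamental_tensor ::
  "('e::euclidean_space \<times> 'e \<Rightarrow> real) \<Rightarrow> 'e \<times> 'e \<Rightarrow> 'e \<Rightarrow> 'e \<Rightarrow> real" where
  "fundamental_tensor L z i j = 1/2 * partial_deriv (0, j) (partial_deriv (0, i) L) z"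

text \<open>Inverse of a square matrix whose rows and columns are indexed by \<open>Basis\<close>.\<close>

definition inverse_matrix :: "('e::euclidean_space \<Rightarrow> 'e \<Rightarrow> real) \<Rightarrow> 'e \<Rightarrow> 'e \<Rightarrow> real" where
  "inverse_matrix a = (SOME b. \<forall>i\<in>Basis. \<forall>k\<in>Basis.
     (\<Sum>l\<in>Basis. a i l * b l k) = (if i = k then 1 else 0) \<and>
     (\<Sum>l\<in>Basis. b i l * a l k) = (if i = k then 1 else 0))"

definition spray_coeff ::
  "('e::euclidean_space \<times> 'e \<Rightarrow> real) \<Rightarrow> 'e \<times> 'e \<Rightarrow> 'e \<Rightarrow> real" where
  "spray_coeff L z i =
     1/4 * (\<Sum>l\<in>Basis. inverse_matrix (fundamental_tensor L z) i l *
       ((\<Sum>m\<in>Basis. partial_deriv (0, l) (partial_deriv (m, 0) L) z * (snd z \<bullet> m))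
        - partial_deriv (l, 0) L z))"

definition finsler_metric ::
  "('a, 'e::euclidean_space) chart set \<Rightarrow> (('a, 'e) tvec \<Rightarrow> real) \<Rightarrow> bool" where
  "finsler_metric A F \<longleftrightarrow>
     (\<forall>v\<in>tangent_bundle A. F v \<ge> 0) \<and>
     (\<forall>v\<in>tangent_bundle A. \<forall>r>0. F (scale_vec r v) = r * F v) \<and>
     (\<forall>c\<in>A. smooth_on (finsler_coord A F c) (coord c ` cdom c \<times> (- {0}))) \<and>
     (\<forall>c\<in>A. \<forall>x\<in>coord c ` cdom c. \<forall>y. y \<noteq> 0 \<longrightarrow> (\<forall>w. w \<noteq> 0 \<longrightarrow>
        (\<Sum>i\<in>Basis. \<Sum>j\<in>Basis.
           fundamental_tensor (\<lambda>z. (finsler_coord A F c z)\<^sup>2) (x, y) i j * (w \<bullet> i) * (w \<bullet> j)) > 0))"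

definition douglas_metric ::
  "('a, 'e::euclidean_space) chart set \<Rightarrow> (('a, 'e) tvec \<Rightarrow> real) \<Rightarrow> bool" where
  "douglas_metric A F \<longleftrightarrow> finsler_metric A F \<and>
     (\<forall>p\<in>points A. \<exists>c\<in>A. p \<in> cdom c \<and>
        (\<exists>(\<Gamma> :: 'e \<Rightarrow> 'e \<Rightarrow> 'e \<Rightarrow> 'e \<Rightarrow> real) (P :: 'e \<Rightarrow> 'e \<Rightarrow> real).
           (\<forall>x\<in>coord c ` cdom c. \<forall>y. y \<noteq> 0 \<longrightarrow> (\<forall>r>0. P x (r *\<^sub>R y) = r * P x y)) \<and>
           (\<forall>x\<in>coord c ` cdom c. \<forall>y. y \<noteq> 0 \<longrightarrow> (\<forall>i\<in>Basis.
              spray_coeff (\<lambda>z. (finsler_coord A F c z)\<^sup>2) (x, y) i =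
                1/2 * (\<Sum>j\<in>Basis. \<Sum>k\<in>Basis. \<Gamma> i j k x * (y \<bullet> j) * (y \<bullet> k)) + P x y * (y \<bullet> i)))))"

definition randers ::
  "(('a, 'e::euclidean_space) tvec \<Rightarrow> ('a, 'e) tvec \<Rightarrow> real) \<Rightarrow> ('a \<Rightarrow> ('a, 'e) tvec)
     \<Rightarrow> ('a, 'e) tvec \<Rightarrow> real" where
  "randers g X v = sqrt (g v v) + g (X (fst v)) v"


section \<open>Lie groups\<close>

definition lie_group :: "'a monoid \<Rightarrow> ('a, 'e::euclidean_space) chart set \<Rightarrow> bool" where
  "lie_group G A \<longleftrightarrow> group G \<and> smooth_manifold A \<and> points A = carrier G \<and>
     smooth_map (prod_atlas A A) A (\<lambda>(x, y). x \<otimes>\<^bsub>G\<^esub> y) \<and> smooth_map A A (\<lambda>x. inv\<^bsub>G\<^esub> x)"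

text \<open>The group structure \<open>T\<mu>(v, w) = T l\<^sub>g w + T r\<^sub>h v\<close> for \<open>v\<close> over \<open>g\<close> and \<open>w\<close> over \<open>h\<close>.\<close>

definition tangent_group ::
  "'a monoid \<Rightarrow> ('a, 'e::euclidean_space) chart set \<Rightarrow> ('a, 'e) tvec monoid" where
  "tangent_group G A =
     \<lparr>carrier = tangent_bundle A,
      mult = (\<lambda>v w. add_vec (tangent_map A (\<lambda>x. fst v \<otimes>\<^bsub>G\<^esub> x) w)
                            (tangent_map A (\<lambda>x. x \<otimes>\<^bsub>G\<^esub> fst w) v)),
      one = zero_vec A \<one>\<^bsub>G\<^esub>\<rparr>"

definition left_invariant_field ::
  "'a monoid \<Rightarrow> ('a, 'e::euclidean_space) chart set \<Rightarrow> ('a \<Rightarrow> ('a, 'e) tvec) \<Rightarrow> bool" where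
  "left_invariant_field G A X \<longleftrightarrow> vector_field A X \<and>
     (\<forall>a\<in>carrier G. \<forall>p\<in>carrier G. tangent_map A (\<lambda>x. a \<otimes>\<^bsub>G\<^esub> x) (X p) = X (a \<otimes>\<^bsub>G\<^esub> p))"

definition left_invariant_metric ::
  "'a monoid \<Rightarrow> ('a, 'e::euclidean_space) chart set
     \<Rightarrow> (('a, 'e) tvec \<Rightarrow> ('a, 'e) tvec \<Rightarrow> real) \<Rightarrow> bool" where
  "left_invariant_metric G A g \<longleftrightarrow> riemannian_metric A g \<and>
     (\<forall>a\<in>carrier G. \<forall>p\<in>carrier G. \<forall>u\<in>tangent_space A p. \<forall>v\<in>tangent_space A p.
        g (tangent_map A (\<lambda>x. a \<otimes>\<^bsub>G\<^esub> x) u) (tangent_map A (\<lambda>x. a \<otimes>\<^bsub>G\<^esub> x) v) = g u v)"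

definition lifted_metric ::
  "'a monoid \<Rightarrow> ('a, 'e::euclidean_space) chart set
     \<Rightarrow> (('a, 'e) tvec \<Rightarrow> ('a, 'e) tvec \<Rightarrow> real)
     \<Rightarrow> ((('a, 'e) tvec, 'e \<times> 'e) tvec \<Rightarrow> (('a, 'e) tvec, 'e \<times> 'e) tvec \<Rightarrow> real) \<Rightarrow> bool" where
  "lifted_metric G A g gt \<longleftrightarrow>
     left_invariant_metric (tangent_group G A) (tangent_atlas A) gt \<and>
     (\<forall>X Y. left_invariant_field G A X \<and> left_invariant_field G A Y \<longrightarrow>
        (\<forall>u\<in>tangent_bundle A.
           gt (complete_lift A X u) (complete_lift A Y u) = g (X (fst u)) (Y (fst u)) \<and>
           gt (vertical_lift A X u) (vertical_lift A Y u) = g (X (fst u)) (Y (fst u)) \<and>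
           gt (complete_lift A X u) (vertical_lift A Y u) = 0))"

end

theory Submission
  imports Defs
begin

text \<open>Let \<open>\<beta> = g(X, \<cdot>)\<close> be the one-form dual to \<open>X\<close>, and \<open>\<alpha>\<close> the norm of \<open>g\<close>, so that \<open>F = \<alpha> + \<beta>\<close>. A Randers
  metric is a Douglas metric if and only if its one-form is closed. The theorem therefore
  compares the closedness of \<open>\<beta>\<close> with that of the form \<open>\<beta>'\<close> dual to \<open>X\<^sup>v\<close> with respect to the lifted
  metric.

  The criterion is a computation in one chart. With \<open>\<^bold>g\<close> the fundamental tensor of \<open>F\<close>, the spray
  vector \<open>s\<close> of \<open>F\<close> is the unique solution of a linear equation \<open>\<^bold>g(s, l) = E(l) / 4\<close> for all \<open>l\<close>
  (\<open>spray_coeff_iff\<close>), and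
  \<open>E(l) / 4 = \<^bold>g(S + P y, l) + F d\<beta>(y, l) / 2\<close>, where \<open>S\<close> is the geodesic spray of \<open>g\<close> and \<open>P\<close> is
  a homogeneous function (\<open>spray_rhs_decomposition\<close>). If \<open>d\<beta> = 0\<close>, then \<open>s = S + P y\<close>. If
  conversely \<open>s\<close> is a quadratic spray up to a multiple of \<open>y\<close>, the same identity equates an even function
  of \<open>y\<close> with the odd function \<open>\<alpha> d\<beta>(y, l) / 2\<close>, so that \<open>d\<beta> = 0\<close> (\<open>Douglas_form_iff\<close>).

  On the tangent bundle, \<open>\<beta>'\<close> turns out to be the complete lift of \<open>\<beta>\<close>: in induced coordinates
  \<open>\<beta>'(\<eta>, \<zeta>) = \<beta>(\<zeta>) + (\<partial>\<^sub>y \<beta>)(\<eta>)\<close> at \<open>(x, y)\<close> (\<open>dual_coord_lift\<close>). This follows from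
  \<open>\<beta>'(Y\<^sup>c) = 0\<close>, \<open>\<beta>'(Z\<^sup>v) = \<beta>(Z)\<close> and the constancy of \<open>\<beta>(Y)\<close> for left invariant \<open>Y\<close> and \<open>Z\<close>,
  because every tangent vector extends to a left invariant field
  (\<open>left_invariant_field_through\<close>). From the formula, \<open>\<beta>'\<close> is closed in an induced chart exactly when
  \<open>\<beta>\<close> is closed in the underlying chart (\<open>dual_closed_lift_iff\<close>).

  Since the coordinate criterion is applied to both \<open>G\<close> and \<open>TG\<close>, it has to be known that the induced
  charts have smooth transition maps and that the two lifts are tangent vectors of \<open>TG\<close>. For the
  complete lift this rests on the symmetry of second derivatives, as does the closedness of \<open>\<beta>'\<close>.\<close>

section \<open>Calculus of smooth maps\<close>

lemma Ck_on_SucD: "Ck_on (Suc k) f S \<Longrightarrow> Ck_on k f S"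
proof (induction k arbitrary: f)
  case 0
  then show ?case
    by (auto intro: continuous_at_imp_continuous_on differentiable_imp_continuous_within)
next
  case (Suc k)
  then show ?case by simp
qed

lemma Ck_on_Suc_has_derivative:
  assumes "open S" "Ck_on (Suc k) f S" "x \<in> S"
  shows "(f has_derivative frechet_derivative f (at x)) (at x)"
  using assms by (auto simp: frechet_derivative_works)

text \<open>Membership in \<open>C\<^sup>k\<close> on an open set is local. This makes it possible to replace the Frechet
  derivative chosen in \<open>Ck_on\<close> by any explicit formula for it, which is how the closure properties
  below are proved (rule \<open>Ck_on_SucI\<close>).\<close>

lemma Ck_on_cong:
  assumes "open S" "\<And>x. x \<in> S \<Longrightarrow> f x = g x" "Ck_on k f S"
  shows "Ck_on k g S"
  using assms(2,3)
proof (induction k arbitrary: f g)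
  case 0
  then show ?case using continuous_on_cong by force
next
  case (Suc k)
  have d: "(g has_derivative frechet_derivative f (at x)) (at x)" if "x \<in> S" for x
    using has_derivative_transform_within_open[OF Ck_on_Suc_has_derivative[OF assms(1) Suc.prems(2) that]
        assms(1) that] Suc.prems(1) by blast
  have "Ck_on k (\<lambda>x. frechet_derivative g (at x) v) S" for v
  proof (rule Suc.IH)
    show "Ck_on k (\<lambda>x. frechet_derivative f (at x) v) S"
      using Suc.prems(2) by simp
    show "frechet_derivative f (at x) v = frechet_derivative g (at x) v" if "x \<in> S" for x
      using frechet_derivative_at[OF d[OF that]] by simp
  qed
  then show ?case using d by (auto simp: differentiable_def)
qed

lemma Ck_on_SucI:
  assumes "open S" "\<And>x. x \<in> S \<Longrightarrow> (f has_derivative f' x) (at x)"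
    and "\<And>v. Ck_on k (\<lambda>x. f' x v) S"
  shows "Ck_on (Suc k) f S"
proof -
  have "Ck_on k (\<lambda>x. frechet_derivative f (at x) v) S" for v
    by (rule Ck_on_cong[OF assms(1) _ assms(3)[of v]]) (metis assms(2) frechet_derivative_at)
  then show ?thesis using assms(2) by (auto simp: differentiable_def)
qed

lemma Ck_on_const [simp]: "Ck_on k (\<lambda>x. c) S"
  by (induction k arbitrary: c) auto

lemma Ck_on_bounded_linear:
  assumes "bounded_linear L" "open S"
  shows "Ck_on k L S"
proof (cases k)
  case 0
  then show ?thesis using assms by (simp add: linear_continuous_on)
next
  case (Suc n)
  then show ?thesis
    using Ck_on_SucI[OF assms(2), of L "\<lambda>_. L"] bounded_linear_imp_has_derivative[OF assms(1)] by simp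
qed

lemma Ck_on_bounded_linear_comp:
  assumes "bounded_linear L" "open S" "Ck_on k f S"
  shows "Ck_on k (\<lambda>x. L (f x)) S"
  using assms(3)
proof (induction k arbitrary: f)
  case 0
  then show ?case using assms(1) by (simp add: bounded_linear.continuous_on)
next
  case (Suc k)
  show ?case
  proof (rule Ck_on_SucI[OF assms(2)])
    show "((\<lambda>x. L (f x)) has_derivative (\<lambda>v. L (frechet_derivative f (at x) v))) (at x)"
      if "x \<in> S" for x
      by (rule bounded_linear.has_derivative[OF assms(1) Ck_on_Suc_has_derivative[OF assms(2) Suc.prems that]])
  qed (use Suc in auto)
qed

lemma Ck_on_add:
  assumes "open S" "Ck_on k f S" "Ck_on k g S"
  shows "Ck_on k (\<lambda>x. f x + g x) S"
  using assms(2,3)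
proof (induction k arbitrary: f g)
  case 0
  then show ?case by (simp add: continuous_on_add)
next
  case (Suc k)
  show ?case
  proof (rule Ck_on_SucI[OF assms(1)])
    show "((\<lambda>x. f x + g x) has_derivative
        (\<lambda>v. frechet_derivative f (at x) v + frechet_derivative g (at x) v)) (at x)" if "x \<in> S" for x
      by (rule has_derivative_add[OF Ck_on_Suc_has_derivative[OF assms(1) Suc.prems(1) that]
            Ck_on_Suc_has_derivative[OF assms(1) Suc.prems(2) that]])
  qed (use Suc in auto)
qed

lemma Ck_on_sum:
  assumes "open S" "\<And>i. i \<in> I \<Longrightarrow> Ck_on k (f i) S"
  shows "Ck_on k (\<lambda>x. \<Sum>i\<in>I. f i x) S"
  using assms(2)
proof (induction I rule: infinite_finite_induct)
  case (insert i I)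
  then show ?case using Ck_on_add[OF assms(1), of k "f i" "\<lambda>x. \<Sum>i\<in>I. f i x"] by simp
qed auto

lemma Ck_on_bounded_bilinear:
  assumes B: "bounded_bilinear B" and S: "open S" and "Ck_on k f S" "Ck_on k g S"
  shows "Ck_on k (\<lambda>x. B (f x) (g x)) S"
  using assms(3,4)
proof (induction k arbitrary: f g)
  case 0
  then show ?case using B by (simp add: bounded_bilinear.continuous_on)
next
  case (Suc k)
  show ?case
  proof (rule Ck_on_SucI[OF S])
    show "((\<lambda>x. B (f x) (g x)) has_derivative
        (\<lambda>v. B (f x) (frechet_derivative g (at x) v) + B (frechet_derivative f (at x) v) (g x))) (at x)"
      if "x \<in> S" for x
      by (rule bounded_bilinear.FDERIV[OF B Ck_on_Suc_has_derivative[OF S Suc.prems(1) that]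
            Ck_on_Suc_has_derivative[OF S Suc.prems(2) that]])
    show "Ck_on k (\<lambda>x. B (f x) (frechet_derivative g (at x) v) + B (frechet_derivative f (at x) v) (g x)) S" for v
      using Ck_on_add[OF S Suc.IH[OF Ck_on_SucD[OF Suc.prems(1)]] Suc.IH[OF _ Ck_on_SucD[OF Suc.prems(2)]]]
        Suc.prems by simp
  qed
qed

lemma linear_eq_sum_Basis:
  fixes L :: "'a::euclidean_space \<Rightarrow> 'b::real_normed_vector"
  assumes "linear L"
  shows "L w = (\<Sum>b\<in>Basis. (w \<bullet> b) *\<^sub>R L b)"
proof -
  have "L w = L (\<Sum>b\<in>Basis. (w \<bullet> b) *\<^sub>R b)" by (simp only: euclidean_representation)
  then show ?thesis by (simp only: linear_sum[OF assms] linear_cmul[OF assms])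
qed

text \<open>By the chain rule the derivative of the composition is a sum of products of partial derivatives
  of \<open>g\<close> along \<open>f\<close> with components of the derivative of \<open>f\<close>, so that induction on \<open>k\<close> needs only
  products and sums. The expansion in a basis keeps all derivatives vector-valued, as the definition
  of \<open>Ck_on\<close> demands.\<close>

lemma Ck_on_compose:
  fixes f :: "'a::real_normed_vector \<Rightarrow> 'b::euclidean_space" and g :: "'b \<Rightarrow> 'c::real_normed_vector"
  assumes "open S" "open T" "f ` S \<subseteq> T" "Ck_on k f S" "Ck_on k g T"
  shows "Ck_on k (\<lambda>x. g (f x)) S"
  using assms(4,5)
proof (induction k arbitrary: g)
  case 0
  then show ?case
    using assms(3) continuous_on_compose2[of T g S f] by auto
next
  case (Suc k)
  let ?f' = "\<lambda>x. frechet_derivative f (at x)" and ?g' = "\<lambda>y. frechet_derivative g (at y)"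
  show ?case
  proof (rule Ck_on_SucI[OF assms(1)])
    fix x assume x: "x \<in> S"
    have gd: "(g has_derivative ?g' (f x)) (at (f x))"
      using Ck_on_Suc_has_derivative[OF assms(2) Suc.prems(2)] x assms(3) by blast
    have fd: "(f has_derivative ?f' x) (at x)"
      by (rule Ck_on_Suc_has_derivative[OF assms(1) Suc.prems(1) x])
    have "((\<lambda>x. g (f x)) has_derivative (\<lambda>v. ?g' (f x) (?f' x v))) (at x)"
      using diff_chain_at[OF fd gd] by (simp add: o_def)
    then show "((\<lambda>x. g (f x)) has_derivative
        (\<lambda>v. \<Sum>b\<in>Basis. (?f' x v \<bullet> b) *\<^sub>R ?g' (f x) b)) (at x)"
      by (rule has_derivative_eq_rhs) (rule ext, rule linear_eq_sum_Basis[OF has_derivative_linear[OF gd]])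
  next
    fix v
    show "Ck_on k (\<lambda>x. \<Sum>b\<in>Basis. (?f' x v \<bullet> b) *\<^sub>R ?g' (f x) b) S"
    proof (intro Ck_on_sum[OF assms(1)] Ck_on_bounded_bilinear[OF bounded_bilinear_scaleR assms(1)])
      fix b :: 'b
      show "Ck_on k (\<lambda>x. ?f' x v \<bullet> b) S"
        using Suc.prems(1) by (intro Ck_on_bounded_linear_comp[OF bounded_linear_inner_left assms(1)]) simp
      show "Ck_on k (\<lambda>x. ?g' (f x) b) S"
        using Suc.IH[OF Ck_on_SucD[OF Suc.prems(1)], of "\<lambda>y. ?g' y b"] Suc.prems(2) by simp
    qed
  qed
qed

text \<open>Powers with an arbitrary real exponent are stable under differentiation, unlike the square root
  alone, which is the case of interest.\<close>

lemma Ck_on_powr: "Ck_on k (\<lambda>x::real. x powr r) {0<..}"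
proof (induction k arbitrary: r)
  case 0
  then show ?case by (auto intro!: continuous_intros)
next
  case (Suc k)
  show ?case
  proof (rule Ck_on_SucI)
    show "((\<lambda>x. x powr r) has_derivative (\<lambda>v. (r * v) * x powr (r - 1))) (at x)" if "x \<in> {0<..}" for x
      using that has_real_derivative_powr[of x r]
      by (auto simp: has_field_derivative_def mult.commute mult.left_commute elim!: has_derivative_eq_rhs)
    show "Ck_on k (\<lambda>x::real. (r * v) * x powr (r - 1)) {0<..}" for v
      by (intro Ck_on_bounded_linear_comp[OF bounded_linear_mult_right] Suc.IH) simp
  qed simp
qed

lemma smooth_on_cong:
  "open S \<Longrightarrow> (\<And>x. x \<in> S \<Longrightarrow> f x = g x) \<Longrightarrow> smooth_on f S \<Longrightarrow> smooth_on g S"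
  unfolding smooth_on_def using Ck_on_cong by blast

lemma smooth_on_const [simp]: "smooth_on (\<lambda>x. c) S"
  by (simp add: smooth_on_def)

lemma smooth_on_bounded_linear: "bounded_linear L \<Longrightarrow> open S \<Longrightarrow> smooth_on L S"
  by (simp add: smooth_on_def Ck_on_bounded_linear)

lemma smooth_on_ident: "open S \<Longrightarrow> smooth_on (\<lambda>x. x) S"
  by (rule smooth_on_bounded_linear[OF bounded_linear_ident])

lemma smooth_on_bounded_linear_comp:
  "bounded_linear L \<Longrightarrow> open S \<Longrightarrow> smooth_on f S \<Longrightarrow> smooth_on (\<lambda>x. L (f x)) S"
  by (simp add: smooth_on_def Ck_on_bounded_linear_comp)

lemma smooth_on_add:
  "open S \<Longrightarrow> smooth_on f S \<Longrightarrow> smooth_on g S \<Longrightarrow> smooth_on (\<lambda>x. f x + g x) S"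
  by (simp add: smooth_on_def Ck_on_add)

lemma smooth_on_sum:
  "open S \<Longrightarrow> (\<And>i. i \<in> I \<Longrightarrow> smooth_on (f i) S) \<Longrightarrow> smooth_on (\<lambda>x. \<Sum>i\<in>I. f i x) S"
  by (simp add: smooth_on_def Ck_on_sum)

lemma smooth_on_scaleR:
  "open S \<Longrightarrow> smooth_on f S \<Longrightarrow> smooth_on g S \<Longrightarrow> smooth_on (\<lambda>x. f x *\<^sub>R g x) S"
  by (simp add: smooth_on_def Ck_on_bounded_bilinear[OF bounded_bilinear_scaleR])

lemma smooth_on_mult:
  fixes f g :: "'a::real_normed_vector \<Rightarrow> real"
  shows "open S \<Longrightarrow> smooth_on f S \<Longrightarrow> smooth_on g S \<Longrightarrow> smooth_on (\<lambda>x. f x * g x) S"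
  by (simp add: smooth_on_def Ck_on_bounded_bilinear[OF bounded_bilinear_mult])

lemma smooth_on_inner_left:
  "open S \<Longrightarrow> smooth_on f S \<Longrightarrow> smooth_on (\<lambda>x. f x \<bullet> b) S"
  by (rule smooth_on_bounded_linear_comp[OF bounded_linear_inner_left])

lemma smooth_on_Pair:
  assumes "open S" "smooth_on f S" "smooth_on g S"
  shows "smooth_on (\<lambda>x. (f x, g x)) S"
proof -
  have "smooth_on (\<lambda>x. (f x, 0) + (0, g x)) S"
    by (intro smooth_on_add assms
        smooth_on_bounded_linear_comp[OF bounded_linear_Pair[OF bounded_linear_ident bounded_linear_zero]]
        smooth_on_bounded_linear_comp[OF bounded_linear_Pair[OF bounded_linear_zero bounded_linear_ident]])
  then show ?thesis by simp
qed

lemma smooth_on_compose: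
  fixes f :: "'a::real_normed_vector \<Rightarrow> 'b::euclidean_space"
  assumes "open S" "open T" "f ` S \<subseteq> T" "smooth_on f S" "smooth_on g T"
  shows "smooth_on (\<lambda>x. g (f x)) S"
  using assms Ck_on_compose[of S T f _ g] by (simp add: smooth_on_def)

lemma smooth_on_fst: "open S \<Longrightarrow> smooth_on fst S"
  by (simp add: smooth_on_bounded_linear bounded_linear_fst)

lemma smooth_on_snd: "open S \<Longrightarrow> smooth_on snd S"
  by (simp add: smooth_on_bounded_linear bounded_linear_snd)

lemma smooth_on_sqrt:
  assumes "open S" "smooth_on f S" "\<And>x. x \<in> S \<Longrightarrow> 0 < f x"
  shows "smooth_on (\<lambda>x. sqrt (f x)) S"
proof (rule smooth_on_cong[OF assms(1)])
  show "smooth_on (\<lambda>x. f x powr (1/2)) S"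
    by (rule smooth_on_compose[where T = "{0<..}"]) (use assms Ck_on_powr in \<open>auto simp: smooth_on_def\<close>)
  show "f x powr (1/2) = sqrt (f x)" if "x \<in> S" for x
    using assms(3)[OF that] by (simp add: powr_half_sqrt)
qed

lemma smooth_on_has_derivative:
  "open S \<Longrightarrow> smooth_on f S \<Longrightarrow> x \<in> S \<Longrightarrow> (f has_derivative frechet_derivative f (at x)) (at x)"
  unfolding smooth_on_def using Ck_on_Suc_has_derivative by blast

lemma smooth_on_linear_frechet_derivative:
  "open S \<Longrightarrow> smooth_on f S \<Longrightarrow> x \<in> S \<Longrightarrow> linear (frechet_derivative f (at x))"
  using has_derivative_linear smooth_on_has_derivative by blast

lemma smooth_on_frechet_derivative:
  "smooth_on f S \<Longrightarrow> smooth_on (\<lambda>x. frechet_derivative f (at x) v) S"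
  unfolding smooth_on_def by (metis Ck_on.simps(2))

lemma smooth_on_frechet_derivative_apply:
  fixes f :: "'a::euclidean_space \<Rightarrow> 'b::real_normed_vector"
    and u :: "'c::real_normed_vector \<Rightarrow> 'a"
  assumes S: "open S" and f: "smooth_on f S" and T: "open T" and "u ` T \<subseteq> S"
    and u: "smooth_on u T" and w: "smooth_on w T"
  shows "smooth_on (\<lambda>z. frechet_derivative f (at (u z)) (w z)) T"
proof (rule smooth_on_cong[OF T])
  show "smooth_on (\<lambda>z. \<Sum>b\<in>Basis. (w z \<bullet> b) *\<^sub>R frechet_derivative f (at (u z)) b) T"
    by (intro smooth_on_sum smooth_on_scaleR smooth_on_inner_left T w
        smooth_on_compose[OF T S _ u smooth_on_frechet_derivative[OF f]] assms)
  show "(\<Sum>b\<in>Basis. (w z \<bullet> b) *\<^sub>R frechet_derivative f (at (u z)) b) =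
      frechet_derivative f (at (u z)) (w z)" if "z \<in> T" for z
    using assms that
    by (intro linear_eq_sum_Basis[symmetric] smooth_on_linear_frechet_derivative[OF S f]) auto
qed

section \<open>Symmetry of second derivatives\<close>

text \<open>The symmetry of second derivatives compares two evaluations of the second difference of \<open>f\<close> over
  a small parallelogram: the mean value theorem is applied first in direction \<open>u\<close> and then in
  direction \<open>v\<close>, or in the opposite order. One mixed derivative at some point therefore equals the
  other one at another point. Both points tend to \<open>x\<close> with \<open>h\<close>, and continuity finishes the argument.\<close>

lemma second_difference:
  fixes f :: "'a::real_normed_vector \<Rightarrow> real"
  assumes S: "open S" and f: "Ck_on 2 f S" and h: "0 < h"
    and inS: "\<And>a b. 0 \<le> a \<Longrightarrow> a \<le> h \<Longrightarrow> 0 \<le> b \<Longrightarrow> b \<le> h \<Longrightarrow> x + a *\<^sub>R u + b *\<^sub>R v \<in> S"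
  shows "\<exists>a b. 0 < a \<and> a < h \<and> 0 < b \<and> b < h \<and>
    f (x + h *\<^sub>R u + h *\<^sub>R v) - f (x + h *\<^sub>R u) - f (x + h *\<^sub>R v) + f x =
      h * h * frechet_derivative (\<lambda>z. frechet_derivative f (at z) u) (at (x + a *\<^sub>R u + b *\<^sub>R v)) v"
proof -
  have fd: "(f has_derivative frechet_derivative f (at z)) (at z)" if "z \<in> S" for z
    using Ck_on_Suc_has_derivative[OF S _ that, of 1 f] f by (simp add: numeral_2_eq_2)
  let ?fu = "\<lambda>z. frechet_derivative f (at z) u"
  have fud: "(?fu has_derivative frechet_derivative ?fu (at z)) (at z)" if "z \<in> S" for z
    using Ck_on_Suc_has_derivative[OF S _ that, of 0 ?fu] f by (simp add: numeral_2_eq_2)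
  have line: "((\<lambda>t. F (p + t *\<^sub>R w)) has_real_derivative F' w) (at t)"
    if "(F has_derivative F') (at (p + t *\<^sub>R w))" for F :: "'a \<Rightarrow> real" and F' p w t
  proof -
    have "((\<lambda>t. p + t *\<^sub>R w) has_derivative (\<lambda>s. s *\<^sub>R w)) (at t)"
      by (auto intro!: derivative_eq_intros)
    from diff_chain_at[OF this that] have "((\<lambda>t. F (p + t *\<^sub>R w)) has_derivative (\<lambda>s. F' (s *\<^sub>R w))) (at t)"
      by (simp add: o_def)
    moreover have "F' (s *\<^sub>R w) = F' w * s" for s
      using linear_cmul[OF has_derivative_linear[OF that]] by simp
    ultimately show ?thesis by (simp add: has_field_derivative_def)
  qed
  define \<psi> where "\<psi> a = f (x + h *\<^sub>R v + a *\<^sub>R u) - f (x + a *\<^sub>R u)" for a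
  have d\<psi>: "(\<psi> has_real_derivative ?fu (x + h *\<^sub>R v + a *\<^sub>R u) - ?fu (x + a *\<^sub>R u)) (at a)"
    if "0 \<le> a" "a \<le> h" for a
  proof -
    have "x + h *\<^sub>R v + a *\<^sub>R u \<in> S" "x + a *\<^sub>R u \<in> S"
      using inS[of a h] inS[of a 0] that h by (simp_all add: algebra_simps)
    then show ?thesis unfolding \<psi>_def by (intro DERIV_diff line fd)
  qed
  then obtain a where a: "0 < a" "a < h"
    "\<psi> h - \<psi> 0 = (h - 0) * (?fu (x + h *\<^sub>R v + a *\<^sub>R u) - ?fu (x + a *\<^sub>R u))"
    using MVT2[OF h d\<psi>] by blast
  have dfu: "((\<lambda>b. ?fu (x + a *\<^sub>R u + b *\<^sub>R v)) has_real_derivative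
      frechet_derivative ?fu (at (x + a *\<^sub>R u + b *\<^sub>R v)) v) (at b)" if "0 \<le> b" "b \<le> h" for b
    by (rule line[OF fud]) (use inS a that in auto)
  then obtain b where b: "0 < b" "b < h"
    "?fu (x + a *\<^sub>R u + h *\<^sub>R v) - ?fu (x + a *\<^sub>R u + 0 *\<^sub>R v) =
      (h - 0) * frechet_derivative ?fu (at (x + a *\<^sub>R u + b *\<^sub>R v)) v"
    using MVT2[OF h dfu] by blast
  show ?thesis
    using a b by (intro exI[of _ a] exI[of _ b]) (simp add: \<psi>_def algebra_simps)
qed

lemma symmetric_second_derivative_real:
  fixes f :: "'a::real_normed_vector \<Rightarrow> real"
  assumes S: "open S" and f: "Ck_on 2 f S" and x: "x \<in> S"
  shows "frechet_derivative (\<lambda>z. frechet_derivative f (at z) u) (at x) v =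
    frechet_derivative (\<lambda>z. frechet_derivative f (at z) v) (at x) u" (is "?d u v x = ?d v u x")
proof (rule ccontr)
  assume "?d u v x \<noteq> ?d v u x"
  define e where "e = \<bar>?d u v x - ?d v u x\<bar> / 2"
  have e: "e > 0" using \<open>?d u v x \<noteq> ?d v u x\<close> by (simp add: e_def)
  have cont: "continuous_on S (?d u v)" for u v using f by (simp add: numeral_2_eq_2)
  obtain r0 where r0: "r0 > 0" "ball x r0 \<subseteq> S" using S x open_contains_ball by blast
  have "\<exists>r>0. \<forall>y. dist y x < r \<longrightarrow> dist (?d u v y) (?d u v x) < e" for u v
    using cont[of u v] S x e by (simp add: continuous_on_eq_continuous_at continuous_at_eps_delta)
  then obtain r1 r2 where r1: "r1 > 0" "\<And>y. dist y x < r1 \<Longrightarrow> dist (?d u v y) (?d u v x) < e"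
    and r2: "r2 > 0" "\<And>y. dist y x < r2 \<Longrightarrow> dist (?d v u y) (?d v u x) < e" by metis
  define r where "r = min r0 (min r1 r2)"
  have r: "r > 0" using r0 r1 r2 by (simp add: r_def)
  \<comment> \<open>The summand 1 makes the denominator positive even if both directions vanish.\<close>
  define h where "h = r / (norm u + norm v + 1)"
  have h: "h > 0" using r by (simp add: h_def add_nonneg_pos)
  have near: "dist (x + a *\<^sub>R u + b *\<^sub>R v) x < r" if "0 \<le> a" "a \<le> h" "0 \<le> b" "b \<le> h" for a b
  proof -
    have "norm (a *\<^sub>R u + b *\<^sub>R v) \<le> a * norm u + b * norm v"
      using that norm_triangle_ineq[of "a *\<^sub>R u" "b *\<^sub>R v"] by simp
    also have "\<dots> \<le> h * norm u + h * norm v" using that by (intro add_mono mult_right_mono) auto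
    also have "\<dots> < h * (norm u + norm v + 1)" using h by (simp add: algebra_simps)
    also have "\<dots> = r" by (simp add: h_def add_nonneg_pos less_imp_neq[THEN not_sym])
    finally show ?thesis by (simp add: dist_norm add.assoc)
  qed
  have inS: "x + a *\<^sub>R u + b *\<^sub>R v \<in> S" if "0 \<le> a" "a \<le> h" "0 \<le> b" "b \<le> h" for a b
    using near[OF that] r0 by (auto simp: r_def dist_commute)
  obtain a b where ab: "0 < a" "a < h" "0 < b" "b < h"
    "f (x + h *\<^sub>R u + h *\<^sub>R v) - f (x + h *\<^sub>R u) - f (x + h *\<^sub>R v) + f x =
      h * h * ?d u v (x + a *\<^sub>R u + b *\<^sub>R v)"
    using second_difference[OF S f h inS] by blast
  have "x + a *\<^sub>R v + b *\<^sub>R u \<in> S" if "0 \<le> a" "a \<le> h" "0 \<le> b" "b \<le> h" for a b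
    using inS[of b a] that by (simp add: algebra_simps)
  then obtain c d where cd: "0 < c" "c < h" "0 < d" "d < h"
    "f (x + h *\<^sub>R v + h *\<^sub>R u) - f (x + h *\<^sub>R v) - f (x + h *\<^sub>R u) + f x =
      h * h * ?d v u (x + c *\<^sub>R v + d *\<^sub>R u)"
    using second_difference[OF S f h, of x v u] by blast
  have swap: "x + c *\<^sub>R v + d *\<^sub>R u = x + d *\<^sub>R u + c *\<^sub>R v"
    "x + h *\<^sub>R v + h *\<^sub>R u = x + h *\<^sub>R u + h *\<^sub>R v" by (simp_all add: algebra_simps)
  have "h * h * ?d u v (x + a *\<^sub>R u + b *\<^sub>R v) = h * h * ?d v u (x + d *\<^sub>R u + c *\<^sub>R v)"
    using ab(5) cd(5) unfolding swap by linarith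
  then have "?d u v (x + a *\<^sub>R u + b *\<^sub>R v) = ?d v u (x + d *\<^sub>R u + c *\<^sub>R v)"
    using h by simp
  moreover have "dist (?d u v (x + a *\<^sub>R u + b *\<^sub>R v)) (?d u v x) < e"
    using near[of a b] ab by (intro r1) (simp add: r_def)
  moreover have "dist (?d v u (x + d *\<^sub>R u + c *\<^sub>R v)) (?d v u x) < e"
    using near[of d c] cd by (intro r2) (simp add: r_def)
  ultimately have "\<bar>?d u v x - ?d v u x\<bar> < 2 * e" unfolding dist_real_def by linarith
  then show False by (simp add: e_def)
qed

lemma symmetric_second_derivative:
  fixes f :: "'a::real_normed_vector \<Rightarrow> 'b::euclidean_space"
  assumes S: "open S" and f: "smooth_on f S" and x: "x \<in> S"
  shows "frechet_derivative (\<lambda>z. frechet_derivative f (at z) u) (at x) v =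
    frechet_derivative (\<lambda>z. frechet_derivative f (at z) v) (at x) u"
proof (rule euclidean_eqI)
  fix b :: 'b
  have fb: "smooth_on (\<lambda>z. f z \<bullet> b) S" by (rule smooth_on_inner_left[OF S f])
  have 1: "frechet_derivative (\<lambda>z. g z \<bullet> b) (at z) w = frechet_derivative g (at z) w \<bullet> b"
    if "smooth_on g S" "z \<in> S" for g :: "'a \<Rightarrow> 'b" and z w
    using fun_cong[OF frechet_derivative_at[OF bounded_linear.has_derivative[OF bounded_linear_inner_left[of b]
          smooth_on_has_derivative[OF S that]]], of w]
    by (rule sym)
  have 2: "frechet_derivative (\<lambda>z. frechet_derivative (\<lambda>z. f z \<bullet> b) (at z) u) (at x) v =
      frechet_derivative (\<lambda>z. frechet_derivative f (at z) u) (at x) v \<bullet> b" for u v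
  proof -
    have "frechet_derivative (\<lambda>z. frechet_derivative (\<lambda>z. f z \<bullet> b) (at z) u) (at x) =
        frechet_derivative (\<lambda>z. frechet_derivative f (at z) u \<bullet> b) (at x)"
    proof (rule frechet_derivative_transform_within_open[OF _ S x])
      show "(\<lambda>z. frechet_derivative (\<lambda>z. f z \<bullet> b) (at z) u) differentiable at x"
        by (rule differentiableI[OF smooth_on_has_derivative[OF S smooth_on_frechet_derivative[OF fb] x]])
    qed (rule 1[OF f])
    then show ?thesis using 1[OF smooth_on_frechet_derivative[OF f] x] by simp
  qed
  have "Ck_on 2 (\<lambda>z. f z \<bullet> b) S" using fb by (simp add: smooth_on_def)
  from symmetric_second_derivative_real[OF S this x, of u v]
  show "frechet_derivative (\<lambda>z. frechet_derivative f (at z) u) (at x) v \<bullet> b =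
    frechet_derivative (\<lambda>z. frechet_derivative f (at z) v) (at x) u \<bullet> b" by (simp add: 2)
qed

text \<open>This is the derivative of the second component of the tangent map \<open>(x, y) \<mapsto> (f x, Df(x) y)\<close>.
  It is evaluated separately in the two factors: freezing \<open>y\<close> leaves a directional derivative of
  \<open>f\<close>, freezing \<open>x\<close> leaves a linear map.\<close>

lemma frechet_derivative_apply_has_derivative:
  fixes f :: "'a::euclidean_space \<Rightarrow> 'b::euclidean_space"
  assumes S: "open S" and f: "smooth_on f S" and x: "x \<in> S"
  shows "((\<lambda>z. frechet_derivative f (at (fst z)) (snd z)) has_derivative
    (\<lambda>z. frechet_derivative (\<lambda>z. frechet_derivative f (at z) y) (at x) (fst z) +
      frechet_derivative f (at x) (snd z))) (at (x, y))"
proof -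
  define G where "G = (\<lambda>z. frechet_derivative f (at (fst z)) (snd z))"
  have W: "open (S \<times> (UNIV :: 'a set))" using S by (rule open_Times) simp
  have "smooth_on G (S \<times> UNIV)"
    unfolding G_def
    by (rule smooth_on_frechet_derivative_apply[OF S f W _ smooth_on_fst[OF W] smooth_on_snd[OF W]]) auto
  then obtain G' where G': "(G has_derivative G') (at (x, y))"
    using smooth_on_has_derivative[OF W] x by blast
  have "((\<lambda>z. (z, y)) has_derivative (\<lambda>v. (v, 0))) (at x)"
    by (auto intro!: derivative_eq_intros)
  from diff_chain_at[OF this G']
  have "((\<lambda>z. frechet_derivative f (at z) y) has_derivative (\<lambda>v. G' (v, 0))) (at x)"
    by (simp add: o_def G_def)
  then have 1: "G' (v, 0) = frechet_derivative (\<lambda>z. frechet_derivative f (at z) y) (at x) v" for v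
    using frechet_derivative_at by metis
  have lin: "bounded_linear (frechet_derivative f (at x))"
    using smooth_on_has_derivative[OF S f x] has_derivative_bounded_linear by blast
  have "((\<lambda>w. (x, w)) has_derivative (\<lambda>w. (0, w))) (at y)"
    by (auto intro!: derivative_eq_intros)
  from diff_chain_at[OF this G']
  have "(frechet_derivative f (at x) has_derivative (\<lambda>w. G' (0, w))) (at y)"
    by (simp add: o_def G_def)
  then have "frechet_derivative f (at x) = (\<lambda>w. G' (0, w))"
    by (rule has_derivative_unique[OF bounded_linear_imp_has_derivative[OF lin]])
  then have 2: "G' (0, w) = frechet_derivative f (at x) w" for w by (rule fun_cong[symmetric])
  have "G' z = frechet_derivative (\<lambda>z. frechet_derivative f (at z) y) (at x) (fst z) +
      frechet_derivative f (at x) (snd z)" for z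
    using linear_add[OF has_derivative_linear[OF G'], of "(fst z, 0)" "(0, snd z)"] 1 2 by simp
  then have "G' = (\<lambda>z. frechet_derivative (\<lambda>z. frechet_derivative f (at z) y) (at x) (fst z) +
      frechet_derivative f (at x) (snd z))" by (rule ext)
  with G' show ?thesis unfolding G_def by simp
qed

section \<open>The spray of a Randers metric in coordinates\<close>

lemma linear_real_ops:
  fixes f :: "'a::real_vector \<Rightarrow> real"
  assumes "linear f"
  shows "f (v + w) = f v + f w" "f (v - w) = f v - f w" "f (- v) = - f v" "f (r *\<^sub>R v) = r * f v" "f 0 = 0"
  using assms by (simp_all add: linear_add linear_diff linear_neg linear_cmul linear_0)

text \<open>\<open>inverse_matrix\<close> is a choice among two-sided inverses, so one has to exist: the linear map with
  matrix \<open>a\<close> is injective, hence bijective, and its inverse provides the matrix.\<close>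

lemma inverse_matrix_inverse:
  fixes a :: "'e::euclidean_space \<Rightarrow> 'e \<Rightarrow> real"
  assumes "\<And>w. (\<And>i. i \<in> Basis \<Longrightarrow> (\<Sum>l\<in>Basis. a i l * (w \<bullet> l)) = 0) \<Longrightarrow> w = 0"
  shows "i \<in> Basis \<Longrightarrow> k \<in> Basis \<Longrightarrow> (\<Sum>l\<in>Basis. a i l * inverse_matrix a l k) = (if i = k then 1 else 0)"
proof -
  define f where "f w = (\<Sum>i\<in>Basis. (\<Sum>l\<in>Basis. a i l * (w \<bullet> l)) *\<^sub>R i)" for w :: 'e
  have f_inner: "f w \<bullet> i = (\<Sum>l\<in>Basis. a i l * (w \<bullet> l))" if "i \<in> Basis" for w i
    using that by (simp add: f_def inner_sum_left inner_Basis if_distrib cong: if_cong)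
  have lin: "linear f"
    by (rule linearI) (simp_all add: f_def inner_add_left algebra_simps sum.distrib scaleR_sum_right
        sum_distrib_left scaleR_sum_left)
  have "inj f"
    unfolding linear_injective_0[OF lin]
  proof (intro allI impI)
    fix w assume "f w = 0"
    then show "w = 0" using assms[of w] f_inner[of _ w] by simp
  qed
  then obtain g where g: "linear g" "\<And>x. g (f x) = x" "\<And>x. f (g x) = x"
    using linear_injective_isomorphism[OF lin] by blast
  define b where "b l k = g k \<bullet> l" for l k
  have 1: "(\<Sum>l\<in>Basis. a i l * b l k) = (if i = k then 1 else 0)" if "i \<in> Basis" "k \<in> Basis" for i k
    using f_inner[OF that(1), of "g k"] that by (auto simp: b_def g(3) inner_Basis)
  have 2: "(\<Sum>l\<in>Basis. b i l * a l k) = (if i = k then 1 else 0)" if "i \<in> Basis" "k \<in> Basis" for i k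
  proof -
    have "f k = (\<Sum>l\<in>Basis. a l k *\<^sub>R l)"
      using that by (simp add: f_def inner_Basis if_distrib cong: if_cong)
    then have "k \<bullet> i = g (\<Sum>l\<in>Basis. a l k *\<^sub>R l) \<bullet> i" using g(2)[of k] by simp
    also have "\<dots> = (\<Sum>l\<in>Basis. b i l * a l k)"
      by (simp add: linear_sum[OF g(1)] linear_cmul[OF g(1)] inner_sum_left b_def mult.commute)
    finally show ?thesis using that by (auto simp: inner_Basis)
  qed
  have "\<forall>i\<in>Basis. \<forall>k\<in>Basis.
     (\<Sum>l\<in>Basis. a i l * inverse_matrix a l k) = (if i = k then 1 else 0) \<and>
     (\<Sum>l\<in>Basis. inverse_matrix a i l * a l k) = (if i = k then 1 else 0)"
    unfolding inverse_matrix_def by (rule someI[of _ b]) (use 1 2 in blast)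
  then show "i \<in> Basis \<Longrightarrow> k \<in> Basis \<Longrightarrow> (\<Sum>l\<in>Basis. a i l * inverse_matrix a l k) = (if i = k then 1 else 0)"
    by blast
qed

text \<open>Contracting with the inverse matrix solves \<open>B(G, l) = e(l)\<close>. This converts index formulas, such as
  the one for the spray coefficients, into a characterization by a nondegenerate bilinear form.\<close>

lemma inverse_matrix_solve:
  fixes B :: "'e::euclidean_space \<Rightarrow> 'e \<Rightarrow> real"
  assumes lin: "\<And>v. linear (\<lambda>w. B v w)" and sym: "\<And>v w. B v w = B w v"
    and pos: "\<And>v. v \<noteq> 0 \<Longrightarrow> 0 < B v v"
    and m: "\<And>i j. i \<in> Basis \<Longrightarrow> j \<in> Basis \<Longrightarrow> m i j = B i j"
    and e: "linear e"
  shows "B (\<Sum>i\<in>Basis. (\<Sum>l\<in>Basis. inverse_matrix m i l * e l) *\<^sub>R i) l = e l"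
proof -
  let ?G = "\<Sum>i\<in>Basis. (\<Sum>l\<in>Basis. inverse_matrix m i l * e l) *\<^sub>R i"
  have inv: "(\<Sum>l\<in>Basis. m i l * inverse_matrix m l k) = (if i = k then 1 else 0)"
    if "i \<in> Basis" "k \<in> Basis" for i k
  proof (rule inverse_matrix_inverse[OF _ that])
    fix w :: 'e assume *: "\<And>i. i \<in> Basis \<Longrightarrow> (\<Sum>l\<in>Basis. m i l * (w \<bullet> l)) = 0"
    have "B i w = 0" if "i \<in> Basis" for i
      using *[OF that] linear_eq_sum_Basis[OF lin, of i w] that by (simp add: m mult.commute)
    then have "B w w = 0"
      using linear_eq_sum_Basis[OF lin, of w w] by (simp add: sym)
    then show "w = 0" using pos[of w] by force
  qed
  have base: "B ?G k = e k" if k: "k \<in> Basis" for k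
  proof -
    have "B ?G k = B k ?G" by (rule sym)
    also have "\<dots> = (\<Sum>i\<in>Basis. (\<Sum>l\<in>Basis. inverse_matrix m i l * e l) * m k i)"
      by (simp add: linear_sum[OF lin] linear_cmul[OF lin] m[OF k])
    also have "\<dots> = (\<Sum>i\<in>Basis. \<Sum>l\<in>Basis. m k i * inverse_matrix m i l * e l)"
      by (simp add: sum_distrib_left sum_distrib_right mult_ac)
    also have "\<dots> = (\<Sum>l\<in>Basis. (\<Sum>i\<in>Basis. m k i * inverse_matrix m i l) * e l)"
      by (subst sum.swap) (simp add: sum_distrib_right)
    also have "\<dots> = (\<Sum>l\<in>Basis. (if k = l then 1 else 0) * e l)"
      by (rule sum.cong) (simp_all add: inv k)
    also have "\<dots> = e k" using k by (simp add: if_distrib[of "\<lambda>r. r * _"] cong: if_cong)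
    finally show ?thesis .
  qed
  show ?thesis
    using linear_eq_sum_Basis[OF lin, of ?G l] linear_eq_sum_Basis[OF e, of l] base by simp
qed

text \<open>Partial derivatives depend only on the values near \<open>z\<close>, so an iterated one can be computed from a
  formula for the inner one that holds on an open set.\<close>

lemma partial_derivI:
  assumes "open W" "z \<in> W" "\<And>z'. z' \<in> W \<Longrightarrow> f z' = h z'"
    and "((\<lambda>t. h (z + t *\<^sub>R v)) has_real_derivative d) (at 0)"
  shows "partial_deriv v f z = d"
proof -
  have "open ((\<lambda>t::real. z + t *\<^sub>R v) -` W)"
    by (intro open_vimage assms) (auto intro!: continuous_intros)
  then have "((\<lambda>t. f (z + t *\<^sub>R v)) has_real_derivative d) (at 0)"
    by (rule has_field_derivative_transform_within_open[OF assms(4)]) (use assms in auto)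
  then show ?thesis unfolding partial_deriv_def by (rule DERIV_imp_deriv)
qed

text \<open>A Riemannian metric as seen in one chart, with \<open>U\<close> the image of the chart.\<close>

locale metric_data =
  fixes U :: "'e::euclidean_space set" and a :: "'e \<Rightarrow> 'e \<Rightarrow> 'e \<Rightarrow> real"
  assumes U: "open U"
    and a_linear: "x \<in> U \<Longrightarrow> linear (a x v)"
    and a_sym: "x \<in> U \<Longrightarrow> a x v w = a x w v"
    and a_pos: "x \<in> U \<Longrightarrow> v \<noteq> 0 \<Longrightarrow> 0 < a x v v"
    and a_smooth: "smooth_on (\<lambda>x. a x v w) U"
begin

lemmas a_ops = linear_real_ops[OF a_linear]

lemma a_ops_left:
  assumes "x \<in> U"
  shows "a x (v + w) u = a x v u + a x w u" "a x (v - w) u = a x v u - a x w u"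
    "a x (- v) u = - a x v u" "a x (r *\<^sub>R v) u = r * a x v u" "a x 0 u = 0"
  using a_ops[OF assms, of u] a_sym[OF assms, of u] by metis+

lemma a_nonneg: "x \<in> U \<Longrightarrow> 0 \<le> a x v v"
  using a_pos[of x v] by (cases "v = 0") (auto simp: a_ops)

text \<open>The vector \<open>w - r y\<close> with \<open>r = a(y, w) / a(y, y)\<close> is orthogonal to \<open>y\<close>, and its square norm times
  \<open>a(y, y)\<close> is the defect in the Cauchy-Schwarz inequality.\<close>

lemma a_Cauchy_Schwarz:
  assumes x: "x \<in> U" and y: "y \<noteq> 0"
  shows "(a x y w)\<^sup>2 \<le> a x y y * a x w w"
    and "(a x y w)\<^sup>2 = a x y y * a x w w \<Longrightarrow> w = (a x y w / a x y y) *\<^sub>R y"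
proof -
  define r where "r = a x y w / a x y y"
  let ?u = "w - r *\<^sub>R y"
  have pos: "a x y y > 0" using a_pos x y by blast
  then have r: "r * a x y y = a x y w" by (simp add: r_def)
  have "a x ?u ?u = a x w w - 2 * (r * a x y w) + r * (r * a x y y)"
    using a_sym[OF x, of w y] by (simp add: a_ops[OF x] a_ops_left[OF x] algebra_simps)
  also have "\<dots> = a x w w - r * a x y w" unfolding r by simp
  finally have uu: "a x ?u ?u = a x w w - r * a x y w" .
  have "a x y y * a x ?u ?u = a x y y * a x w w - (r * a x y y) * a x y w"
    unfolding uu by (simp add: algebra_simps)
  then have *: "a x y y * a x ?u ?u = a x y y * a x w w - (a x y w)\<^sup>2"
    unfolding r by (simp add: power2_eq_square)
  then show "(a x y w)\<^sup>2 \<le> a x y y * a x w w"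
    using mult_nonneg_nonneg[OF less_imp_le[OF pos] a_nonneg[OF x, of ?u]] by linarith
  show "w = (a x y w / a x y y) *\<^sub>R y" if "(a x y w)\<^sup>2 = a x y y * a x w w"
  proof (rule ccontr)
    assume "\<not> ?thesis"
    then have "?u \<noteq> 0" by (simp add: r_def)
    then have "a x y y * a x ?u ?u > 0" using a_pos[OF x] pos by simp
    then show False using * that by simp
  qed
qed

end

text \<open>A Randers metric \<open>\<alpha> + b\<close> as seen in one chart; the bound on \<open>b\<close> is the condition that its norm is
  less than one.\<close>

locale randers_data = metric_data U a for U :: "'e::euclidean_space set" and a +
  fixes b :: "'e \<Rightarrow> 'e \<Rightarrow> real"
  assumes b_linear: "x \<in> U \<Longrightarrow> linear (b x)"
    and b_smooth: "smooth_on (\<lambda>x. b x v) U"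
    and b_small: "x \<in> U \<Longrightarrow> v \<noteq> 0 \<Longrightarrow> \<bar>b x v\<bar> < sqrt (a x v v)"
begin

definition \<alpha> :: "'e \<Rightarrow> 'e \<Rightarrow> real" where "\<alpha> x y = sqrt (a x y y)"

definition F :: "'e \<Rightarrow> 'e \<Rightarrow> real" where "F x y = \<alpha> x y + b x y"

definition Da :: "'e \<Rightarrow> 'e \<Rightarrow> 'e \<Rightarrow> 'e \<Rightarrow> real" where
  "Da x m v w = frechet_derivative (\<lambda>x. a x v w) (at x) m"

definition Db :: "'e \<Rightarrow> 'e \<Rightarrow> 'e \<Rightarrow> real" where
  "Db x m v = frechet_derivative (\<lambda>x. b x v) (at x) m"

lemmas b_ops = linear_real_ops[OF b_linear]

lemma Da_deriv: "x \<in> U \<Longrightarrow> ((\<lambda>x. a x v w) has_derivative (\<lambda>m. Da x m v w)) (at x)"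
  unfolding Da_def using smooth_on_has_derivative[OF U a_smooth] by simp

lemma Db_deriv: "x \<in> U \<Longrightarrow> ((\<lambda>x. b x v) has_derivative (\<lambda>m. Db x m v)) (at x)"
  unfolding Db_def using smooth_on_has_derivative[OF U b_smooth] by simp

lemma deriv_unique_on_U:
  fixes f g :: "'e \<Rightarrow> real"
  assumes "x \<in> U" "(f has_derivative f') (at x)" "(g has_derivative g') (at x)"
    "\<And>x. x \<in> U \<Longrightarrow> f x = g x"
  shows "f' m = g' m"
  using has_derivative_unique[OF has_derivative_transform_within_open[OF assms(2) U assms(1,4)] assms(3)]
  by (rule fun_cong)

lemma Da_linear1: "x \<in> U \<Longrightarrow> linear (\<lambda>m. Da x m v w)"
  using Da_deriv has_derivative_linear by blast

lemma Db_linear1: "x \<in> U \<Longrightarrow> linear (\<lambda>m. Db x m v)"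
  using Db_deriv has_derivative_linear by blast

lemma Da_sym: "x \<in> U \<Longrightarrow> Da x m v w = Da x m w v"
  using a_sym by (intro deriv_unique_on_U[OF _ Da_deriv Da_deriv]) auto

lemma Da_linear: "x \<in> U \<Longrightarrow> linear (Da x m v)"
proof (rule linearI)
  assume x: "x \<in> U"
  show "Da x m v (w + u) = Da x m v w + Da x m v u" for w u
    by (rule deriv_unique_on_U[OF x Da_deriv[OF x] has_derivative_add[OF Da_deriv[OF x] Da_deriv[OF x]]])
      (simp add: a_ops)
  show "Da x m v (r *\<^sub>R w) = r *\<^sub>R Da x m v w" for r w
    by (rule deriv_unique_on_U[OF x Da_deriv[OF x] has_derivative_scaleR_right[OF Da_deriv[OF x]]])
      (simp add: a_ops)
qed

lemma Db_linear: "x \<in> U \<Longrightarrow> linear (Db x m)"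
proof (rule linearI)
  assume x: "x \<in> U"
  show "Db x m (w + u) = Db x m w + Db x m u" for w u
    by (rule deriv_unique_on_U[OF x Db_deriv[OF x] has_derivative_add[OF Db_deriv[OF x] Db_deriv[OF x]]])
      (simp add: b_ops)
  show "Db x m (r *\<^sub>R w) = r *\<^sub>R Db x m w" for r w
    by (rule deriv_unique_on_U[OF x Db_deriv[OF x] has_derivative_scaleR_right[OF Db_deriv[OF x]]])
      (simp add: b_ops)
qed

lemmas Da_ops1 = linear_real_ops[OF Da_linear1]
lemmas Da_ops = linear_real_ops[OF Da_linear]
lemmas Db_ops1 = linear_real_ops[OF Db_linear1]
lemmas Db_ops = linear_real_ops[OF Db_linear]

lemma Da_ops_left:
  assumes "x \<in> U"
  shows "Da x m (v + w) u = Da x m v u + Da x m w u" "Da x m (v - w) u = Da x m v u - Da x m w u"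
    "Da x m (- v) u = - Da x m v u" "Da x m (r *\<^sub>R v) u = r * Da x m v u" "Da x m 0 u = 0"
  using Da_ops[OF assms, of m u] Da_sym[OF assms, of m u] by metis+

lemma alpha_pos: "x \<in> U \<Longrightarrow> y \<noteq> 0 \<Longrightarrow> 0 < \<alpha> x y"
  by (simp add: \<alpha>_def a_pos)

lemma alpha_square: "x \<in> U \<Longrightarrow> \<alpha> x y * \<alpha> x y = a x y y"
  by (cases "y = 0") (simp_all add: \<alpha>_def a_ops abs_of_pos[OF a_pos])

lemma F_pos: "x \<in> U \<Longrightarrow> y \<noteq> 0 \<Longrightarrow> 0 < F x y"
  using b_small[of x y] by (auto simp: F_def \<alpha>_def)

lemma F_zero: "x \<in> U \<Longrightarrow> F x 0 = 0"
  by (simp add: F_def \<alpha>_def a_ops b_ops)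

lemma alpha_homogeneous: "x \<in> U \<Longrightarrow> 0 < r \<Longrightarrow> \<alpha> x (r *\<^sub>R y) = r * \<alpha> x y"
  by (simp add: \<alpha>_def a_ops a_ops_left real_sqrt_mult mult.assoc[symmetric])

lemma F_homogeneous: "x \<in> U \<Longrightarrow> 0 < r \<Longrightarrow> F x (r *\<^sub>R y) = r * F x y"
  by (simp add: F_def alpha_homogeneous b_ops algebra_simps)

lemma smooth_on_F: "smooth_on (\<lambda>(x, y). F x y) (U \<times> - {0})"
proof -
  let ?W = "U \<times> - {0::'e}"
  have W: "open ?W" using U by (intro open_Times) auto
  have f: "smooth_on (\<lambda>z. f (fst z)) ?W" if "smooth_on f U" for f :: "'e \<Rightarrow> real"
    by (rule smooth_on_compose[OF W U _ smooth_on_fst[OF W] that]) auto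
  have s: "smooth_on (\<lambda>z::'e \<times> 'e. snd z \<bullet> i) ?W" for i
    by (rule smooth_on_inner_left[OF W smooth_on_snd[OF W]])
  have A: "smooth_on (\<lambda>z. a (fst z) (snd z) (snd z)) ?W"
  proof (rule smooth_on_cong[OF W])
    show "smooth_on (\<lambda>z. \<Sum>i\<in>Basis. (snd z \<bullet> i) * (\<Sum>j\<in>Basis. (snd z \<bullet> j) * a (fst z) i j)) ?W"
      by (intro smooth_on_sum smooth_on_mult W s f a_smooth)
    show "(\<Sum>i\<in>Basis. (snd z \<bullet> i) * (\<Sum>j\<in>Basis. (snd z \<bullet> j) * a (fst z) i j)) = a (fst z) (snd z) (snd z)"
      if "z \<in> ?W" for z
    proof -
      have z: "fst z \<in> U" using that by auto
      show ?thesis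
        using linear_eq_sum_Basis[OF a_linear[OF z], of "snd z" "snd z"]
          linear_eq_sum_Basis[OF a_linear[OF z], of _ "snd z"]
        by (simp add: a_sym[OF z, of "snd z"])
    qed
  qed
  have "smooth_on (\<lambda>z. sqrt (a (fst z) (snd z) (snd z))) ?W"
    by (rule smooth_on_sqrt[OF W A]) (auto intro: a_pos)
  moreover have "smooth_on (\<lambda>z. b (fst z) (snd z)) ?W"
  proof (rule smooth_on_cong[OF W])
    show "smooth_on (\<lambda>z. \<Sum>i\<in>Basis. (snd z \<bullet> i) * b (fst z) i) ?W"
      by (intro smooth_on_sum smooth_on_mult W s f b_smooth)
    show "(\<Sum>i\<in>Basis. (snd z \<bullet> i) * b (fst z) i) = b (fst z) (snd z)" if "z \<in> ?W" for z
      using linear_eq_sum_Basis[OF b_linear[of "fst z"], of "snd z"] that by auto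
  qed
  ultimately show ?thesis
    using smooth_on_add[OF W] by (simp add: F_def \<alpha>_def case_prod_beta')
qed

text \<open>The derivative of \<open>F x\<close> at \<open>y\<close> in the fibre direction \<open>v\<close>.\<close>

definition Fy :: "'e \<Rightarrow> 'e \<Rightarrow> 'e \<Rightarrow> real" where
  "Fy x y v = a x y v / \<alpha> x y + b x v"

text \<open>The fundamental tensor \<open>\<^bold>g(v, w) = F\<^sub>y v F\<^sub>y w + F F\<^sub>y\<^sub>y(v, w)\<close>, as a bilinear form. Since \<open>b\<close> is
  linear, the Hessian \<open>F\<^sub>y\<^sub>y\<close> is that of \<open>\<alpha>\<close>.\<close>

definition fund :: "'e \<Rightarrow> 'e \<Rightarrow> 'e \<Rightarrow> 'e \<Rightarrow> real" where
  "fund x y v w = Fy x y v * Fy x y w + F x y * (a x v w / \<alpha> x y - a x y v * a x y w / \<alpha> x y ^ 3)"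

text \<open>The contraction \<open>[F\<^sup>2]\<^sub>x\<^sub>y(y, l) - [F\<^sup>2]\<^sub>x(l)\<close> from the definition of the spray coefficients, computed
  for \<open>F = \<alpha> + b\<close>.\<close>

definition spray_rhs :: "'e \<Rightarrow> 'e \<Rightarrow> 'e \<Rightarrow> real" where
  "spray_rhs x y l = 2 * Fy x y l * (Da x y y y / (2 * \<alpha> x y) + Db x y y)
     + 2 * F x y * (Da x y y l / \<alpha> x y - Da x y y y * a x y l / (2 * \<alpha> x y ^ 3) + Db x y l)
     - 2 * F x y * (Da x l y y / (2 * \<alpha> x y) + Db x l y)"

lemma fund_sym: "x \<in> U \<Longrightarrow> fund x y v w = fund x y w v"
  using a_sym[of x v w] by (simp add: fund_def mult.commute)

lemma fund_linear: "x \<in> U \<Longrightarrow> linear (fund x y v)"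
  by (rule linearI)
    (simp_all add: fund_def Fy_def a_ops b_ops add_divide_distrib diff_divide_distrib algebra_simps)

lemmas fund_ops = linear_real_ops[OF fund_linear]

lemma fund_ops_left:
  assumes "x \<in> U"
  shows "fund x y (v + w) u = fund x y v u + fund x y w u" "fund x y (v - w) u = fund x y v u - fund x y w u"
    "fund x y (r *\<^sub>R v) u = r * fund x y v u"
  using fund_ops[OF assms, of y u] fund_sym[OF assms, of y u] by metis+

lemma spray_rhs_linear: "x \<in> U \<Longrightarrow> linear (spray_rhs x y)"
  by (rule linearI)
    (simp_all add: spray_rhs_def Fy_def a_ops b_ops Da_ops Db_ops Da_ops1 Db_ops1
      add_divide_distrib diff_divide_distrib algebra_simps)

lemma Fy_self: "x \<in> U \<Longrightarrow> y \<noteq> 0 \<Longrightarrow> Fy x y y = F x y"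
  using alpha_square[of x y] alpha_pos[of x y] by (simp add: Fy_def F_def field_simps)

text \<open>By homogeneity the Hessian of \<open>\<alpha>\<close> annihilates \<open>y\<close>.\<close>

lemma fund_self:
  assumes "x \<in> U" "y \<noteq> 0"
  shows "fund x y y w = F x y * Fy x y w"
proof -
  have "a x y y / \<alpha> x y ^ 3 = 1 / \<alpha> x y"
    using alpha_pos[OF assms] unfolding alpha_square[OF assms(1), of y, symmetric]
    by (simp add: power3_eq_cube)
  then have "a x y w / \<alpha> x y - a x y y * a x y w / \<alpha> x y ^ 3 = 0"
    by (metis (no_types, lifting) cancel_comm_monoid_add_class.diff_cancel mult.commute mult.right_neutral times_divide_eq_right)
  then show ?thesis by (simp add: fund_def Fy_self[OF assms])
qed

text \<open>Both summands of \<open>fund x y w w\<close> are nonnegative. The Hessian of \<open>\<alpha>\<close> vanishes only on multiples of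
  \<open>y\<close>, and there the first summand is positive because \<open>F\<^sub>y y = F > 0\<close>.\<close>

lemma fund_pos:
  assumes x: "x \<in> U" and y: "y \<noteq> 0" and w: "w \<noteq> 0"
  shows "0 < fund x y w w"
proof -
  have al: "\<alpha> x y > 0" "F x y > 0" using alpha_pos F_pos x y by auto
  have eq: "a x w w / \<alpha> x y - a x y w * a x y w / \<alpha> x y ^ 3 = (a x y y * a x w w - (a x y w)\<^sup>2) / \<alpha> x y ^ 3"
    using al unfolding alpha_square[OF x, of y, symmetric]
    by (simp add: power3_eq_cube power2_eq_square field_simps)
  show ?thesis
  proof (cases "(a x y w)\<^sup>2 = a x y y * a x w w")
    case True
    define r where "r = a x y w / a x y y"
    have r: "w = r *\<^sub>R y" using a_Cauchy_Schwarz(2)[OF x y True] by (simp add: r_def)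
    then have "r \<noteq> 0" using w by auto
    have "fund x y w w = r * r * fund x y y y"
      unfolding r using fund_sym[OF x, of y "r *\<^sub>R y" y] by (simp add: linear_real_ops[OF fund_linear[OF x]])
    also have "fund x y y y = F x y * F x y" using fund_self[OF x y] Fy_self[OF x y] by simp
    finally show ?thesis using al \<open>r \<noteq> 0\<close> by (metis mult_pos_pos not_real_square_gt_zero)
  next
    case False
    then have "a x y y * a x w w - (a x y w)\<^sup>2 > 0" using a_Cauchy_Schwarz(1)[OF x y, of w] by linarith
    then have "F x y * (a x w w / \<alpha> x y - a x y w * a x y w / \<alpha> x y ^ 3) > 0"
      unfolding eq using al by simp
    then show ?thesis unfolding fund_def by (simp add: add_nonneg_pos)
  qed
qed

text \<open>The partial derivatives in \<open>spray_coeff\<close> are taken in purely horizontal or purely vertical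
  directions, so one-dimensional derivatives along such lines suffice.\<close>

lemma DERIV_a_horizontal: "x \<in> U \<Longrightarrow> ((\<lambda>t. a (x + t *\<^sub>R m) v w) has_real_derivative Da x m v w) (at 0)"
  and DERIV_b_horizontal: "x \<in> U \<Longrightarrow> ((\<lambda>t. b (x + t *\<^sub>R m) v) has_real_derivative Db x m v) (at 0)"
proof -
  have line: "((\<lambda>t. f (x + t *\<^sub>R m)) has_real_derivative f' m) (at 0)"
    if "(f has_derivative f') (at x)" for f :: "'e \<Rightarrow> real" and f'
  proof -
    have "((\<lambda>t::real. x + t *\<^sub>R m) has_derivative (\<lambda>s. s *\<^sub>R m)) (at 0)"
      by (auto intro!: derivative_eq_intros)
    then have "((\<lambda>t::real. f (x + t *\<^sub>R m)) has_derivative (\<lambda>s. f' (s *\<^sub>R m))) (at 0)"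
      using diff_chain_at[of "\<lambda>t::real. x + t *\<^sub>R m" _ 0 f f'] that by (simp add: o_def)
    moreover have "(\<lambda>s. f' (s *\<^sub>R m)) = (*) (f' m)"
      by (auto simp: linear_real_ops[OF has_derivative_linear[OF that]])
    ultimately show ?thesis by (simp add: has_field_derivative_def)
  qed
  show "((\<lambda>t. a (x + t *\<^sub>R m) v w) has_real_derivative Da x m v w) (at 0)" if "x \<in> U"
    by (rule line[OF Da_deriv[OF that]])
  show "((\<lambda>t. b (x + t *\<^sub>R m) v) has_real_derivative Db x m v) (at 0)" if "x \<in> U"
    by (rule line[OF Db_deriv[OF that]])
qed

lemma DERIV_linear_line:
  fixes f :: "'e \<Rightarrow> real"
  assumes "linear f"
  shows "((\<lambda>t. f (y + t *\<^sub>R l)) has_real_derivative f l) (at 0)"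
  by (auto simp: linear_real_ops[OF assms] intro!: derivative_eq_intros)

lemma DERIV_quadratic_line:
  fixes B :: "'e \<Rightarrow> 'e \<Rightarrow> real"
  assumes "\<And>v. linear (B v)" "\<And>v w. B v w = B w v"
  shows "((\<lambda>t. B (y + t *\<^sub>R l) (y + t *\<^sub>R l)) has_real_derivative 2 * B y l) (at 0)"
proof -
  have "B (y + t *\<^sub>R l) (y + t *\<^sub>R l) = B y y + t * (2 * B y l) + t * t * B l l" for t
    using assms(2)[of "y + t *\<^sub>R l" y] assms(2)[of "y + t *\<^sub>R l" l] assms(2)[of l y]
    by (simp add: linear_real_ops[OF assms(1)] algebra_simps)
  then show ?thesis by (auto intro!: derivative_eq_intros)
qed

lemma DERIV_alpha_horizontal:
  assumes "x \<in> U" "y \<noteq> 0"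
  shows "((\<lambda>t. \<alpha> (x + t *\<^sub>R m) y) has_real_derivative Da x m y y / (2 * \<alpha> x y)) (at 0)"
  unfolding \<alpha>_def
  by (rule DERIV_chain2[OF DERIV_real_sqrt DERIV_a_horizontal, THEN DERIV_cong])
    (use assms a_pos in \<open>auto simp: field_simps\<close>)

lemma DERIV_alpha_vertical:
  assumes "x \<in> U" "y \<noteq> 0"
  shows "((\<lambda>t. \<alpha> x (y + t *\<^sub>R l)) has_real_derivative a x y l / \<alpha> x y) (at 0)"
  unfolding \<alpha>_def
  by (rule DERIV_chain2[OF DERIV_real_sqrt DERIV_quadratic_line, THEN DERIV_cong])
    (use assms a_pos a_linear a_sym in \<open>auto simp: field_simps\<close>)

lemma DERIV_F_horizontal:
  assumes "x \<in> U" "y \<noteq> 0"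
  shows "((\<lambda>t. F (x + t *\<^sub>R m) y) has_real_derivative Da x m y y / (2 * \<alpha> x y) + Db x m y) (at 0)"
  unfolding F_def by (intro DERIV_add DERIV_alpha_horizontal DERIV_b_horizontal assms)

lemma DERIV_F_vertical:
  assumes "x \<in> U" "y \<noteq> 0"
  shows "((\<lambda>t. F x (y + t *\<^sub>R l)) has_real_derivative Fy x y l) (at 0)"
  unfolding F_def Fy_def
  by (intro DERIV_add DERIV_alpha_vertical DERIV_linear_line b_linear assms)

lemma DERIV_Fy_vertical:
  assumes "x \<in> U" "y \<noteq> 0"
  shows "((\<lambda>t. Fy x (y + t *\<^sub>R l) i) has_real_derivative a x i l / \<alpha> x y - a x y i * a x y l / \<alpha> x y ^ 3) (at 0)"
proof -
  have "((\<lambda>t. a x (y + t *\<^sub>R l) i) has_real_derivative a x l i) (at 0)"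
    using DERIV_linear_line[OF a_linear[OF assms(1), of i], of y l] by (simp add: a_sym[OF assms(1), of i])
  from DERIV_divide[OF this DERIV_alpha_vertical[OF assms]]
  have "((\<lambda>t. a x (y + t *\<^sub>R l) i / \<alpha> x (y + t *\<^sub>R l)) has_real_derivative
     (a x l i * \<alpha> x y - a x y i * (a x y l / \<alpha> x y)) / (\<alpha> x y * \<alpha> x y)) (at 0)"
    using alpha_pos[OF assms] by simp
  moreover have "(a x l i * \<alpha> x y - a x y i * (a x y l / \<alpha> x y)) / (\<alpha> x y * \<alpha> x y) =
      a x i l / \<alpha> x y - a x y i * a x y l / \<alpha> x y ^ 3"
    using alpha_pos[OF assms] a_sym[OF assms(1), of l i] by (simp add: power3_eq_cube field_simps)
  ultimately have "((\<lambda>t. a x (y + t *\<^sub>R l) i / \<alpha> x (y + t *\<^sub>R l) + b x i) has_real_derivative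
      a x i l / \<alpha> x y - a x y i * a x y l / \<alpha> x y ^ 3 + 0) (at 0)"
    by (intro DERIV_add) auto
  then show ?thesis by (simp add: Fy_def)
qed

definition quadratic_spray :: "('e \<Rightarrow> 'e \<Rightarrow> 'e \<Rightarrow> 'e \<Rightarrow> real) \<Rightarrow> 'e \<Rightarrow> 'e \<Rightarrow> 'e" where
  "quadratic_spray \<Gamma> x y =
     (\<Sum>i\<in>Basis. (1/2 * (\<Sum>j\<in>Basis. \<Sum>k\<in>Basis. \<Gamma> i j k x * (y \<bullet> j) * (y \<bullet> k))) *\<^sub>R i)"

lemma quadratic_spray_inner:
  "i \<in> Basis \<Longrightarrow> quadratic_spray \<Gamma> x y \<bullet> i =
     1/2 * (\<Sum>j\<in>Basis. \<Sum>k\<in>Basis. \<Gamma> i j k x * (y \<bullet> j) * (y \<bullet> k))"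
  by (simp add: quadratic_spray_def inner_sum_left inner_Basis if_distrib cong: if_cong)

text \<open>The Christoffel symbols of \<open>a\<close> before symmetrization in \<open>j\<close> and \<open>k\<close>, an operation that does not
  change their contraction with \<open>y\<^sup>j y\<^sup>k\<close>.\<close>

definition levi_civita :: "'e \<Rightarrow> 'e \<Rightarrow> 'e \<Rightarrow> 'e \<Rightarrow> real" where
  "levi_civita i j k x = (\<Sum>l\<in>Basis. inverse_matrix (a x) i l * (Da x j k l - 1/2 * Da x l j k))"

text \<open>The geodesic spray of \<open>a\<close> is characterized without indices, which is the form in which it is
  compared with the spray of \<open>F\<close>.\<close>

lemma levi_civita_spray:
  assumes x: "x \<in> U"
  shows "a x (quadratic_spray levi_civita x y) l = 1/2 * Da x y y l - 1/4 * Da x l y y"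
proof -
  have bilinear: "(\<Sum>j\<in>Basis. \<Sum>k\<in>Basis. B j k * (y \<bullet> j) * (y \<bullet> k)) = B y y"
    if "\<And>v. linear (B v)" "\<And>w. linear (\<lambda>v. B v w)" for B :: "'e \<Rightarrow> 'e \<Rightarrow> real"
  proof -
    have "B y y = (\<Sum>j\<in>Basis. (y \<bullet> j) * (\<Sum>k\<in>Basis. (y \<bullet> k) * B j k))"
      using linear_eq_sum_Basis[OF that(2)[of y], of y] linear_eq_sum_Basis[OF that(1), of _ y] by simp
    then show ?thesis by (simp add: sum_distrib_left mult_ac)
  qed
  let ?B = "\<lambda>l j k. Da x j k l - 1/2 * Da x l j k"
  have B: "(\<Sum>j\<in>Basis. \<Sum>k\<in>Basis. ?B l j k * (y \<bullet> j) * (y \<bullet> k)) = ?B l y y" for l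
    by (rule bilinear; rule linearI; simp add: Da_ops[OF x] Da_ops1[OF x] Da_ops_left[OF x] algebra_simps)
  have "1/2 * (\<Sum>j\<in>Basis. \<Sum>k\<in>Basis. levi_civita i j k x * (y \<bullet> j) * (y \<bullet> k)) =
      (\<Sum>l\<in>Basis. inverse_matrix (a x) i l * (1/2 * ?B l y y))" for i
  proof -
    have "(\<Sum>j\<in>Basis. \<Sum>k\<in>Basis. levi_civita i j k x * (y \<bullet> j) * (y \<bullet> k)) =
        (\<Sum>j\<in>Basis. \<Sum>k\<in>Basis. \<Sum>l\<in>Basis. inverse_matrix (a x) i l * (?B l j k * (y \<bullet> j) * (y \<bullet> k)))"
      by (simp add: levi_civita_def sum_distrib_right mult.assoc)
    also have "\<dots> = (\<Sum>j\<in>Basis. \<Sum>l\<in>Basis. \<Sum>k\<in>Basis. inverse_matrix (a x) i l * (?B l j k * (y \<bullet> j) * (y \<bullet> k)))"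
      by (rule sum.cong[OF refl]) (rule sum.swap)
    also have "\<dots> = (\<Sum>l\<in>Basis. \<Sum>j\<in>Basis. \<Sum>k\<in>Basis. inverse_matrix (a x) i l * (?B l j k * (y \<bullet> j) * (y \<bullet> k)))"
      by (rule sum.swap)
    also have "\<dots> = (\<Sum>l\<in>Basis. inverse_matrix (a x) i l * ?B l y y)"
      by (simp only: sum_distrib_left[symmetric] B)
    finally show ?thesis by (simp add: sum_divide_distrib)
  qed
  then have eq: "quadratic_spray levi_civita x y =
      (\<Sum>i\<in>Basis. (\<Sum>l\<in>Basis. inverse_matrix (a x) i l * (1/2 * ?B l y y)) *\<^sub>R i)"
    unfolding quadratic_spray_def by simp
  have lin: "linear (\<lambda>l. 1/2 * ?B l y y)"
    by (rule linearI) (simp_all add: Da_ops[OF x] Da_ops1[OF x] algebra_simps)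
  have "a x (quadratic_spray levi_civita x y) l = 1/2 * ?B l y y"
    unfolding eq by (rule inverse_matrix_solve[OF a_linear[OF x] a_sym[OF x] a_pos[OF x] refl lin])
  then show ?thesis by simp
qed

text \<open>The coefficient of \<open>y\<close> in the spray of \<open>F\<close> for closed \<open>b\<close>. It is forced by the equation for the
  spray in direction \<open>y\<close>, using \<open>\<^bold>g(y, l) = F F\<^sub>y l\<close>.\<close>

definition projective_factor :: "'e \<Rightarrow> 'e \<Rightarrow> real" where
  "projective_factor x y = (1/2 * (Da x y y y / (2 * \<alpha> x y) + Db x y y) - Fy x y (quadratic_spray levi_civita x y)) / F x y"

text \<open>The decisive identity: up to the term with the exterior derivative \<open>db(y, l)\<close>, the vector
  \<open>S + P y\<close>, where \<open>S\<close> is the geodesic spray of \<open>a\<close>, solves the equation that defines the spray of \<open>F\<close>.\<close>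

lemma spray_rhs_decomposition:
  assumes x: "x \<in> U" and y: "y \<noteq> 0"
  shows "1/4 * spray_rhs x y l = fund x y (quadratic_spray levi_civita x y + projective_factor x y *\<^sub>R y) l
    + 1/2 * F x y * (Db x y l - Db x l y)"
proof -
  let ?G = "quadratic_spray levi_civita x y" and ?S = "Da x y y y / (2 * \<alpha> x y) + Db x y y"
  have al: "\<alpha> x y > 0" "F x y > 0" using alpha_pos F_pos x y by auto
  have G: "a x ?G l = 1/2 * Da x y y l - 1/4 * Da x l y y" by (rule levi_civita_spray[OF x])
  have yG: "a x y ?G = 1/4 * Da x y y y"
    using levi_civita_spray[OF x, of y y] a_sym[OF x, of y ?G] by simp
  \<comment> \<open>The projective factor is chosen such that the coefficients of \<open>F\<^sub>y\<close> match.\<close>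
  have PF: "projective_factor x y * F x y = 1/2 * ?S - Fy x y ?G" using al by (simp add: projective_factor_def)
  have "fund x y (?G + projective_factor x y *\<^sub>R y) l = fund x y ?G l + projective_factor x y * F x y * Fy x y l"
    by (simp add: fund_ops_left[OF x] fund_self[OF x y])
  also have "\<dots> = 1/2 * ?S * Fy x y l + F x y * (a x ?G l / \<alpha> x y - a x y ?G * a x y l / \<alpha> x y ^ 3)"
    unfolding PF fund_def by (simp add: algebra_simps)
  finally have "fund x y (?G + projective_factor x y *\<^sub>R y) l =
      1/2 * ?S * Fy x y l + F x y * (a x ?G l / \<alpha> x y - a x y ?G * a x y l / \<alpha> x y ^ 3)" .
  then show ?thesis
    unfolding G yG spray_rhs_def by (simp add: add_divide_distrib diff_divide_distrib algebra_simps)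
qed

lemma projective_factor_homogeneous:
  assumes x: "x \<in> U" and "y \<noteq> 0" and r: "r > 0"
  shows "projective_factor x (r *\<^sub>R y) = r * projective_factor x y"
proof -
  note al = alpha_homogeneous[OF x r, of y] and F = F_homogeneous[OF x r, of y]
  have G: "quadratic_spray levi_civita x (r *\<^sub>R y) = (r * r) *\<^sub>R quadratic_spray levi_civita x y"
    by (simp add: quadratic_spray_def scaleR_sum_right sum_distrib_left mult_ac)
  have Fy: "Fy x (r *\<^sub>R y) w = Fy x y w" for w using r by (simp add: Fy_def al a_ops_left[OF x])
  have Fyr: "Fy x y (s *\<^sub>R w) = s * Fy x y w" for s w
    by (simp add: Fy_def a_ops[OF x] b_ops[OF x] algebra_simps)
  have "Da x (r *\<^sub>R y) (r *\<^sub>R y) (r *\<^sub>R y) / (2 * (r * \<alpha> x y)) = r * r * (Da x y y y / (2 * \<alpha> x y))"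
    using r by (simp add: Da_ops[OF x] Da_ops1[OF x] Da_ops_left[OF x])
  then have "projective_factor x (r *\<^sub>R y) = (r * r * (1/2 * (Da x y y y / (2 * \<alpha> x y) + Db x y y)
      - Fy x y (quadratic_spray levi_civita x y))) / (r * F x y)"
    unfolding projective_factor_def al F G Fy Fyr by (simp add: Db_ops[OF x] Db_ops1[OF x] algebra_simps)
  then show ?thesis using r by (simp add: projective_factor_def)
qed

text \<open>The coordinate expression of a Finsler function is arbitrary outside the image of the chart,
  so \<open>L\<close> agrees with \<open>F\<^sup>2\<close> over \<open>U\<close> only.\<close>

context
  fixes L :: "'e \<times> 'e \<Rightarrow> real"
  assumes L: "\<And>x y. x \<in> U \<Longrightarrow> L (x, y) = (F x y)\<^sup>2"
begin

lemma open_slit: "open (U \<times> - {0::'e})"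
  using U by (intro open_Times) auto

lemma partial_vertical:
  assumes "x \<in> U" "y \<noteq> 0"
  shows "partial_deriv (0, l) L (x, y) = 2 * F x y * Fy x y l"
proof (rule partial_derivI[OF open_slit])
  show "((\<lambda>t. (\<lambda>(x, y). (F x y)\<^sup>2) ((x, y) + t *\<^sub>R (0, l))) has_real_derivative 2 * F x y * Fy x y l) (at 0)"
    using DERIV_power[OF DERIV_F_vertical[OF assms, of l], of 2] by (simp add: mult_ac)
qed (use assms L in auto)

lemma partial_horizontal:
  assumes "x \<in> U" "y \<noteq> 0"
  shows "partial_deriv (m, 0) L (x, y) = 2 * F x y * (Da x m y y / (2 * \<alpha> x y) + Db x m y)"
proof (rule partial_derivI[OF open_slit])
  show "((\<lambda>t. (\<lambda>(x, y). (F x y)\<^sup>2) ((x, y) + t *\<^sub>R (m, 0))) has_real_derivative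
     2 * F x y * (Da x m y y / (2 * \<alpha> x y) + Db x m y)) (at 0)"
    using DERIV_power[OF DERIV_F_horizontal[OF assms, of m], of 2] by (simp add: mult_ac)
qed (use assms L in auto)

lemma fundamental_tensor_eq:
  assumes "x \<in> U" "y \<noteq> 0"
  shows "fundamental_tensor L (x, y) i j = fund x y i j"
proof -
  have "partial_deriv (0, j) (partial_deriv (0, i) L) (x, y) = 2 * fund x y i j"
  proof (rule partial_derivI[OF open_slit])
    show "((\<lambda>t. (\<lambda>(x, y). 2 * F x y * Fy x y i) ((x, y) + t *\<^sub>R (0, j))) has_real_derivative 2 * fund x y i j) (at 0)"
      using DERIV_cmult[OF DERIV_mult[OF DERIV_F_vertical[OF assms, of j] DERIV_Fy_vertical[OF assms, of j i]], of 2]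
      by (simp add: fund_def algebra_simps)
  qed (use assms partial_vertical in auto)
  then show ?thesis by (simp add: fundamental_tensor_def)
qed

lemma partial_mixed:
  assumes x: "x \<in> U" and y: "y \<noteq> 0"
  shows "partial_deriv (0, l) (partial_deriv (m, 0) L) (x, y) =
    2 * Fy x y l * (Da x m y y / (2 * \<alpha> x y) + Db x m y)
     + 2 * F x y * (Da x m y l / \<alpha> x y - Da x m y y * a x y l / (2 * \<alpha> x y ^ 3) + Db x m l)" (is "_ = ?r")
proof (rule partial_derivI[OF open_slit])
  have 1: "((\<lambda>t. Da x m (y + t *\<^sub>R l) (y + t *\<^sub>R l)) has_real_derivative 2 * Da x m y l) (at 0)"
    by (rule DERIV_quadratic_line) (use Da_linear Da_sym x in auto)
  have 2: "((\<lambda>t. 2 * \<alpha> x (y + t *\<^sub>R l)) has_real_derivative 2 * (a x y l / \<alpha> x y)) (at 0)"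
    by (rule DERIV_cmult[OF DERIV_alpha_vertical[OF x y]])
  have 3: "((\<lambda>t. Da x m (y + t *\<^sub>R l) (y + t *\<^sub>R l) / (2 * \<alpha> x (y + t *\<^sub>R l)) + Db x m (y + t *\<^sub>R l)) has_real_derivative
      Da x m y l / \<alpha> x y - Da x m y y * a x y l / (2 * \<alpha> x y ^ 3) + Db x m l) (at 0)"
    by (rule DERIV_add[OF DERIV_divide[OF 1 2] DERIV_linear_line[OF Db_linear[OF x]], THEN DERIV_cong])
      (use alpha_pos[OF x y] in \<open>auto simp: power3_eq_cube field_simps\<close>)
  show "((\<lambda>t. (\<lambda>(x, y). 2 * F x y * (Da x m y y / (2 * \<alpha> x y) + Db x m y)) ((x, y) + t *\<^sub>R (0, l)))
      has_real_derivative ?r) (at 0)"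
    using DERIV_mult[OF DERIV_cmult[OF DERIV_F_vertical[OF x y], of 2] 3]
    by (simp add: algebra_simps)
qed (use assms partial_horizontal in auto)

lemma spray_numerator_eq:
  assumes x: "x \<in> U" and y: "y \<noteq> 0"
  shows "(\<Sum>m\<in>Basis. partial_deriv (0, l) (partial_deriv (m, 0) L) (x, y) * (snd (x, y) \<bullet> m))
        - partial_deriv (l, 0) L (x, y) = spray_rhs x y l"
proof -
  let ?T = "\<lambda>m. partial_deriv (0, l) (partial_deriv (m, 0) L) (x, y)"
  have "linear ?T"
    by (rule linearI) (simp_all add: partial_mixed[OF x y] Da_ops1[OF x] Db_ops1[OF x]
      add_divide_distrib diff_divide_distrib algebra_simps)
  from linear_eq_sum_Basis[OF this, of y]
  have "(\<Sum>m\<in>Basis. ?T m * (snd (x, y) \<bullet> m)) = ?T y" by (simp add: mult.commute)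
  then show ?thesis by (simp add: partial_mixed[OF x y] partial_horizontal[OF x y] spray_rhs_def)
qed

lemma spray_coeff_iff:
  assumes x: "x \<in> U" and y: "y \<noteq> 0"
  shows "(\<forall>i\<in>Basis. spray_coeff L (x, y) i = G \<bullet> i) \<longleftrightarrow> (\<forall>l. fund x y G l = 1/4 * spray_rhs x y l)"
proof -
  let ?S = "\<Sum>i\<in>Basis. spray_coeff L (x, y) i *\<^sub>R i"
  have "spray_coeff L (x, y) i =
      (\<Sum>l\<in>Basis. inverse_matrix (fundamental_tensor L (x, y)) i l * (1/4 * spray_rhs x y l))" for i
    unfolding spray_coeff_def spray_numerator_eq[OF x y]
    by (simp add: sum_distrib_left sum_divide_distrib)
  then have S: "?S = (\<Sum>i\<in>Basis. (\<Sum>l\<in>Basis. inverse_matrix (fundamental_tensor L (x, y)) i l * (1/4 * spray_rhs x y l)) *\<^sub>R i)"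
    by simp
  have lin: "linear (\<lambda>l. 1/4 * spray_rhs x y l)"
    by (intro linearI) (simp_all add: linear_real_ops[OF spray_rhs_linear[OF x]] algebra_simps)
  have hS: "fund x y ?S l = 1/4 * spray_rhs x y l" for l
    unfolding S
    by (rule inverse_matrix_solve[OF fund_linear[OF x] fund_sym[OF x] fund_pos[OF x y] fundamental_tensor_eq[OF x y] lin])
  have comp: "?S \<bullet> i = spray_coeff L (x, y) i" if "i \<in> Basis" for i
    using that by (simp add: inner_sum_left inner_Basis if_distrib cong: if_cong)
  show ?thesis
  proof
    assume "\<forall>i\<in>Basis. spray_coeff L (x, y) i = G \<bullet> i"
    then have "?S = G" by (simp add: euclidean_representation)
    then show "\<forall>l. fund x y G l = 1/4 * spray_rhs x y l" using hS by simp
  next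
    assume "\<forall>l. fund x y G l = 1/4 * spray_rhs x y l"
    then have "fund x y (G - ?S) (G - ?S) = 0"
      by (simp add: fund_ops_left[OF x] hS)
    then have "G - ?S = 0" using fund_pos[OF x y, of "G - ?S"] by force
    then have "G = ?S" by simp
    then show "\<forall>i\<in>Basis. spray_coeff L (x, y) i = G \<bullet> i" using comp by simp
  qed
qed

text \<open>If \<open>b\<close> is closed, the previous decomposition exhibits the spray in Douglas form. Conversely, let the
  spray be \<open>Q + P' y\<close> with \<open>Q\<close> quadratic, and let \<open>R\<close> be \<open>Q\<close> minus the geodesic spray of \<open>a\<close>. Subtracting
  the decomposition gives \<open>\<^bold>g(R + (P' - P) y, l) = F db(y, l) / 2\<close>. For \<open>l = y\<close> this shows that the
  part along \<open>F\<^sub>y\<close> vanishes, and what remains is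
  \<open>a(R, l) - a(y, R) a(y, l) / \<alpha>\<^sup>2 = \<alpha> db(y, l) / 2\<close>. The left-hand side is even in \<open>y\<close> and
  the right-hand side is odd, so both are zero.\<close>

lemma Douglas_form_iff:
  "(\<exists>(\<Gamma> :: 'e \<Rightarrow> 'e \<Rightarrow> 'e \<Rightarrow> 'e \<Rightarrow> real) (P :: 'e \<Rightarrow> 'e \<Rightarrow> real).
     (\<forall>x\<in>U. \<forall>y. y \<noteq> 0 \<longrightarrow> (\<forall>r>0. P x (r *\<^sub>R y) = r * P x y)) \<and>
     (\<forall>x\<in>U. \<forall>y. y \<noteq> 0 \<longrightarrow> (\<forall>i\<in>Basis. spray_coeff L (x, y) i =
        1/2 * (\<Sum>j\<in>Basis. \<Sum>k\<in>Basis. \<Gamma> i j k x * (y \<bullet> j) * (y \<bullet> k)) + P x y * (y \<bullet> i))))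
   \<longleftrightarrow> (\<forall>x\<in>U. \<forall>v w. Db x v w = Db x w v)" (is "?D \<longleftrightarrow> ?C")
proof
  assume closed: ?C
  have "spray_coeff L (x, y) i =
      1/2 * (\<Sum>j\<in>Basis. \<Sum>k\<in>Basis. levi_civita i j k x * (y \<bullet> j) * (y \<bullet> k)) + projective_factor x y * (y \<bullet> i)"
    if x: "x \<in> U" and y: "y \<noteq> 0" and i: "i \<in> Basis" for x y i
  proof -
    have "\<forall>l. fund x y (quadratic_spray levi_civita x y + projective_factor x y *\<^sub>R y) l = 1/4 * spray_rhs x y l"
      using spray_rhs_decomposition[OF x y] closed x by simp
    then have "spray_coeff L (x, y) i = (quadratic_spray levi_civita x y + projective_factor x y *\<^sub>R y) \<bullet> i"
      using spray_coeff_iff[OF x y] i by blast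
    then show ?thesis using quadratic_spray_inner[OF i] by (simp add: inner_add_left)
  qed
  moreover have "projective_factor x (r *\<^sub>R y) = r * projective_factor x y" if "x \<in> U" "y \<noteq> 0" "r > 0" for x y r
    by (rule projective_factor_homogeneous[OF that])
  ultimately show ?D by (intro exI[of _ levi_civita] exI[of _ projective_factor]) blast
next
  assume ?D
  then obtain \<Gamma> :: "'e \<Rightarrow> 'e \<Rightarrow> 'e \<Rightarrow> 'e \<Rightarrow> real" and P :: "'e \<Rightarrow> 'e \<Rightarrow> real" where
    D: "\<And>x y i. x \<in> U \<Longrightarrow> y \<noteq> 0 \<Longrightarrow> i \<in> Basis \<Longrightarrow> spray_coeff L (x, y) i =
        1/2 * (\<Sum>j\<in>Basis. \<Sum>k\<in>Basis. \<Gamma> i j k x * (y \<bullet> j) * (y \<bullet> k)) + P x y * (y \<bullet> i)"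
    by blast
  show ?C
  proof (intro ballI allI)
    fix x y l assume x: "x \<in> U"
    define R where "R y = quadratic_spray \<Gamma> x y - quadratic_spray levi_civita x y" for y
    have R_even: "R (- y) = R y" for y by (simp add: R_def quadratic_spray_def)
    have even_odd: "a x (R y) l - a x y (R y) * a x y l / (\<alpha> x y * \<alpha> x y) = 1/2 * \<alpha> x y * (Db x y l - Db x l y)"
      if y: "y \<noteq> 0" for y l
    proof -
      have al: "\<alpha> x y > 0" "F x y > 0" using alpha_pos F_pos x y by auto
      have "\<forall>i\<in>Basis. spray_coeff L (x, y) i = (quadratic_spray \<Gamma> x y + P x y *\<^sub>R y) \<bullet> i"
        using D[OF x y] quadratic_spray_inner by (simp add: inner_add_left)
      then have spray: "fund x y (quadratic_spray \<Gamma> x y + P x y *\<^sub>R y) l = 1/4 * spray_rhs x y l" for l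
        using spray_coeff_iff[OF x y] by blast
      have split_spray: "quadratic_spray \<Gamma> x y + P x y *\<^sub>R y =
          (quadratic_spray levi_civita x y + projective_factor x y *\<^sub>R y) + (R y + (P x y - projective_factor x y) *\<^sub>R y)"
        by (simp add: R_def algebra_simps)
      have "fund x y (R y + (P x y - projective_factor x y) *\<^sub>R y) l = 1/2 * F x y * (Db x y l - Db x l y)" for l
        using spray[of l, unfolded split_spray fund_ops_left(1)[OF x, of y "quadratic_spray levi_civita x y + projective_factor x y *\<^sub>R y"]]
          spray_rhs_decomposition[OF x y, of l] by linarith
      then have hR: "fund x y (R y) l + (P x y - projective_factor x y) * (F x y * Fy x y l) =
          1/2 * F x y * (Db x y l - Db x l y)" for l
        by (simp add: fund_ops_left[OF x] fund_self[OF x y])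
      \<comment> \<open>The coefficient of \<open>F\<^sub>y\<close>, which testing against \<open>y\<close> shows to vanish.\<close>
      let ?c = "Fy x y (R y) + (P x y - projective_factor x y) * F x y"
      have split: "?c * Fy x y l + F x y * (a x (R y) l / \<alpha> x y - a x y (R y) * a x y l / \<alpha> x y ^ 3) =
          1/2 * F x y * (Db x y l - Db x l y)" for l
        using hR[of l] by (simp add: fund_def algebra_simps)
      have "a x (R y) y / \<alpha> x y - a x y (R y) * a x y y / \<alpha> x y ^ 3 = 0"
        using al a_sym[OF x, of "R y" y] unfolding alpha_square[OF x, of y, symmetric]
        by (simp add: power3_eq_cube)
      then have "?c * F x y = 0" using split[of y] Fy_self[OF x y] by simp
      then have "?c = 0" using al by simp
      then have "F x y * (a x (R y) l / \<alpha> x y - a x y (R y) * a x y l / \<alpha> x y ^ 3) =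
          F x y * (1/2 * (Db x y l - Db x l y))" using split[of l] by simp
      then have "a x (R y) l / \<alpha> x y - a x y (R y) * a x y l / \<alpha> x y ^ 3 = 1/2 * (Db x y l - Db x l y)"
        using al by simp
      then have "\<alpha> x y * (a x (R y) l / \<alpha> x y - a x y (R y) * a x y l / \<alpha> x y ^ 3) =
          \<alpha> x y * (1/2 * (Db x y l - Db x l y))" by simp
      then show ?thesis using al by (simp add: right_diff_distrib power3_eq_cube)
    qed
    \<comment> \<open>Comparison of \<open>even_odd\<close> at \<open>y\<close> and at \<open>- y\<close>.\<close>
    show "Db x y l = Db x l y"
    proof (cases "y = 0")
      case True
      then show ?thesis using x by (simp add: Db_ops Db_ops1)
    next
      case False
      have "\<alpha> x (- y) = \<alpha> x y" by (simp add: \<alpha>_def a_ops[OF x] a_ops_left[OF x])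
      then have "\<alpha> x y * (Db x y l - Db x l y) = - (\<alpha> x y * (Db x y l - Db x l y))"
        using even_odd[of y l] even_odd[of "- y" l] False R_even[of y]
        by (simp add: a_ops[OF x] a_ops_left[OF x] Db_ops[OF x] Db_ops1[OF x] right_diff_distrib)
      then show ?thesis using alpha_pos[OF x False] by simp
    qed
  qed
qed

lemma fundamental_tensor_pos:
  assumes x: "x \<in> U" and y: "y \<noteq> 0" and w: "w \<noteq> 0"
  shows "0 < (\<Sum>i\<in>Basis. \<Sum>j\<in>Basis. fundamental_tensor L (x, y) i j * (w \<bullet> i) * (w \<bullet> j))"
proof -
  have "fund x y w w = (\<Sum>i\<in>Basis. (w \<bullet> i) * (\<Sum>j\<in>Basis. (w \<bullet> j) * fund x y i j))"
    using linear_eq_sum_Basis[OF fund_linear[OF x], of y w w] linear_eq_sum_Basis[OF fund_linear[OF x], of y _ w]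
    by (simp add: fund_sym[OF x, of y w])
  also have "\<dots> = (\<Sum>i\<in>Basis. \<Sum>j\<in>Basis. fundamental_tensor L (x, y) i j * (w \<bullet> i) * (w \<bullet> j))"
    by (simp add: fundamental_tensor_eq[OF x y] sum_distrib_left mult_ac)
  finally show ?thesis using fund_pos[OF x y w] by simp
qed

end

end

section \<open>Randers metrics on manifolds\<close>

text \<open>The conditions on charts alone, in the form in which they pass from a manifold to its
  tangent bundle.\<close>

locale smooth_atlas =
  fixes A :: "('a, 'e::euclidean_space) chart set"
  assumes inj_coord: "c \<in> A \<Longrightarrow> inj_on (coord c) (cdom c)"
    and open_coord: "c \<in> A \<Longrightarrow> open (coord c ` cdom c)"
    and open_overlap: "c \<in> A \<Longrightarrow> d \<in> A \<Longrightarrow> open (coord c ` (cdom c \<inter> cdom d))"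
    and smooth_transition: "c \<in> A \<Longrightarrow> d \<in> A \<Longrightarrow>
      smooth_on (coord d \<circ> param c) (coord c ` (cdom c \<inter> cdom d))"

lemma smooth_manifold_smooth_atlas: "smooth_manifold A \<Longrightarrow> smooth_atlas A"
  by (simp add: smooth_manifold_def smooth_atlas_def)

context smooth_atlas
begin

lemma param_coord [simp]: "c \<in> A \<Longrightarrow> p \<in> cdom c \<Longrightarrow> param c (coord c p) = p"
  by (rule inv_into_f_f[OF inj_coord])

lemma param_in_cdom: "x \<in> coord c ` cdom c \<Longrightarrow> param c x \<in> cdom c"
  by (rule inv_into_into)

lemma coord_param: "x \<in> coord c ` cdom c \<Longrightarrow> coord c (param c x) = x"
  by (rule f_inv_into_f)

lemma param_in_points: "c \<in> A \<Longrightarrow> x \<in> coord c ` cdom c \<Longrightarrow> param c x \<in> points A"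
  unfolding points_def by (rule UN_I[where a = c]) (simp_all add: param_in_cdom)

abbreviation transition :: "('a, 'e) chart \<Rightarrow> ('a, 'e) chart \<Rightarrow> 'a \<Rightarrow> 'e \<Rightarrow> 'e" where
  "transition c d p \<equiv> frechet_derivative (coord d \<circ> param c) (at (coord c p))"

lemma transition_has_derivative:
  assumes "c \<in> A" "d \<in> A" "p \<in> cdom c" "p \<in> cdom d"
  shows "((coord d \<circ> param c) has_derivative transition c d p) (at (coord c p))"
  using assms by (intro smooth_on_has_derivative[OF open_overlap smooth_transition]) auto

lemma linear_transition:
  assumes "c \<in> A" "d \<in> A" "p \<in> cdom c" "p \<in> cdom d"
  shows "linear (transition c d p)"
  using transition_has_derivative[OF assms] has_derivative_linear by blast

lemma transition_self [simp]:
  assumes "c \<in> A" "p \<in> cdom c"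
  shows "transition c c p w = w"
proof -
  have "((\<lambda>x. x) has_derivative (\<lambda>x. x)) (at (coord c p))" by (rule has_derivative_ident)
  then have "((coord c \<circ> param c) has_derivative (\<lambda>x. x)) (at (coord c p))"
    by (rule has_derivative_transform_within_open[OF _ open_coord[OF assms(1)]])
      (use assms coord_param in auto)
  then show ?thesis by (metis frechet_derivative_at)
qed

text \<open>The chain rule for transition maps. It is what makes the components recorded in \<open>tvec\<close>
  independent of the chart used to specify them.\<close>

lemma transition_transition:
  assumes "c \<in> A" "d \<in> A" "e \<in> A" "p \<in> cdom c" "p \<in> cdom d" "p \<in> cdom e"
  shows "transition d e p (transition c d p w) = transition c e p w"
proof -
  have "((coord e \<circ> param d) has_derivative transition d e p) (at ((coord d \<circ> param c) (coord c p)))"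
    using transition_has_derivative[of d e p] assms by simp
  from diff_chain_at[OF transition_has_derivative[OF assms(1,2,4,5)] this]
  have *: "((coord e \<circ> param d \<circ> (coord d \<circ> param c)) has_derivative transition d e p \<circ> transition c d p)
      (at (coord c p))" .
  have "((coord e \<circ> param c) has_derivative transition d e p \<circ> transition c d p) (at (coord c p))"
    by (rule has_derivative_transform_within_open[OF * open_overlap[OF assms(1,2)]]) (use assms in auto)
  then show ?thesis by (metis comp_apply frechet_derivative_at)
qed

lemma fst_tvec [simp]: "fst (tvec A p c w) = p"
  by (simp add: tvec_def)

lemma comps_tvec:
  assumes "d \<in> A" "p \<in> cdom d"
  shows "comps d (tvec A p c w) = transition c d p w"
proof -
  have "(d, v) \<in> snd (tvec A p c w) \<longleftrightarrow> v = transition c d p w" for v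
    using assms unfolding tvec_def by force
  then show ?thesis by (simp add: comps_def)
qed

lemma comps_tvec_self [simp]:
  assumes "c \<in> A" "p \<in> cdom c"
  shows "comps c (tvec A p c w) = w"
  using comps_tvec[OF assms, of c w] assms by simp

lemma tvec_change_chart:
  assumes "c \<in> A" "d \<in> A" "p \<in> cdom c" "p \<in> cdom d"
  shows "tvec A p c w = tvec A p d (transition c d p w)"
  using transition_transition[OF assms(1,2) _ assms(3,4)] unfolding tvec_def by force

lemma tvec_in_tangent_space [intro]: "c \<in> A \<Longrightarrow> p \<in> cdom c \<Longrightarrow> tvec A p c w \<in> tangent_space A p"
  unfolding tangent_space_def by blast

lemma tvec_in_tangent_bundle [intro]: "c \<in> A \<Longrightarrow> p \<in> cdom c \<Longrightarrow> tvec A p c w \<in> tangent_bundle A"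
  using tvec_in_tangent_space unfolding tangent_bundle_def points_def by blast

lemma tvec_comps:
  assumes "u \<in> tangent_space A p" "d \<in> A" "p \<in> cdom d"
  shows "tvec A p d (comps d u) = u"
proof -
  obtain c w where "u = tvec A p c w" "c \<in> A" "p \<in> cdom c"
    using assms(1) by (auto simp: tangent_space_def)
  then show ?thesis using tvec_change_chart[of c d p w] comps_tvec[OF assms(2,3)] assms by simp
qed

lemma fst_tangent_space: "u \<in> tangent_space A p \<Longrightarrow> fst u = p"
  by (auto simp: tangent_space_def)

lemma tangent_bundle_cases:
  assumes "u \<in> tangent_bundle A"
  obtains c w where "c \<in> A" "fst u \<in> cdom c" "u = tvec A (fst u) c w"
  using assms by (auto simp: tangent_bundle_def tangent_space_def)

lemma tangent_bundle_tangent_space: "u \<in> tangent_bundle A \<Longrightarrow> u \<in> tangent_space A (fst u)"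
  by (auto simp: tangent_bundle_def fst_tangent_space)

lemma tvec_fst_comps:
  "u \<in> tangent_bundle A \<Longrightarrow> c \<in> A \<Longrightarrow> fst u \<in> cdom c \<Longrightarrow> tvec A (fst u) c (comps c u) = u"
  by (rule tvec_comps[OF tangent_bundle_tangent_space])

lemma add_vec_tvec:
  assumes "c \<in> A" "p \<in> cdom c"
  shows "add_vec (tvec A p c v) (tvec A p c w) = tvec A p c (v + w)"
proof -
  have "transition c d p (v + w) = transition c d p v + transition c d p w" if "d \<in> A" "p \<in> cdom d" for d
    using linear_add[OF linear_transition[OF assms(1) that(1) assms(2) that(2)]] .
  then show ?thesis unfolding add_vec_def tvec_def by force
qed

lemma scale_vec_tvec:
  assumes "c \<in> A" "p \<in> cdom c"
  shows "scale_vec r (tvec A p c w) = tvec A p c (r *\<^sub>R w)"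
proof -
  have "transition c d p (r *\<^sub>R w) = r *\<^sub>R transition c d p w" if "d \<in> A" "p \<in> cdom d" for d
    using linear_cmul[OF linear_transition[OF assms(1) that(1) assms(2) that(2)]] .
  then show ?thesis unfolding scale_vec_def tvec_def by force
qed

lemma zero_vec_tvec:
  assumes "c \<in> A" "p \<in> cdom c"
  shows "zero_vec A p = tvec A p c 0"
proof -
  have "transition c d p 0 = 0" if "d \<in> A" "p \<in> cdom d" for d
    using linear_0[OF linear_transition[OF assms(1) that(1) assms(2) that(2)]] .
  then show ?thesis unfolding zero_vec_def tvec_def by force
qed

definition metric_coord :: "(('a, 'e) tvec \<Rightarrow> ('a, 'e) tvec \<Rightarrow> real) \<Rightarrow> ('a, 'e) chart \<Rightarrow> 'e \<Rightarrow> 'e \<Rightarrow> 'e \<Rightarrow> real" where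
  "metric_coord g c x v w = g (tvec A (param c x) c v) (tvec A (param c x) c w)"

definition dual_coord ::
  "(('a, 'e) tvec \<Rightarrow> ('a, 'e) tvec \<Rightarrow> real) \<Rightarrow> ('a \<Rightarrow> ('a, 'e) tvec) \<Rightarrow> ('a, 'e) chart \<Rightarrow> 'e \<Rightarrow> 'e \<Rightarrow> real" where
  "dual_coord g X c x w = g (X (param c x)) (tvec A (param c x) c w)"

text \<open>The condition \<open>d\<beta> = 0\<close> for the one-form \<open>\<beta> = g(X, \<cdot>)\<close>, written in the coordinates of one chart.\<close>

definition dual_closed ::
  "(('a, 'e) tvec \<Rightarrow> ('a, 'e) tvec \<Rightarrow> real) \<Rightarrow> ('a \<Rightarrow> ('a, 'e) tvec) \<Rightarrow> ('a, 'e) chart \<Rightarrow> bool" where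
  "dual_closed g X c \<longleftrightarrow> (\<forall>x\<in>coord c ` cdom c. \<forall>v w.
     frechet_derivative (\<lambda>x. dual_coord g X c x w) (at x) v =
     frechet_derivative (\<lambda>x. dual_coord g X c x v) (at x) w)"

lemma metric_data_chart:
  assumes g: "riemannian_metric A g" and c: "c \<in> A"
  shows "metric_data (coord c ` cdom c) (metric_coord g c)"
proof -
  let ?U = "coord c ` cdom c"
  have sym: "metric_coord g c x v w = metric_coord g c x w v" if "x \<in> ?U" for x v w
    using g param_in_points[OF c that] tvec_in_tangent_space[OF c param_in_cdom[OF that]]
    unfolding riemannian_metric_def metric_coord_def by blast
  have lin: "linear (metric_coord g c x v)" if x: "x \<in> ?U" for x v
  proof -
    have "metric_coord g c x (u + w) v = metric_coord g c x u v + metric_coord g c x w v"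
      "metric_coord g c x (r *\<^sub>R u) v = r * metric_coord g c x u v" for u w r
      using g param_in_points[OF c x] tvec_in_tangent_space[OF c param_in_cdom[OF x]]
      unfolding riemannian_metric_def metric_coord_def
      by (simp_all add: add_vec_tvec[OF c param_in_cdom[OF x], symmetric]
          scale_vec_tvec[OF c param_in_cdom[OF x], symmetric])
    then show ?thesis by (intro linearI) (simp_all add: sym[OF x, of v])
  qed
  show ?thesis
  proof (rule metric_data.intro)
    show "open ?U" by (rule open_coord[OF c])
    show "linear (metric_coord g c x v)" if "x \<in> ?U" for x v by (rule lin[OF that])
    show "metric_coord g c x v w = metric_coord g c x w v" if "x \<in> ?U" for x v w by (rule sym[OF that])
    show "0 < metric_coord g c x v v" if x: "x \<in> ?U" and v: "v \<noteq> 0" for x v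
    proof -
      have "tvec A (param c x) c v \<noteq> zero_vec A (param c x)"
        using v comps_tvec_self[OF c param_in_cdom[OF x]] zero_vec_tvec[OF c param_in_cdom[OF x]] by metis
      then show ?thesis
        using g param_in_points[OF c x] tvec_in_tangent_space[OF c param_in_cdom[OF x]]
        unfolding riemannian_metric_def metric_coord_def by blast
    qed
    show "smooth_on (\<lambda>x. metric_coord g c x v w) ?U" for v w
    proof (rule smooth_on_cong[OF open_coord[OF c]])
      have "smooth_on (\<lambda>x. metric_coord g c x i j) ?U" if "i \<in> Basis" "j \<in> Basis" for i j
        using g c that unfolding riemannian_metric_def metric_coord_def by blast
      then show "smooth_on (\<lambda>x. \<Sum>i\<in>Basis. (v \<bullet> i) * (\<Sum>j\<in>Basis. (w \<bullet> j) * metric_coord g c x i j)) ?U"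
        by (intro smooth_on_sum smooth_on_mult open_coord[OF c] smooth_on_const) auto
      show "(\<Sum>i\<in>Basis. (v \<bullet> i) * (\<Sum>j\<in>Basis. (w \<bullet> j) * metric_coord g c x i j)) = metric_coord g c x v w"
        if "x \<in> ?U" for x
      proof -
        have "(\<Sum>j\<in>Basis. (w \<bullet> j) * metric_coord g c x i j) = metric_coord g c x i w" for i
          using linear_eq_sum_Basis[OF lin[OF that], of i w] by simp
        moreover have "(\<Sum>i\<in>Basis. (v \<bullet> i) * metric_coord g c x i w) = metric_coord g c x v w"
          using linear_eq_sum_Basis[OF lin[OF that], of w v] by (simp add: sym[OF that, of _ w])
        ultimately show ?thesis by simp
      qed
    qed
  qed
qed

lemma dual_coord_eq:
  assumes X: "vector_field A X" and c: "c \<in> A" and x: "x \<in> coord c ` cdom c"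
  shows "dual_coord g X c x w = metric_coord g c x (comps c (X (param c x))) w"
  using tvec_comps[of "X (param c x)" "param c x" c] X param_in_points[OF c x] param_in_cdom[OF x] c
  unfolding vector_field_def by (simp add: dual_coord_def metric_coord_def)

text \<open>The bound on the one-form \<open>g(X, \<cdot>)\<close> is the Cauchy-Schwarz inequality together with \<open>g(X, X) < 1\<close>.\<close>

lemma randers_data_chart:
  assumes g: "riemannian_metric A g" and X: "vector_field A X" and c: "c \<in> A"
    and less: "\<And>p. p \<in> points A \<Longrightarrow> g (X p) (X p) < 1"
  shows "randers_data (coord c ` cdom c) (metric_coord g c) (dual_coord g X c)"
proof -
  let ?U = "coord c ` cdom c"
  interpret metric_data ?U "metric_coord g c" by (rule metric_data_chart[OF g c])
  define \<xi> where "\<xi> = (\<lambda>x. comps c (X (param c x)))"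
  have \<xi>: "smooth_on \<xi> ?U" using X c by (simp add: vector_field_def \<xi>_def)
  have b: "dual_coord g X c x w = metric_coord g c x (\<xi> x) w" if "x \<in> ?U" for x w
    using dual_coord_eq[OF X c that] by (simp add: \<xi>_def)
  show ?thesis
  proof (rule randers_data.intro[OF metric_data_axioms], rule randers_data_axioms.intro)
    show "linear (dual_coord g X c x)" if "x \<in> ?U" for x
    proof -
      have "dual_coord g X c x = metric_coord g c x (\<xi> x)" using b[OF that] by (rule ext)
      then show ?thesis using a_linear[OF that, of "\<xi> x"] by simp
    qed
    show "smooth_on (\<lambda>x. dual_coord g X c x v) ?U" for v
    proof (rule smooth_on_cong[OF U])
      show "smooth_on (\<lambda>x. \<Sum>i\<in>Basis. (\<xi> x \<bullet> i) * metric_coord g c x v i) ?U"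
        by (intro smooth_on_sum smooth_on_mult U a_smooth smooth_on_inner_left \<xi>)
      show "(\<Sum>i\<in>Basis. (\<xi> x \<bullet> i) * metric_coord g c x v i) = dual_coord g X c x v" if "x \<in> ?U" for x
        using linear_eq_sum_Basis[OF a_linear[OF that], of v "\<xi> x"] by (simp add: b[OF that] a_sym[OF that, of "\<xi> x"])
    qed
    show "\<bar>dual_coord g X c x v\<bar> < sqrt (metric_coord g c x v v)" if x: "x \<in> ?U" and v: "v \<noteq> 0" for x v
    proof -
      have "metric_coord g c x (\<xi> x) (\<xi> x) = g (X (param c x)) (X (param c x))"
        using b[OF x, of "\<xi> x"] tvec_comps[of "X (param c x)" "param c x" c] X param_in_points[OF c x]
          param_in_cdom[OF x] c unfolding vector_field_def by (simp add: dual_coord_def \<xi>_def)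
      then have n: "metric_coord g c x (\<xi> x) (\<xi> x) < 1" using less param_in_points[OF c x] by simp
      have "(dual_coord g X c x v)\<^sup>2 \<le> metric_coord g c x v v * metric_coord g c x (\<xi> x) (\<xi> x)"
        using a_Cauchy_Schwarz(1)[OF x v, of "\<xi> x"] by (simp add: b[OF x] a_sym[OF x, of v "\<xi> x"])
      also have "\<dots> < metric_coord g c x v v" using n a_pos[OF x v] by simp
      finally show ?thesis by (simp add: real_less_rsqrt)
    qed
  qed
qed

lemma finsler_coord_randers:
  assumes g: "riemannian_metric A g" and X: "vector_field A X" and c: "c \<in> A"
    and less: "\<And>p. p \<in> points A \<Longrightarrow> g (X p) (X p) < 1"
  shows "finsler_coord A (randers g X) c (x, y) =
    randers_data.F (metric_coord g c) (dual_coord g X c) x y"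
proof -
  interpret randers_data "coord c ` cdom c" "metric_coord g c" "dual_coord g X c"
    by (rule randers_data_chart[OF assms])
  show ?thesis
    by (simp add: finsler_coord_def randers_def F_def \<alpha>_def metric_coord_def dual_coord_def)
qed

lemma finsler_metric_randers:
  assumes g: "riemannian_metric A g" and X: "vector_field A X"
    and less: "\<And>p. p \<in> points A \<Longrightarrow> g (X p) (X p) < 1"
  shows "finsler_metric A (randers g X)"
  unfolding finsler_metric_def
proof (intro conjI ballI allI impI)
  have F: "randers g X (tvec A p c w) = randers_data.F (metric_coord g c) (dual_coord g X c) (coord c p) w"
    if "c \<in> A" "p \<in> cdom c" for p c w
    using finsler_coord_randers[OF g X that(1) less, of "coord c p" w] that by (simp add: finsler_coord_def)
  fix v assume v: "v \<in> tangent_bundle A"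
  then obtain c w where cw: "c \<in> A" "fst v \<in> cdom c" "v = tvec A (fst v) c w"
    by (rule tangent_bundle_cases)
  interpret randers_data "coord c ` cdom c" "metric_coord g c" "dual_coord g X c"
    by (rule randers_data_chart[OF g X cw(1) less])
  have x: "coord c (fst v) \<in> coord c ` cdom c" using cw by blast
  have Fv: "randers g X v = F (coord c (fst v)) w" using F[OF cw(1,2), of w] cw(3) by simp
  show "0 \<le> randers g X v"
    using F_pos[OF x, of w] F_zero[OF x] by (cases "w = 0") (simp_all add: Fv)
  fix r :: real assume r: "0 < r"
  have "scale_vec r v = tvec A (fst v) c (r *\<^sub>R w)" using scale_vec_tvec[OF cw(1,2)] cw(3) by metis
  then have "randers g X (scale_vec r v) = F (coord c (fst v)) (r *\<^sub>R w)" using F[OF cw(1,2)] by simp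
  then show "randers g X (scale_vec r v) = r * randers g X v"
    using F_homogeneous[OF x r] Fv by simp
next
  fix c assume c: "c \<in> A"
  interpret randers_data "coord c ` cdom c" "metric_coord g c" "dual_coord g X c"
    by (rule randers_data_chart[OF g X c less])
  have eq: "finsler_coord A (randers g X) c = (\<lambda>(x, y). F x y)"
    using finsler_coord_randers[OF g X c less] by auto
  show "smooth_on (finsler_coord A (randers g X) c) (coord c ` cdom c \<times> - {0})"
    unfolding eq by (rule smooth_on_F)
  fix x y w :: 'e assume "x \<in> coord c ` cdom c" "y \<noteq> 0" "w \<noteq> 0"
  then show "0 < (\<Sum>i\<in>Basis. \<Sum>j\<in>Basis.
      fundamental_tensor (\<lambda>z. (finsler_coord A (randers g X) c z)\<^sup>2) (x, y) i j * (w \<bullet> i) * (w \<bullet> j))"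
    by (intro fundamental_tensor_pos) (simp_all add: eq)
qed

text \<open>The Douglas condition asks for some chart around each point, and in each single chart it is
  equivalent to closedness. Hence the same charts serve on both sides.\<close>

lemma douglas_randers_iff:
  assumes g: "riemannian_metric A g" and X: "vector_field A X"
    and less: "\<And>p. p \<in> points A \<Longrightarrow> g (X p) (X p) < 1"
  shows "douglas_metric A (randers g X) \<longleftrightarrow>
    (\<forall>p\<in>points A. \<exists>c\<in>A. p \<in> cdom c \<and> dual_closed g X c)"
proof -
  have "(\<exists>(\<Gamma> :: 'e \<Rightarrow> 'e \<Rightarrow> 'e \<Rightarrow> 'e \<Rightarrow> real) (P :: 'e \<Rightarrow> 'e \<Rightarrow> real).
       (\<forall>x\<in>coord c ` cdom c. \<forall>y. y \<noteq> 0 \<longrightarrow> (\<forall>r>0. P x (r *\<^sub>R y) = r * P x y)) \<and>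
       (\<forall>x\<in>coord c ` cdom c. \<forall>y. y \<noteq> 0 \<longrightarrow> (\<forall>i\<in>Basis.
          spray_coeff (\<lambda>z. (finsler_coord A (randers g X) c z)\<^sup>2) (x, y) i =
            1/2 * (\<Sum>j\<in>Basis. \<Sum>k\<in>Basis. \<Gamma> i j k x * (y \<bullet> j) * (y \<bullet> k)) + P x y * (y \<bullet> i))))
      \<longleftrightarrow> dual_closed g X c" if c: "c \<in> A" for c
  proof -
    interpret randers_data "coord c ` cdom c" "metric_coord g c" "dual_coord g X c"
      by (rule randers_data_chart[OF g X c less])
    show ?thesis
      unfolding dual_closed_def
      by (subst Douglas_form_iff) (auto simp: finsler_coord_randers[OF g X c less] Db_def)
  qed
  then show ?thesis
    unfolding douglas_metric_def using finsler_metric_randers[OF assms] by simp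
qed

end

section \<open>The tangent bundle and the lifts of vector fields\<close>

context smooth_atlas
begin

abbreviation TA :: "(('a, 'e) tvec, 'e \<times> 'e) chart set" where
  "TA \<equiv> tangent_atlas A"

abbreviation tchart :: "('a, 'e) chart \<Rightarrow> (('a, 'e) tvec, 'e \<times> 'e) chart" where
  "tchart c \<equiv> tangent_chart A c"

lemma cdom_tchart: "cdom (tchart c) = {v \<in> tangent_bundle A. fst v \<in> cdom c}"
  by (simp add: tangent_chart_def)

lemma coord_tchart: "coord (tchart c) v = (coord c (fst v), comps c v)"
  by (simp add: tangent_chart_def)

lemma tchart_in_TA [intro]: "c \<in> A \<Longrightarrow> tchart c \<in> TA"
  by (simp add: tangent_atlas_def)

lemma tchart_image_subset:
  assumes c: "c \<in> A" and T: "T \<subseteq> cdom c"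
  shows "coord (tchart c) ` {v \<in> tangent_bundle A. fst v \<in> T} = coord c ` T \<times> UNIV"
proof (intro equalityI subsetI)
  fix z assume "z \<in> coord c ` T \<times> (UNIV :: 'e set)"
  then obtain p y where p: "p \<in> T" "z = (coord c p, y)" by auto
  then have pc: "p \<in> cdom c" using T by blast
  have "tvec A p c y \<in> {v \<in> tangent_bundle A. fst v \<in> T}"
    using tvec_in_tangent_bundle[OF c pc] p by simp
  moreover have "z = coord (tchart c) (tvec A p c y)"
    using c pc p by (simp add: coord_tchart)
  ultimately show "z \<in> coord (tchart c) ` {v \<in> tangent_bundle A. fst v \<in> T}" by (rule rev_image_eqI)
qed (auto simp: coord_tchart)

lemma tchart_image: "c \<in> A \<Longrightarrow> coord (tchart c) ` cdom (tchart c) = coord c ` cdom c \<times> UNIV"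
  using tchart_image_subset[of c "cdom c"] by (simp add: cdom_tchart)

lemma tchart_overlap_image:
  assumes "c \<in> A"
  shows "coord (tchart c) ` (cdom (tchart c) \<inter> cdom (tchart d)) = coord c ` (cdom c \<inter> cdom d) \<times> UNIV"
proof -
  have "cdom (tchart c) \<inter> cdom (tchart d) = {v \<in> tangent_bundle A. fst v \<in> cdom c \<inter> cdom d}"
    by (auto simp: cdom_tchart)
  then show ?thesis using tchart_image_subset[OF assms, of "cdom c \<inter> cdom d"] by simp
qed

lemma inj_on_tchart: "c \<in> A \<Longrightarrow> inj_on (coord (tchart c)) (cdom (tchart c))"
proof (rule inj_onI)
  fix u v assume c: "c \<in> A" and uv: "u \<in> cdom (tchart c)" "v \<in> cdom (tchart c)"
    "coord (tchart c) u = coord (tchart c) v"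
  then have u: "u \<in> tangent_bundle A" "fst u \<in> cdom c" and v: "v \<in> tangent_bundle A" "fst v \<in> cdom c"
    and eq: "coord c (fst u) = coord c (fst v)" "comps c u = comps c v"
    by (auto simp: cdom_tchart coord_tchart)
  have "u = tvec A (fst u) c (comps c u)" by (rule tvec_fst_comps[OF u(1) c u(2), symmetric])
  also have "\<dots> = tvec A (fst v) c (comps c v)"
    by (simp only: inj_onD[OF inj_coord[OF c] eq(1) u(2) v(2)] eq(2))
  also have "\<dots> = v" by (rule tvec_fst_comps[OF v(1) c v(2)])
  finally show "u = v" .
qed

lemma param_tchart:
  assumes c: "c \<in> A" and x: "x \<in> coord c ` cdom c"
  shows "param (tchart c) (x, y) = tvec A (param c x) c y"
proof (rule inv_into_f_eq[OF inj_on_tchart[OF c]])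
  show "tvec A (param c x) c y \<in> cdom (tchart c)"
    using tvec_in_tangent_bundle[OF c param_in_cdom[OF x]] param_in_cdom[OF x] by (simp add: cdom_tchart)
  show "coord (tchart c) (tvec A (param c x) c y) = (x, y)"
    using comps_tvec_self[OF c param_in_cdom[OF x]] coord_param[OF x] by (simp add: coord_tchart)
qed

lemma tchart_transition:
  assumes c: "c \<in> A" and d: "d \<in> A" and x: "x \<in> coord c ` (cdom c \<inter> cdom d)"
  shows "(coord (tchart d) \<circ> param (tchart c)) (x, y) =
    ((coord d \<circ> param c) x, frechet_derivative (coord d \<circ> param c) (at x) y)"
proof -
  have x': "x \<in> coord c ` cdom c" using x by auto
  have "param c x \<in> cdom d" using x c by auto
  then have "comps d (tvec A (param c x) c y) = transition c d (param c x) y" by (rule comps_tvec[OF d])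
  then show ?thesis unfolding coord_param[OF x'] by (simp add: param_tchart[OF c x'] coord_tchart)
qed

lemma smooth_atlas_tangent_atlas: "smooth_atlas TA"
proof
  fix C assume "C \<in> TA"
  then obtain c where c: "c \<in> A" "C = tchart c" by (auto simp: tangent_atlas_def)
  show "inj_on (coord C) (cdom C)" using inj_on_tchart c by simp
  show "open (coord C ` cdom C)" using tchart_image open_coord c by (simp add: open_Times)
  fix D assume "D \<in> TA"
  then obtain d where d: "d \<in> A" "D = tchart d" by (auto simp: tangent_atlas_def)
  let ?U = "coord c ` (cdom c \<inter> cdom d)"
  let ?f = "coord d \<circ> param c"
  have U: "open ?U" by (rule open_overlap[OF c(1) d(1)])
  have im: "coord C ` (cdom C \<inter> cdom D) = ?U \<times> UNIV" using tchart_overlap_image c d by simp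
  have W: "open (?U \<times> (UNIV :: 'e set))" using U by (rule open_Times) simp
  show "open (coord C ` (cdom C \<inter> cdom D))" unfolding im by (rule W)
  show "smooth_on (coord D \<circ> param C) (coord C ` (cdom C \<inter> cdom D))"
    unfolding im
  proof (rule smooth_on_cong[OF W])
    have f: "smooth_on ?f ?U" by (rule smooth_transition[OF c(1) d(1)])
    show "smooth_on (\<lambda>z. (?f (fst z), frechet_derivative ?f (at (fst z)) (snd z))) (?U \<times> UNIV)"
      by (intro smooth_on_Pair W smooth_on_compose[OF W U _ smooth_on_fst[OF W] f]
          smooth_on_frechet_derivative_apply[OF U f W _ smooth_on_fst[OF W] smooth_on_snd[OF W]]) auto
    show "(?f (fst z), frechet_derivative ?f (at (fst z)) (snd z)) = (coord D \<circ> param C) z"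
      if "z \<in> ?U \<times> UNIV" for z
      using tchart_transition[OF c(1) d(1), of "fst z" "snd z"] that c d by auto
  qed
qed

lemma points_TA: "points TA = tangent_bundle A"
proof -
  have "v \<in> points TA" if v: "v \<in> tangent_bundle A" for v
  proof -
    obtain c w where "c \<in> A" "fst v \<in> cdom c" using v by (rule tangent_bundle_cases)
    then show ?thesis using v unfolding points_def tangent_atlas_def by (auto simp: cdom_tchart)
  qed
  then show ?thesis by (auto simp: points_def tangent_atlas_def cdom_tchart)
qed

text \<open>The Jacobian of an induced transition map \<open>(x, y) \<mapsto> (\<phi>(x), D\<phi>(x) y)\<close>: it is block triangular,
  with the second derivative of \<open>\<phi>\<close> off the diagonal.\<close>

lemma tchart_transition_derivative:
  assumes c: "c \<in> A" and d: "d \<in> A" and u: "fst u \<in> cdom c" "fst u \<in> cdom d"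
  shows "frechet_derivative (coord (tchart d) \<circ> param (tchart c)) (at (coord (tchart c) u)) (v, w) =
    (transition c d (fst u) v,
     frechet_derivative (\<lambda>z. frechet_derivative (coord d \<circ> param c) (at z) (comps c u)) (at (coord c (fst u))) v
       + transition c d (fst u) w)"
proof -
  let ?f = "coord d \<circ> param c" and ?U = "coord c ` (cdom c \<inter> cdom d)"
    and ?x = "coord c (fst u)" and ?y = "comps c u"
  have U: "open ?U" by (rule open_overlap[OF c d])
  have f: "smooth_on ?f ?U" by (rule smooth_transition[OF c d])
  have x: "?x \<in> ?U" using u by blast
  have W: "open (?U \<times> (UNIV :: 'e set))" using U by (rule open_Times) simp
  have "(fst has_derivative fst) (at (?x, ?y))" by (rule has_derivative_fst[OF has_derivative_ident])
  from diff_chain_at[OF this, unfolded fst_conv, OF smooth_on_has_derivative[OF U f x]]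
  have "((\<lambda>z. ?f (fst z)) has_derivative (\<lambda>z. transition c d (fst u) (fst z))) (at (?x, ?y))"
    by (simp only: comp_def)
  from has_derivative_Pair[OF this frechet_derivative_apply_has_derivative[OF U f x, of ?y]]
  have "((coord (tchart d) \<circ> param (tchart c)) has_derivative
      (\<lambda>z. (transition c d (fst u) (fst z),
        frechet_derivative (\<lambda>z. frechet_derivative ?f (at z) ?y) (at ?x) (fst z) +
        transition c d (fst u) (snd z)))) (at (?x, ?y))"
    by (rule has_derivative_transform_within_open[OF _ W])
      (use x tchart_transition[OF c d] in auto)
  from frechet_derivative_at[OF this] show ?thesis unfolding coord_tchart
    by (metis (no_types, lifting) fst_conv snd_conv)
qed

text \<open>The lifts are given by their components in all induced charts; they are tangent vectors as soon
  as these components are related by the induced transition maps.\<close>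

lemma tvec_TA_eqI:
  assumes c: "c \<in> A" and u: "u \<in> tangent_bundle A" "fst u \<in> cdom c"
    and k: "\<And>d. d \<in> A \<Longrightarrow> fst u \<in> cdom d \<Longrightarrow>
      frechet_derivative (coord (tchart d) \<circ> param (tchart c)) (at (coord (tchart c) u)) w = k d"
  shows "(u, {(tchart d, k d) | d. d \<in> A \<and> fst u \<in> cdom d}) = tvec TA u (tchart c) w"
proof -
  have "{(tchart d, k d) | d. d \<in> A \<and> fst u \<in> cdom d} =
     {(D, frechet_derivative (coord D \<circ> param (tchart c)) (at (coord (tchart c) u)) w) | D. D \<in> TA \<and> u \<in> cdom D}"
    (is "?L = ?R")
  proof (intro equalityI subsetI)
    fix z assume "z \<in> ?L"
    then obtain d where d: "z = (tchart d, k d)" "d \<in> A" "fst u \<in> cdom d" by blast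
    then have "tchart d \<in> TA" "u \<in> cdom (tchart d)" using u by (auto simp: cdom_tchart)
    moreover have "z = (tchart d, frechet_derivative (coord (tchart d) \<circ> param (tchart c)) (at (coord (tchart c) u)) w)"
      unfolding k[OF d(2,3)] by (rule d(1))
    ultimately show "z \<in> ?R" by blast
  next
    fix z assume "z \<in> ?R"
    then obtain D where D: "z = (D, frechet_derivative (coord D \<circ> param (tchart c)) (at (coord (tchart c) u)) w)"
      "D \<in> TA" "u \<in> cdom D" by blast
    then obtain d where d: "d \<in> A" "D = tchart d" by (auto simp: tangent_atlas_def)
    then have "fst u \<in> cdom d" using D(3) by (simp add: cdom_tchart)
    moreover from this have "z = (tchart d, k d)" unfolding D(1) d(2) using k[OF d(1)] by simp
    ultimately show "z \<in> ?L" using d(1) by blast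
  qed
  then show ?thesis unfolding tvec_def by simp
qed

text \<open>Vertical vectors do not meet the off-diagonal block of the Jacobian, so the transformation rule
  is that of \<open>X\<close>.\<close>

lemma vertical_lift_eq_tvec:
  assumes X: "vector_field A X" and c: "c \<in> A" and u: "u \<in> tangent_bundle A" "fst u \<in> cdom c"
  shows "vertical_lift A X u = tvec TA u (tchart c) (0, comps c (X (fst u)))"
  unfolding vertical_lift_def
proof (rule tvec_TA_eqI[OF c u])
  fix d assume d: "d \<in> A" "fst u \<in> cdom d"
  let ?p = "fst u"
  have "X ?p \<in> tangent_space A ?p" using X u(2) c unfolding vector_field_def points_def by blast
  then have *: "comps d (X ?p) = transition c d ?p (comps c (X ?p))"
    using comps_tvec[OF d, of c "comps c (X ?p)"] tvec_comps[OF _ c u(2)] by simp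
  have 0: "transition c d ?p 0 = 0"
    by (rule linear_0[OF linear_transition[OF c d(1) u(2) d(2)]])
  have U: "open (coord c ` (cdom c \<inter> cdom d))" by (rule open_overlap[OF c d(1)])
  have 1: "frechet_derivative (\<lambda>z. frechet_derivative (coord d \<circ> param c) (at z) (comps c u)) (at (coord c ?p)) 0 = 0"
    by (rule linear_0[OF smooth_on_linear_frechet_derivative[OF U
        smooth_on_frechet_derivative[OF smooth_transition[OF c d(1)]]]]) (use u d in blast)
  show "frechet_derivative (coord (tchart d) \<circ> param (tchart c)) (at (coord (tchart c) u)) (0, comps c (X ?p)) =
      (0, comps d (X ?p))"
    unfolding tchart_transition_derivative[OF c d(1) u(2) d(2)] 0 1 * by simp
qed

text \<open>Differentiate the transformation rule \<open>\<xi>'(\<phi>(x)) = D\<phi>(x) \<xi>(x)\<close> in direction \<open>y\<close>. This yields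
  \<open>D\<^sup>2\<phi>(x)(y, \<xi>)\<close>, while the transition map of the tangent bundle produces \<open>D\<^sup>2\<phi>(x)(\<xi>, y)\<close>;
  they agree since second derivatives are symmetric.\<close>

lemma complete_lift_eq_tvec:
  assumes X: "vector_field A X" and c: "c \<in> A" and u: "u \<in> tangent_bundle A" "fst u \<in> cdom c"
  shows "complete_lift A X u = tvec TA u (tchart c) (comps c (X (fst u)),
     frechet_derivative (\<lambda>x. comps c (X (param c x))) (at (coord c (fst u))) (comps c u))"
  unfolding complete_lift_def
proof (rule tvec_TA_eqI[OF c u])
  fix d assume d: "d \<in> A" "fst u \<in> cdom d"
  let ?p = "fst u" and ?x = "coord c (fst u)" and ?y = "comps c u"
  let ?\<xi> = "\<lambda>x. comps c (X (param c x))" and ?\<xi>' = "\<lambda>x. comps d (X (param d x))"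
  let ?f = "coord d \<circ> param c" and ?U = "coord c ` (cdom c \<inter> cdom d)"
  have U: "open ?U" by (rule open_overlap[OF c d(1)])
  have f: "smooth_on ?f ?U" by (rule smooth_transition[OF c d(1)])
  have x: "?x \<in> ?U" using u d by blast
  have transf: "comps d (X p) = transition c d p (comps c (X p))" if p: "p \<in> cdom c" "p \<in> cdom d" for p
  proof -
    have "X p \<in> tangent_space A p" using X p(1) c unfolding vector_field_def points_def by blast
    then show ?thesis
      using comps_tvec[OF d(1) p(2), of c "comps c (X p)"] tvec_comps[OF _ c p(1)] by simp
  qed
  have y': "comps d u = transition c d ?p ?y"
    using comps_tvec[OF d, of c ?y] tvec_fst_comps[OF u(1) c u(2)] by simp
  have \<xi>d: "(?\<xi> has_derivative frechet_derivative ?\<xi> (at ?x)) (at ?x)"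
    using X c u(2) by (intro smooth_on_has_derivative[OF open_coord[OF c]]) (auto simp: vector_field_def)
  have \<xi>'d: "(?\<xi>' has_derivative frechet_derivative ?\<xi>' (at (coord d ?p))) (at (?f ?x))"
    using smooth_on_has_derivative[OF open_coord[OF d(1)], of ?\<xi>' "coord d ?p"] X c d u(2)
    by (simp add: vector_field_def)
  have "((\<lambda>z. (z, ?\<xi> z)) has_derivative (\<lambda>v. (v, frechet_derivative ?\<xi> (at ?x) v))) (at ?x)"
    by (rule has_derivative_Pair[OF has_derivative_ident \<xi>d])
  from diff_chain_at[OF this frechet_derivative_apply_has_derivative[OF U f x]]
  have "((\<lambda>z. frechet_derivative ?f (at z) (?\<xi> z)) has_derivative
      (\<lambda>v. frechet_derivative (\<lambda>z. frechet_derivative ?f (at z) (?\<xi> ?x)) (at ?x) v +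
        transition c d ?p (frechet_derivative ?\<xi> (at ?x) v))) (at ?x)"
    by (simp add: o_def)
  then have D1: "((?\<xi>' \<circ> ?f) has_derivative
      (\<lambda>v. frechet_derivative (\<lambda>z. frechet_derivative ?f (at z) (?\<xi> ?x)) (at ?x) v +
        transition c d ?p (frechet_derivative ?\<xi> (at ?x) v))) (at ?x)"
    by (rule has_derivative_transform_within_open[OF _ U x]) (use c d transf in auto)
  have D2: "((?\<xi>' \<circ> ?f) has_derivative
      frechet_derivative ?\<xi>' (at (coord d ?p)) \<circ> transition c d ?p) (at ?x)"
    by (rule diff_chain_at[OF transition_has_derivative[OF c d(1) u(2) d(2)] \<xi>'d])
  have "frechet_derivative ?\<xi>' (at (coord d ?p)) (transition c d ?p ?y) =
      frechet_derivative (\<lambda>z. frechet_derivative ?f (at z) (?\<xi> ?x)) (at ?x) ?y +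
        transition c d ?p (frechet_derivative ?\<xi> (at ?x) ?y)"
    using fun_cong[OF has_derivative_unique[OF D2 D1], of ?y] by (simp only: comp_apply)
  also have "frechet_derivative (\<lambda>z. frechet_derivative ?f (at z) (?\<xi> ?x)) (at ?x) ?y =
      frechet_derivative (\<lambda>z. frechet_derivative ?f (at z) ?y) (at ?x) (?\<xi> ?x)"
    by (rule symmetric_second_derivative[OF U f x])
  also have "?\<xi> ?x = comps c (X ?p)" using c u(2) by simp
  finally have lift: "frechet_derivative ?\<xi>' (at (coord d ?p)) (transition c d ?p ?y) =
      frechet_derivative (\<lambda>z. frechet_derivative ?f (at z) ?y) (at ?x) (comps c (X ?p)) +
        transition c d ?p (frechet_derivative ?\<xi> (at ?x) ?y)" .
  show "frechet_derivative (coord (tchart d) \<circ> param (tchart c)) (at (coord (tchart c) u))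
      (comps c (X ?p), frechet_derivative ?\<xi> (at ?x) ?y) =
      (comps d (X ?p), frechet_derivative ?\<xi>' (at (coord d ?p)) (comps d u))"
    unfolding tchart_transition_derivative[OF c d(1) u(2) d(2)] transf[OF u(2) d(2)] y' lift by (rule refl)
qed

lemma vector_field_vertical_lift:
  assumes X: "vector_field A X"
  shows "vector_field TA (vertical_lift A X)"
  unfolding vector_field_def points_TA
proof (intro conjI ballI)
  interpret T: smooth_atlas TA by (rule smooth_atlas_tangent_atlas)
  show "vertical_lift A X u \<in> tangent_space TA u" if u: "u \<in> tangent_bundle A" for u
  proof -
    obtain c w where c: "c \<in> A" "fst u \<in> cdom c" using u by (rule tangent_bundle_cases)
    show ?thesis
      unfolding vertical_lift_eq_tvec[OF X c(1) u c(2)]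
      using u c by (intro T.tvec_in_tangent_space) (auto simp: cdom_tchart)
  qed
  fix C assume "C \<in> TA"
  then obtain c where c: "c \<in> A" "C = tchart c" by (auto simp: tangent_atlas_def)
  let ?U = "coord c ` cdom c"
  have W: "open (?U \<times> (UNIV :: 'e set))" using open_coord[OF c(1)] by (rule open_Times) simp
  show "smooth_on (\<lambda>x. comps C (vertical_lift A X (param C x))) (coord C ` cdom C)"
    unfolding c(2) tchart_image[OF c(1)]
  proof (rule smooth_on_cong[OF W])
    have "smooth_on (\<lambda>x. comps c (X (param c x))) ?U" using X c by (simp add: vector_field_def)
    then show "smooth_on (\<lambda>z. (0, comps c (X (param c (fst z))))) (?U \<times> (UNIV :: 'e set))"
      by (intro smooth_on_Pair W smooth_on_const smooth_on_compose[OF W open_coord[OF c(1)] _ smooth_on_fst[OF W]]) auto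
    show "(0, comps c (X (param c (fst z)))) = comps (tchart c) (vertical_lift A X (param (tchart c) z))"
      if "z \<in> ?U \<times> (UNIV :: 'e set)" for z
    proof -
      have x: "fst z \<in> ?U" using that by auto
      let ?u = "tvec A (param c (fst z)) c (snd z)"
      have u: "?u \<in> tangent_bundle A" "fst ?u \<in> cdom c"
        using tvec_in_tangent_bundle[OF c(1) param_in_cdom[OF x]] param_in_cdom[OF x] by auto
      have pz: "param (tchart c) z = ?u" using param_tchart[OF c(1) x, of "snd z"] by simp
      have "comps (tchart c) (tvec TA ?u (tchart c) w) = w" for w
        by (rule T.comps_tvec_self) (use c(1) u in \<open>auto simp: cdom_tchart\<close>)
      then show ?thesis unfolding pz vertical_lift_eq_tvec[OF X c(1) u] by simp
    qed
  qed
qed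

end

section \<open>Left invariant vector fields\<close>

context smooth_atlas
begin

abbreviation local_derivative :: "('a \<Rightarrow> 'a) \<Rightarrow> ('a, 'e) chart \<Rightarrow> ('a, 'e) chart \<Rightarrow> 'a \<Rightarrow> 'e \<Rightarrow> 'e" where
  "local_derivative f c d p \<equiv> frechet_derivative (coord d \<circ> f \<circ> param c) (at (coord c p))"

lemma local_has_derivative:
  assumes f: "smooth_map A A f" and c: "c \<in> A" "p \<in> cdom c" and d: "d \<in> A" "f p \<in> cdom d"
  shows "((coord d \<circ> f \<circ> param c) has_derivative local_derivative f c d p) (at (coord c p))"
proof -
  have "open (coord c ` (cdom c \<inter> f -` cdom d))"
    "smooth_on (coord d \<circ> f \<circ> param c) (coord c ` (cdom c \<inter> f -` cdom d))"
    using f c(1) d(1) unfolding smooth_map_def by blast+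
  then show ?thesis by (rule smooth_on_has_derivative) (use c d in blast)
qed

text \<open>The chain rule for maps of the manifold in charts. The composition \<open>k\<close> is required to agree with
  \<open>f \<circ> h\<close> only on the points of the manifold, because the group laws hold only on the carrier.\<close>

lemma local_derivative_compose:
  assumes f: "smooth_map A A f" and h: "smooth_map A A h" and k: "\<And>x. x \<in> points A \<Longrightarrow> k x = f (h x)"
    and c: "c \<in> A" "p \<in> cdom c" and d: "d \<in> A" "h p \<in> cdom d" and e: "e \<in> A" "k p \<in> cdom e"
  shows "local_derivative f d e (h p) (local_derivative h c d p w) = local_derivative k c e p w"
proof -
  have k': "k q = f (h q)" if "q \<in> cdom c" for q
    using k[of q] that c(1) unfolding points_def by blast
  have U: "open (coord c ` (cdom c \<inter> h -` cdom d))"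
    using h c(1) d(1) unfolding smooth_map_def by blast
  have hp: "(coord d \<circ> h \<circ> param c) (coord c p) = coord d (h p)" using c by simp
  have "f (h p) \<in> cdom e" using e(2) k'[OF c(2)] by simp
  from local_has_derivative[OF f d e(1) this]
  have "((coord e \<circ> f \<circ> param d) has_derivative local_derivative f d e (h p))
      (at ((coord d \<circ> h \<circ> param c) (coord c p)))" unfolding hp .
  from diff_chain_at[OF local_has_derivative[OF h c d] this]
  have *: "((coord e \<circ> f \<circ> param d \<circ> (coord d \<circ> h \<circ> param c)) has_derivative
      local_derivative f d e (h p) \<circ> local_derivative h c d p) (at (coord c p))" .
  have "((coord e \<circ> k \<circ> param c) has_derivative
      local_derivative f d e (h p) \<circ> local_derivative h c d p) (at (coord c p))"
  proof (rule has_derivative_transform_within_open[OF * U])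
    show "coord c p \<in> coord c ` (cdom c \<inter> h -` cdom d)" using c d by blast
    fix x assume "x \<in> coord c ` (cdom c \<inter> h -` cdom d)"
    then obtain q where q: "q \<in> cdom c" "h q \<in> cdom d" "x = coord c q" by blast
    then show "(coord e \<circ> f \<circ> param d \<circ> (coord d \<circ> h \<circ> param c)) x = (coord e \<circ> k \<circ> param c) x"
      using c(1) d(1) k'[OF q(1)] by simp
  qed
  from fun_cong[OF frechet_derivative_at[OF this], of w] show ?thesis by simp
qed

lemma smooth_map_ident: "smooth_map A A (\<lambda>x. x)"
proof -
  have "coord d \<circ> (\<lambda>x. x) \<circ> param c = coord d \<circ> param c" for c d :: "('a, 'e) chart"
    by (simp add: comp_def)
  then show ?thesis unfolding smooth_map_def using open_overlap smooth_transition by simp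
qed

lemma local_derivative_ident: "local_derivative (\<lambda>x. x) c d p = transition c d p"
proof -
  have "coord d \<circ> (\<lambda>x. x) \<circ> param c = coord d \<circ> param c" by (simp add: comp_def)
  then show ?thesis by simp
qed

text \<open>\<open>tangent_map\<close> collects the images of the components in all charts. They form a single tangent
  vector by the chain rule with the identity composed on either side.\<close>

lemma tangent_map_tvec:
  assumes f: "smooth_map A A f" and c: "c \<in> A" "p \<in> cdom c" and d: "d \<in> A" "f p \<in> cdom d"
  shows "tangent_map A f (tvec A p c w) = tvec A (f p) d (local_derivative f c d p w)"
proof -
  have *: "local_derivative f c' d' p (transition c c' p w) =
      transition d d' (f p) (local_derivative f c d p w)"
    if c': "c' \<in> A" "p \<in> cdom c'" and d': "d' \<in> A" "f p \<in> cdom d'" for c' d'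
    using local_derivative_compose[where f = f and h = "\<lambda>x. x" and k = f, OF f smooth_map_ident refl c c' d', of w]
      local_derivative_compose[where f = "\<lambda>x. x" and h = f and k = f, OF smooth_map_ident f refl c d d', of w]
    by (simp add: local_derivative_ident)
  have "(\<exists>c' w'. z = (d', local_derivative f c' d' p w') \<and> (c', w') \<in> snd (tvec A p c w)) \<longleftrightarrow>
      z = (d', transition d d' (f p) (local_derivative f c d p w))"
    if d': "d' \<in> A" "f p \<in> cdom d'" for d' z
  proof
    assume "\<exists>c' w'. z = (d', local_derivative f c' d' p w') \<and> (c', w') \<in> snd (tvec A p c w)"
    then obtain c' where "c' \<in> A" "p \<in> cdom c'" "z = (d', local_derivative f c' d' p (transition c c' p w))"
      unfolding tvec_def by auto
    then show "z = (d', transition d d' (f p) (local_derivative f c d p w))" using *[OF _ _ d'] by simp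
  next
    assume z: "z = (d', transition d d' (f p) (local_derivative f c d p w))"
    have "(c, transition c c p w) \<in> snd (tvec A p c w)"
      using c unfolding tvec_def snd_conv by blast
    then show "\<exists>c' w'. z = (d', local_derivative f c' d' p w') \<and> (c', w') \<in> snd (tvec A p c w)"
      using z *[OF c d'] by metis
  qed
  then have "{(d', local_derivative f c' d' p w') | c' w' d'.
        (c', w') \<in> snd (tvec A p c w) \<and> d' \<in> A \<and> f p \<in> cdom d'} =
      {(d', transition d d' (f p) (local_derivative f c d p w)) | d'. d' \<in> A \<and> f p \<in> cdom d'}"
    by blast
  then show ?thesis unfolding tangent_map_def fst_tvec by (simp only: tvec_def)
qed

lemma tangent_map_compose:
  assumes f: "smooth_map A A f" and h: "smooth_map A A h" and k: "smooth_map A A k"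
    and eq: "\<And>x. x \<in> points A \<Longrightarrow> k x = f (h x)" and u: "u \<in> tangent_bundle A"
  shows "tangent_map A f (tangent_map A h u) = tangent_map A k u"
proof -
  obtain c w where c: "c \<in> A" "fst u \<in> cdom c" "u = tvec A (fst u) c w"
    using u by (rule tangent_bundle_cases)
  let ?p = "fst u"
  have p: "?p \<in> points A" using c unfolding points_def by blast
  then have "h ?p \<in> points A" using h unfolding smooth_map_def by blast
  then obtain d where d: "d \<in> A" "h ?p \<in> cdom d" unfolding points_def by blast
  have "k ?p \<in> points A" using p k unfolding smooth_map_def by blast
  then obtain e where e: "e \<in> A" "k ?p \<in> cdom e" unfolding points_def by blast
  have fe: "f (h ?p) \<in> cdom e" using e(2) eq[OF p] by simp
  have "tangent_map A f (tangent_map A h u) =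
      tvec A (f (h ?p)) e (local_derivative f d e (h ?p) (local_derivative h c d ?p w))"
    using tangent_map_tvec[OF h c(1,2) d, of w] tangent_map_tvec[OF f d e(1) fe] c(3) by simp
  also have "\<dots> = tvec A (k ?p) e (local_derivative k c e ?p w)"
    by (simp only: local_derivative_compose[OF f h eq c(1,2) d e] eq[OF p])
  also have "\<dots> = tangent_map A k u" using tangent_map_tvec[OF k c(1,2) e, of w] c(3) by simp
  finally show ?thesis .
qed

lemma tangent_map_ident:
  assumes u: "u \<in> tangent_bundle A"
  shows "tangent_map A (\<lambda>x. x) u = u"
proof -
  obtain c w where c: "c \<in> A" "fst u \<in> cdom c" "u = tvec A (fst u) c w"
    using u by (rule tangent_bundle_cases)
  have "tangent_map A (\<lambda>x. x) (tvec A (fst u) c w) = tvec A (fst u) c w"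
    using tangent_map_tvec[OF smooth_map_ident c(1,2) c(1,2), of w] c(1,2)
    by (simp add: local_derivative_ident)
  then show ?thesis using c(3) by simp
qed

lemma tangent_map_in_tangent_space:
  assumes f: "smooth_map A A f" and u: "u \<in> tangent_bundle A"
  shows "tangent_map A f u \<in> tangent_space A (f (fst u))"
proof -
  obtain c w where c: "c \<in> A" "fst u \<in> cdom c" "u = tvec A (fst u) c w"
    using u by (rule tangent_bundle_cases)
  then have "f (fst u) \<in> points A" using f unfolding smooth_map_def points_def by blast
  then obtain d where d: "d \<in> A" "f (fst u) \<in> cdom d" unfolding points_def by blast
  show ?thesis using tangent_map_tvec[OF f c(1,2) d, of w] c(3) d by auto
qed

end

text \<open>Left invariant fields are obtained by differentiating the multiplication in its second factor,
  hence the condition that the multiplication is smooth as a map of two variables.\<close>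

locale lie_group_atlas = smooth_atlas A + group G
  for G :: "'a monoid" and A :: "('a, 'e::euclidean_space) chart set" +
  assumes points_carrier: "points A = carrier G"
    and smooth_mult: "smooth_map (prod_atlas A A) A (\<lambda>(x, y). x \<otimes>\<^bsub>G\<^esub> y)"

lemma lie_group_lie_group_atlas: "lie_group G A \<Longrightarrow> lie_group_atlas G A"
  by (simp add: lie_group_def lie_group_atlas_def lie_group_atlas_axioms_def smooth_manifold_smooth_atlas)

context lie_group_atlas
begin

definition mult_domain :: "('a, 'e) chart \<Rightarrow> ('a, 'e) chart \<Rightarrow> ('a, 'e) chart \<Rightarrow> ('e \<times> 'e) set" where
  "mult_domain c c' d = {(x, y). x \<in> coord c ` cdom c \<and> y \<in> coord c' ` cdom c' \<and>
     param c x \<otimes>\<^bsub>G\<^esub> param c' y \<in> cdom d}"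

lemma mult_coord_smooth:
  assumes c: "c \<in> A" and c': "c' \<in> A" and d: "d \<in> A"
  shows "open (mult_domain c c' d)"
    and "smooth_on (\<lambda>z. coord d (param c (fst z) \<otimes>\<^bsub>G\<^esub> param c' (snd z))) (mult_domain c c' d)"
proof -
  let ?C = "(cdom c \<times> cdom c', map_prod (coord c) (coord c'))"
  let ?m = "\<lambda>(x, y). x \<otimes>\<^bsub>G\<^esub> y"
  have C: "?C \<in> prod_atlas A A" using c c' unfolding prod_atlas_def by blast
  have im: "coord ?C ` (cdom ?C \<inter> ?m -` cdom d) = mult_domain c c' d"
  proof (intro equalityI subsetI)
    fix z assume "z \<in> coord ?C ` (cdom ?C \<inter> ?m -` cdom d)"
    then obtain p q where "p \<in> cdom c" "q \<in> cdom c'" "p \<otimes>\<^bsub>G\<^esub> q \<in> cdom d" "z = (coord c p, coord c' q)"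
      by auto
    then show "z \<in> mult_domain c c' d" using c c' by (simp add: mult_domain_def)
  next
    fix z assume "z \<in> mult_domain c c' d"
    then obtain p q where "p \<in> cdom c" "q \<in> cdom c'" "p \<otimes>\<^bsub>G\<^esub> q \<in> cdom d" "z = (coord c p, coord c' q)"
      using c c' by (auto simp: mult_domain_def)
    then show "z \<in> coord ?C ` (cdom ?C \<inter> ?m -` cdom d)"
      by (intro image_eqI[of _ _ "(p, q)"]) auto
  qed
  have inj: "inj_on (coord ?C) (cdom ?C)"
    using map_prod_inj_on[OF inj_coord[OF c] inj_coord[OF c']] by simp
  have param: "param ?C (x, y) = (param c x, param c' y)" if "(x, y) \<in> mult_domain c c' d" for x y
    by (rule inv_into_f_eq[OF inj])
      (use that in \<open>auto simp: mult_domain_def param_in_cdom coord_param c c'\<close>)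
  have *: "open (coord ?C ` (cdom ?C \<inter> ?m -` cdom d))"
    "smooth_on (coord d \<circ> ?m \<circ> param ?C) (coord ?C ` (cdom ?C \<inter> ?m -` cdom d))"
    using smooth_mult C d unfolding smooth_map_def by blast+
  show o: "open (mult_domain c c' d)" using *(1) unfolding im .
  show "smooth_on (\<lambda>z. coord d (param c (fst z) \<otimes>\<^bsub>G\<^esub> param c' (snd z))) (mult_domain c c' d)"
  proof (rule smooth_on_cong[OF o])
    show "smooth_on (coord d \<circ> ?m \<circ> param ?C) (mult_domain c c' d)" using *(2) unfolding im .
    show "(coord d \<circ> ?m \<circ> param ?C) z = coord d (param c (fst z) \<otimes>\<^bsub>G\<^esub> param c' (snd z))"
      if "z \<in> mult_domain c c' d" for z
      using param[of "fst z" "snd z"] that by simp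
  qed
qed

text \<open>A left translation is the multiplication restricted to a slice on which the first factor is constant.\<close>

lemma smooth_map_left_translation:
  assumes a: "a \<in> carrier G"
  shows "smooth_map A A (\<lambda>x. a \<otimes>\<^bsub>G\<^esub> x)"
  unfolding smooth_map_def
proof (intro conjI ballI)
  show "(\<lambda>x. a \<otimes>\<^bsub>G\<^esub> x) ` points A \<subseteq> points A" using a unfolding points_carrier by auto
  obtain b where b: "b \<in> A" "a \<in> cdom b" using a points_carrier unfolding points_def by blast
  fix c d assume c: "c \<in> A" and d: "d \<in> A"
  let ?l = "\<lambda>x. a \<otimes>\<^bsub>G\<^esub> x"
  let ?V = "coord c ` (cdom c \<inter> ?l -` cdom d)"
  have V: "?V = (\<lambda>y. (coord b a, y)) -` mult_domain b c d"
    using b c by (auto simp: mult_domain_def)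
  show openV: "open ?V"
    unfolding V by (intro open_vimage mult_coord_smooth b c d continuous_intros)
  show "smooth_on (coord d \<circ> ?l \<circ> param c) ?V"
  proof (rule smooth_on_cong[OF openV])
    have pair: "smooth_on (\<lambda>y. (coord b a, y)) ?V"
      by (rule smooth_on_Pair[OF openV smooth_on_const smooth_on_ident[OF openV]])
    show "smooth_on (\<lambda>y. coord d (param b (fst (coord b a, y)) \<otimes>\<^bsub>G\<^esub> param c (snd (coord b a, y)))) ?V"
      by (rule smooth_on_compose[OF openV mult_coord_smooth(1)[OF b(1) c d]
            _ pair mult_coord_smooth(2)[OF b(1) c d]])
        (use V in auto)
  qed (use b in simp)
qed

text \<open>The field \<open>Y(q) = Tl\<^sub>q v\<close> with \<open>v\<close> the translate of \<open>u\<close> to the unit. In charts its components are the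
  derivative of the multiplication at \<open>(q, \<one>)\<close> in direction \<open>(0, v)\<close>, hence smooth in \<open>q\<close>.\<close>

lemma left_invariant_field_through:
  assumes u: "u \<in> tangent_bundle A"
  obtains Y where "left_invariant_field G A Y" "Y (fst u) = u"
proof -
  let ?l = "\<lambda>a x. a \<otimes>\<^bsub>G\<^esub> x"
  let ?p = "fst u"
  have p: "?p \<in> carrier G" using u by (auto simp: tangent_bundle_def fst_tangent_space points_carrier)
  define v where "v = tangent_map A (?l (inv\<^bsub>G\<^esub> ?p)) u"
  have v: "v \<in> tangent_space A \<one>\<^bsub>G\<^esub>"
    using tangent_map_in_tangent_space[OF smooth_map_left_translation u, of "inv\<^bsub>G\<^esub> ?p"] p
    by (simp add: v_def)
  then have vb: "v \<in> tangent_bundle A" using points_carrier unfolding tangent_bundle_def by blast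
  have fv: "fst v = \<one>\<^bsub>G\<^esub>" by (rule fst_tangent_space[OF v])
  define Y where "Y q = tangent_map A (?l q) v" for q
  have Y_tangent: "Y q \<in> tangent_space A q" if "q \<in> carrier G" for q
    using tangent_map_in_tangent_space[OF smooth_map_left_translation[OF that] vb] that fv by (simp add: Y_def)
  have invariant: "tangent_map A (?l a) (Y q) = Y (a \<otimes>\<^bsub>G\<^esub> q)" if "a \<in> carrier G" "q \<in> carrier G" for a q
    unfolding Y_def
    by (rule tangent_map_compose[OF _ _ _ _ vb])
      (use that in \<open>auto intro!: smooth_map_left_translation simp: points_carrier m_assoc\<close>)
  have "tangent_map A (?l ?p) v = tangent_map A (\<lambda>x. x) u"
    unfolding v_def
    by (rule tangent_map_compose[OF _ _ smooth_map_ident _ u])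
      (use p in \<open>auto intro!: smooth_map_left_translation simp: points_carrier m_assoc[symmetric]\<close>)
  then have Yp: "Y ?p = u" using tangent_map_ident[OF u] by (simp add: Y_def)
  obtain c0 w where c0: "c0 \<in> A" "\<one>\<^bsub>G\<^esub> \<in> cdom c0" "v = tvec A \<one>\<^bsub>G\<^esub> c0 w"
    using tangent_bundle_cases[OF vb] fv by metis
  have smooth: "smooth_on (\<lambda>x. comps c (Y (param c x))) (coord c ` cdom c)" if c: "c \<in> A" for c
  proof -
    let ?U = "coord c ` cdom c" and ?y0 = "coord c0 \<one>\<^bsub>G\<^esub>"
    let ?M = "\<lambda>z. coord c (param c (fst z) \<otimes>\<^bsub>G\<^esub> param c0 (snd z))"
    let ?W = "mult_domain c c0 c"
    have U: "open ?U" by (rule open_coord[OF c])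
    note W = mult_coord_smooth[OF c c0(1) c]
    have car: "param c x \<in> carrier G" if "x \<in> ?U" for x
      using param_in_points[OF c that] points_carrier by simp
    have in_W: "(x, ?y0) \<in> ?W" if x: "x \<in> ?U" for x
      using x param_in_cdom[OF x] car[OF x] c0 by (simp add: mult_domain_def)
    show ?thesis
    proof (rule smooth_on_cong[OF U])
      show "smooth_on (\<lambda>x. frechet_derivative ?M (at (x, ?y0)) (0, w)) ?U"
        by (rule smooth_on_compose[OF U W(1) _ _ smooth_on_frechet_derivative[OF W(2)]])
          (use in_W in \<open>auto intro: smooth_on_Pair[OF U smooth_on_ident[OF U] smooth_on_const]\<close>)
      fix x assume x: "x \<in> ?U"
      let ?q = "param c x"
      have q: "?q \<otimes>\<^bsub>G\<^esub> \<one>\<^bsub>G\<^esub> = ?q" using car[OF x] by simp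
      have M: "(?M has_derivative frechet_derivative ?M (at (x, ?y0))) (at (x, ?y0))"
        by (rule smooth_on_has_derivative[OF W in_W[OF x]])
      have "((\<lambda>y. (x, y)) has_derivative (\<lambda>w. (0, w))) (at ?y0)"
        by (auto intro!: derivative_eq_intros)
      from diff_chain_at[OF this M]
      have "((coord c \<circ> ?l ?q \<circ> param c0) has_derivative (\<lambda>w. frechet_derivative ?M (at (x, ?y0)) (0, w))) (at ?y0)"
        by (simp add: comp_def)
      from frechet_derivative_at[OF this]
      have "frechet_derivative ?M (at (x, ?y0)) (0, w) = local_derivative (?l ?q) c0 c \<one>\<^bsub>G\<^esub> w"
        by (rule fun_cong)
      also have "\<dots> = comps c (Y ?q)"
        using tangent_map_tvec[OF smooth_map_left_translation[OF car[OF x]] c0(1,2) c, of w]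
          param_in_cdom[OF x] c by (simp add: Y_def c0(3) q)
      finally show "frechet_derivative ?M (at (x, ?y0)) (0, w) = comps c (Y ?q)" .
    qed
  qed
  have "left_invariant_field G A Y"
    unfolding left_invariant_field_def vector_field_def
    using Y_tangent invariant smooth points_carrier by simp
  then show ?thesis using Yp that by blast
qed

lemma left_invariant_inner_const:
  assumes g: "left_invariant_metric G A g" and X: "left_invariant_field G A X" and Y: "left_invariant_field G A Y"
    and p: "p \<in> carrier G"
  shows "g (X p) (Y p) = g (X \<one>\<^bsub>G\<^esub>) (Y \<one>\<^bsub>G\<^esub>)"
proof -
  have "X \<one>\<^bsub>G\<^esub> \<in> tangent_space A \<one>\<^bsub>G\<^esub>" "Y \<one>\<^bsub>G\<^esub> \<in> tangent_space A \<one>\<^bsub>G\<^esub>"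
    using X Y points_carrier unfolding left_invariant_field_def vector_field_def by auto
  then have "g (tangent_map A (\<lambda>x. p \<otimes>\<^bsub>G\<^esub> x) (X \<one>\<^bsub>G\<^esub>)) (tangent_map A (\<lambda>x. p \<otimes>\<^bsub>G\<^esub> x) (Y \<one>\<^bsub>G\<^esub>)) = g (X \<one>\<^bsub>G\<^esub>) (Y \<one>\<^bsub>G\<^esub>)"
    using g p unfolding left_invariant_metric_def by blast
  moreover have "tangent_map A (\<lambda>x. p \<otimes>\<^bsub>G\<^esub> x) (Z \<one>\<^bsub>G\<^esub>) = Z p" if "left_invariant_field G A Z" for Z
    using that p unfolding left_invariant_field_def by (metis one_closed r_one)
  ultimately show ?thesis using X Y by simp
qed

end

section \<open>The form dual to the vertical lift\<close>

context lie_group_atlas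
begin

lemma left_invariant_vector_field: "left_invariant_field G A X \<Longrightarrow> vector_field A X"
  by (simp add: left_invariant_field_def)

text \<open>With \<open>\<beta> = g(X, \<cdot>)\<close> the function \<open>\<beta>(Y)\<close> is constant for left invariant \<open>Y\<close>. Differentiating it by the product rule
  gives \<open>(\<partial>\<^sub>y \<beta>)(Y) = - \<beta>(\<partial>\<^sub>y Y)\<close>.\<close>

lemma dual_coord_along_left_invariant:
  assumes g: "left_invariant_metric G A g" and X: "left_invariant_field G A X" and Y: "left_invariant_field G A Y"
    and less: "\<And>p. p \<in> points A \<Longrightarrow> g (X p) (X p) < 1"
    and c: "c \<in> A" and x: "x \<in> coord c ` cdom c"
  shows "frechet_derivative (\<lambda>z. dual_coord g X c z (comps c (Y (param c x)))) (at x) y =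
     - dual_coord g X c x (frechet_derivative (\<lambda>z. comps c (Y (param c z))) (at x) y)"
proof -
  let ?U = "coord c ` cdom c"
  have rg: "riemannian_metric A g" using g by (simp add: left_invariant_metric_def)
  interpret randers_data ?U "metric_coord g c" "dual_coord g X c"
    by (rule randers_data_chart[OF rg left_invariant_vector_field[OF X] c less])
  let ?b = "dual_coord g X c"
  define \<eta> where "\<eta> = (\<lambda>z. comps c (Y (param c z)))"
  have const: "?b z (\<eta> z) = g (X \<one>\<^bsub>G\<^esub>) (Y \<one>\<^bsub>G\<^esub>)" if z: "z \<in> ?U" for z
  proof -
    have "tvec A (param c z) c (\<eta> z) = Y (param c z)"
      using tvec_comps[of "Y (param c z)" "param c z" c] left_invariant_vector_field[OF Y]
        param_in_points[OF c z] param_in_cdom[OF z] c by (simp add: \<eta>_def vector_field_def)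
    then show ?thesis
      using left_invariant_inner_const[OF g X Y, of "param c z"] param_in_points[OF c z] points_carrier
      by (simp add: dual_coord_def)
  qed
  have "((\<lambda>_. g (X \<one>\<^bsub>G\<^esub>) (Y \<one>\<^bsub>G\<^esub>)) has_derivative (\<lambda>_. 0)) (at x)" by (rule has_derivative_const)
  then have D0: "((\<lambda>z. ?b z (\<eta> z)) has_derivative (\<lambda>_. 0)) (at x)"
    by (rule has_derivative_transform_within_open[OF _ U x]) (simp add: const)
  let ?\<eta>' = "frechet_derivative \<eta> (at x)"
  have "smooth_on \<eta> ?U" using left_invariant_vector_field[OF Y] c by (simp add: vector_field_def \<eta>_def)
  then have \<eta>: "(\<eta> has_derivative ?\<eta>') (at x)" by (rule smooth_on_has_derivative[OF U _ x])
  have "((\<lambda>z. (\<eta> z \<bullet> i) * ?b z i) has_derivative (\<lambda>v. (\<eta> x \<bullet> i) * Db x v i + (?\<eta>' v \<bullet> i) * ?b x i)) (at x)" for i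
    by (rule has_derivative_mult[OF bounded_linear.has_derivative[OF bounded_linear_inner_left \<eta>] Db_deriv[OF x]])
  then have "((\<lambda>z. \<Sum>i\<in>Basis. (\<eta> z \<bullet> i) * ?b z i) has_derivative
      (\<lambda>v. \<Sum>i\<in>Basis. (\<eta> x \<bullet> i) * Db x v i + (?\<eta>' v \<bullet> i) * ?b x i)) (at x)"
    by (rule has_derivative_sum)
  then have D1: "((\<lambda>z. ?b z (\<eta> z)) has_derivative
      (\<lambda>v. \<Sum>i\<in>Basis. (\<eta> x \<bullet> i) * Db x v i + (?\<eta>' v \<bullet> i) * ?b x i)) (at x)"
    by (rule has_derivative_transform_within_open[OF _ U x])
      (use linear_eq_sum_Basis[OF b_linear] in force)
  have "(\<Sum>i\<in>Basis. (\<eta> x \<bullet> i) * Db x y i + (?\<eta>' y \<bullet> i) * ?b x i) = Db x y (\<eta> x) + ?b x (?\<eta>' y)"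
    using linear_eq_sum_Basis[OF Db_linear[OF x], of y "\<eta> x"] linear_eq_sum_Basis[OF b_linear[OF x], of "?\<eta>' y"]
    by (simp add: sum.distrib)
  then have "Db x y (\<eta> x) + ?b x (?\<eta>' y) = 0"
    using fun_cong[OF has_derivative_unique[OF D1 D0], of y] by simp
  then show "frechet_derivative (\<lambda>z. ?b z (comps c (Y (param c x)))) (at x) y =
      - ?b x (frechet_derivative (\<lambda>z. comps c (Y (param c z))) (at x) y)"
    by (simp add: Db_def \<eta>_def)
qed

end

locale lifted_metric_data = lie_group_atlas G A
  for G :: "'a monoid" and A :: "('a, 'e::euclidean_space) chart set" +
  fixes g :: "('a, 'e) tvec \<Rightarrow> ('a, 'e) tvec \<Rightarrow> real"
    and gt :: "(('a, 'e) tvec, 'e \<times> 'e) tvec \<Rightarrow> (('a, 'e) tvec, 'e \<times> 'e) tvec \<Rightarrow> real"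
    and X :: "'a \<Rightarrow> ('a, 'e) tvec"
  assumes g: "left_invariant_metric G A g"
    and X: "left_invariant_field G A X"
    and less: "p \<in> points A \<Longrightarrow> g (X p) (X p) < 1"
    and gt: "lifted_metric G A g gt"
begin

text \<open>Constants and facts with the qualifier \<open>T\<close> are those of the tangent bundle.\<close>

sublocale T: smooth_atlas TA
  by (rule smooth_atlas_tangent_atlas)

lemma gt_riemannian: "riemannian_metric TA gt"
  using gt by (simp add: lifted_metric_def left_invariant_metric_def)

lemma vector_field_X: "vector_field A X"
  by (rule left_invariant_vector_field[OF X])

lemma g_riemannian: "riemannian_metric A g"
  using g by (simp add: left_invariant_metric_def)

abbreviation Xv :: "('a, 'e) tvec \<Rightarrow> (('a, 'e) tvec, 'e \<times> 'e) tvec" where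
  "Xv \<equiv> vertical_lift A X"

lemma less_lift:
  assumes "u \<in> points TA"
  shows "gt (Xv u) (Xv u) < 1"
proof -
  have u: "u \<in> tangent_bundle A" using assms points_TA by simp
  then have "fst u \<in> points A" by (auto simp: tangent_bundle_def fst_tangent_space)
  moreover have "gt (Xv u) (Xv u) = g (X (fst u)) (X (fst u))"
    using gt X u unfolding lifted_metric_def by blast
  ultimately show ?thesis using less by simp
qed

text \<open>The form \<open>\<beta>' = gt(X\<^sup>v, \<cdot>)\<close> is the complete lift of \<open>\<beta> = g(X, \<cdot>)\<close>. Choose left invariant \<open>Y\<close> with value
  \<open>\<eta>\<close> at \<open>x\<close>. The complete lift \<open>Y\<^sup>c\<close> has components \<open>(\<eta>, \<delta>)\<close> with \<open>\<delta> = \<partial>\<^sub>y Y\<close>, so the vector \<open>(\<eta>, \<zeta>)\<close> is the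
  sum of \<open>Y\<^sup>c\<close>, on which \<open>\<beta>'\<close> vanishes, and of the vertical lift of \<open>\<zeta> - \<delta>\<close>. The value is therefore
  \<open>\<beta>(\<zeta>) - \<beta>(\<delta>)\<close>, and \<open>- \<beta>(\<delta>)\<close> is \<open>(\<partial>\<^sub>y \<beta>)(\<eta>)\<close> by the preceding lemma.\<close>

lemma dual_coord_lift:
  assumes c: "c \<in> A" and x: "x \<in> coord c ` cdom c"
  shows "T.dual_coord gt Xv (tchart c) (x, y) (\<eta>, \<zeta>) =
    dual_coord g X c x \<zeta> + frechet_derivative (\<lambda>x. dual_coord g X c x \<eta>) (at x) y"
proof -
  interpret randers_data "coord c ` cdom c" "metric_coord g c" "dual_coord g X c"
    by (rule randers_data_chart[OF g_riemannian vector_field_X c less])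
  let ?p = "param c x"
  define u where "u = tvec A ?p c y"
  have p: "?p \<in> cdom c" by (rule param_in_cdom[OF x])
  have u: "u \<in> tangent_bundle A" "fst u = ?p" "comps c u = y" "fst u \<in> cdom c"
    using tvec_in_tangent_bundle[OF c p] comps_tvec_self[OF c p] p by (auto simp: u_def)
  have cp: "coord c (fst u) = x" using coord_param[OF x] u(2) by simp
  have through: "\<exists>Y. left_invariant_field G A Y \<and> Y ?p = tvec A ?p c w" for w
    using left_invariant_field_through[OF tvec_in_tangent_bundle[OF c p, of w]] by (metis fst_tvec)
  obtain Y where Y: "left_invariant_field G A Y" "Y ?p = tvec A ?p c \<eta>" using through by blast
  define \<delta> where "\<delta> = frechet_derivative (\<lambda>z. comps c (Y (param c z))) (at x) y"
  obtain Z where Z: "left_invariant_field G A Z" "Z ?p = tvec A ?p c (\<zeta> - \<delta>)" using through by blast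
  have Y\<eta>: "comps c (Y ?p) = \<eta>" and Z\<zeta>: "comps c (Z ?p) = \<zeta> - \<delta>"
    using Y(2) Z(2) comps_tvec_self[OF c p] by simp_all
  have uT: "tchart c \<in> TA" "u \<in> cdom (tchart c)" using c u by (auto simp: cdom_tchart)
  have complete: "complete_lift A Y u = tvec TA u (tchart c) (\<eta>, \<delta>)"
    unfolding complete_lift_eq_tvec[OF left_invariant_vector_field[OF Y(1)] c u(1,4)] cp
    by (simp add: u Y\<eta> \<delta>_def)
  have vertical: "vertical_lift A Z u = tvec TA u (tchart c) (0, \<zeta> - \<delta>)"
    unfolding vertical_lift_eq_tvec[OF left_invariant_vector_field[OF Z(1)] c u(1,4)]
    by (simp add: u Z\<zeta>)
  have sum: "tvec TA u (tchart c) (\<eta>, \<zeta>) = add_vec (complete_lift A Y u) (vertical_lift A Z u)"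
    unfolding complete vertical T.add_vec_tvec[OF uT] by simp
  have Xv: "Xv u \<in> tangent_space TA u"
    using vector_field_vertical_lift[OF vector_field_X] u(1) points_TA unfolding vector_field_def by blast
  have tang: "tvec TA u (tchart c) w \<in> tangent_space TA u" for w
    by (rule T.tvec_in_tangent_space[OF uT])
  have up: "u \<in> points TA" using u(1) points_TA by simp
  have "T.dual_coord gt Xv (tchart c) (x, y) (\<eta>, \<zeta>) = gt (Xv u) (tvec TA u (tchart c) (\<eta>, \<zeta>))"
    unfolding T.dual_coord_def param_tchart[OF c x] u_def ..
  also have "\<dots> = gt (tvec TA u (tchart c) (\<eta>, \<zeta>)) (Xv u)"
    using gt_riemannian up Xv tang unfolding riemannian_metric_def by blast
  also have "\<dots> = gt (complete_lift A Y u) (Xv u) + gt (vertical_lift A Z u) (Xv u)"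
    unfolding sum complete vertical using gt_riemannian up Xv tang unfolding riemannian_metric_def by blast
  also have "gt (complete_lift A Y u) (Xv u) = 0"
    using gt X Y(1) u(1) unfolding lifted_metric_def by blast
  also have "gt (vertical_lift A Z u) (Xv u) = g (Z ?p) (X ?p)"
    using gt X Z(1) u(1) unfolding lifted_metric_def u(2)[symmetric] by blast
  also have "g (Z ?p) (X ?p) = g (X ?p) (Z ?p)"
    using g_riemannian vector_field_X left_invariant_vector_field[OF Z(1)] param_in_points[OF c x]
    unfolding riemannian_metric_def vector_field_def by blast
  also have "\<dots> = dual_coord g X c x (\<zeta> - \<delta>)" unfolding Z(2) dual_coord_def ..
  also have "\<dots> = dual_coord g X c x \<zeta> - dual_coord g X c x \<delta>" by (rule b_ops(2)[OF x])
  also have "dual_coord g X c x \<delta> = - frechet_derivative (\<lambda>x. dual_coord g X c x \<eta>) (at x) y"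
    using dual_coord_along_left_invariant[OF g X Y(1) less c x, of y] by (simp add: Y\<eta> \<delta>_def)
  finally show ?thesis by simp
qed

text \<open>The derivative of \<open>\<beta>(\<zeta>) + (\<partial>\<^sub>y \<beta>)(\<eta>)\<close> in direction \<open>(v, w)\<close> is
  \<open>(\<partial>\<^sub>v \<beta>)(\<zeta>) + (\<partial>\<^sub>v \<partial>\<^sub>y \<beta>)(\<eta>) + (\<partial>\<^sub>w \<beta>)(\<eta>)\<close>. If \<open>(\<partial>\<^sub>v \<beta>)(w)\<close> is symmetric in \<open>v\<close> and \<open>w\<close>,
  then \<open>(\<partial>\<^sub>v \<partial>\<^sub>y \<beta>)(\<eta>)\<close> is symmetric in all three arguments, and exchanging \<open>(v, w)\<close> with
  \<open>(\<eta>, \<zeta>)\<close> changes nothing. Conversely the symmetry of \<open>\<partial>\<beta>\<close> is read off on the zero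
  section \<open>y = 0\<close>, where the second-order term is absent.\<close>

lemma dual_closed_lift_iff:
  assumes c: "c \<in> A"
  shows "T.dual_closed gt Xv (tchart c) \<longleftrightarrow> dual_closed g X c"
proof -
  let ?U = "coord c ` cdom c" and ?b = "dual_coord g X c"
  interpret randers_data ?U "metric_coord g c" ?b
    by (rule randers_data_chart[OF g_riemannian vector_field_X c less])
  have W: "open (?U \<times> (UNIV :: 'e set))" using U by (rule open_Times) simp
  define DDb where "DDb x y \<eta> v = frechet_derivative (\<lambda>z. Db z y \<eta>) (at x) v" for x y \<eta> v
  have lift: "frechet_derivative (\<lambda>z. T.dual_coord gt Xv (tchart c) z (\<eta>, \<zeta>)) (at (x, y)) (v, w) =
      Db x v \<zeta> + DDb x y \<eta> v + Db x w \<eta>" if x: "x \<in> ?U" for x y \<eta> \<zeta> v w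
  proof -
    have "(fst has_derivative fst) (at (x, y))" by (rule has_derivative_fst[OF has_derivative_ident])
    from diff_chain_at[OF this, unfolded fst_conv, OF Db_deriv[OF x, of \<zeta>]]
    have 1: "((\<lambda>z. ?b (fst z) \<zeta>) has_derivative (\<lambda>z. Db x (fst z) \<zeta>)) (at (x, y))"
      by (simp only: comp_def)
    have "((\<lambda>z. frechet_derivative (\<lambda>x. ?b x \<eta>) (at (fst z)) (snd z)) has_derivative
        (\<lambda>z. DDb x y \<eta> (fst z) + Db x (snd z) \<eta>)) (at (x, y))"
      using frechet_derivative_apply_has_derivative[OF U b_smooth x, of \<eta> y] by (simp add: DDb_def Db_def)
    from has_derivative_add[OF 1 this]
    have "((\<lambda>z. T.dual_coord gt Xv (tchart c) z (\<eta>, \<zeta>)) has_derivative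
        (\<lambda>z. Db x (fst z) \<zeta> + (DDb x y \<eta> (fst z) + Db x (snd z) \<eta>))) (at (x, y))"
      by (rule has_derivative_transform_within_open[OF _ W])
        (use x dual_coord_lift[OF c] in auto)
    from fun_cong[OF frechet_derivative_at[OF this], of "(v, w)"] show ?thesis by simp
  qed
  have closed_iff: "dual_closed g X c \<longleftrightarrow> (\<forall>x\<in>?U. \<forall>v w. Db x v w = Db x w v)"
    unfolding dual_closed_def Db_def ..
  show ?thesis
  proof
    assume "dual_closed g X c"
    then have sym: "Db x v w = Db x w v" if "x \<in> ?U" for x v w using that closed_iff by blast
    have DDb_swap: "DDb x y \<eta> v = DDb x v \<eta> y" if x: "x \<in> ?U" for x y \<eta> v
      unfolding DDb_def Db_def by (rule symmetric_second_derivative[OF U b_smooth x])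
    have DDb_sym: "DDb x y \<eta> v = DDb x \<eta> y v" if x: "x \<in> ?U" for x y \<eta> v
      unfolding DDb_def
    proof (rule fun_cong[OF frechet_derivative_transform_within_open[OF _ U x]])
      have "smooth_on (\<lambda>z. Db z y \<eta>) ?U"
        unfolding Db_def by (rule smooth_on_frechet_derivative[OF b_smooth])
      then show "(\<lambda>z. Db z y \<eta>) differentiable at x"
        using smooth_on_has_derivative[OF U _ x] by (blast intro: differentiableI)
    qed (rule sym)
    have "Db x v \<zeta> + DDb x y \<eta> v + Db x w \<eta> = Db x \<eta> w + DDb x y v \<eta> + Db x \<zeta> v"
      if x: "x \<in> ?U" for x y v w \<eta> \<zeta>
    proof -
      have "DDb x y \<eta> v = DDb x \<eta> y v" by (rule DDb_sym[OF x])
      also have "\<dots> = DDb x v y \<eta>" by (rule DDb_swap[OF x])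
      also have "\<dots> = DDb x y v \<eta>" by (rule DDb_sym[OF x])
      finally show ?thesis using sym[OF x, of v \<zeta>] sym[OF x, of w \<eta>] by simp
    qed
    then show "T.dual_closed gt Xv (tchart c)"
      unfolding T.dual_closed_def tchart_image[OF c] by (auto simp: lift)
  next
    assume closed: "T.dual_closed gt Xv (tchart c)"
    have "Db x v w = Db x w v" if x: "x \<in> ?U" for x v w
    proof -
      \<comment> \<open>On the zero section \<open>Db z 0 \<eta>\<close> vanishes for all \<open>z\<close>, hence so does its derivative.\<close>
      have zero: "DDb x 0 \<eta> u = 0" for \<eta> u
      proof -
        have "((\<lambda>z. 0) has_derivative (\<lambda>_. 0)) (at x)" by (rule has_derivative_const)
        then have "((\<lambda>z. Db z 0 \<eta>) has_derivative (\<lambda>_. 0)) (at x)"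
          by (rule has_derivative_transform_within_open[OF _ U x]) (simp add: Db_ops1)
        from fun_cong[OF frechet_derivative_at[OF this], of u] show ?thesis by (simp add: DDb_def)
      qed
      have "(x, 0) \<in> coord (tchart c) ` cdom (tchart c)" unfolding tchart_image[OF c] using x by simp
      then have "frechet_derivative (\<lambda>z. T.dual_coord gt Xv (tchart c) z (0, w)) (at (x, 0)) (v, 0) =
          frechet_derivative (\<lambda>z. T.dual_coord gt Xv (tchart c) z (v, 0)) (at (x, 0)) (0, w)"
        using closed unfolding T.dual_closed_def by blast
      then show ?thesis unfolding lift[OF x] zero by (simp add: Db_ops[OF x] Db_ops1[OF x])
    qed
    then show "dual_closed g X c" using closed_iff by blast
  qed
qed

text \<open>Induced charts cover the tangent bundle exactly as the charts cover the group: a chart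
  around the base point of \<open>u\<close> induces one around \<open>u\<close>, and an induced chart around a vector at \<open>p\<close>
  comes from a chart around \<open>p\<close>.\<close>

lemma douglas_lift_iff:
  "douglas_metric A (randers g X) \<longleftrightarrow> douglas_metric TA (randers gt Xv)"
proof -
  have "(\<forall>p\<in>points A. \<exists>c\<in>A. p \<in> cdom c \<and> dual_closed g X c) \<longleftrightarrow>
      (\<forall>u\<in>points TA. \<exists>C\<in>TA. u \<in> cdom C \<and> T.dual_closed gt Xv C)" (is "?L \<longleftrightarrow> ?R")
  proof
    assume L: ?L
    show ?R
    proof
      fix u assume "u \<in> points TA"
      then have u: "u \<in> tangent_bundle A" using points_TA by simp
      then have "fst u \<in> points A" by (auto simp: tangent_bundle_def fst_tangent_space)
      then obtain c where c: "c \<in> A" "fst u \<in> cdom c" "dual_closed g X c" using L by blast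
      then have "tchart c \<in> TA" "u \<in> cdom (tchart c)" using u by (auto simp: cdom_tchart)
      then show "\<exists>C\<in>TA. u \<in> cdom C \<and> T.dual_closed gt Xv C" using dual_closed_lift_iff[OF c(1)] c(3) by blast
    qed
  next
    assume R: ?R
    show ?L
    proof
      fix p assume "p \<in> points A"
      then obtain c0 where c0: "c0 \<in> A" "p \<in> cdom c0" unfolding points_def by blast
      then have "tvec A p c0 0 \<in> points TA" using points_TA tvec_in_tangent_bundle by simp
      then obtain C where C: "C \<in> TA" "tvec A p c0 0 \<in> cdom C" "T.dual_closed gt Xv C" using R by blast
      then obtain c where c: "c \<in> A" "C = tchart c" by (auto simp: tangent_atlas_def)
      then have "p \<in> cdom c" using C(2) by (simp add: cdom_tchart)
      then show "\<exists>c\<in>A. p \<in> cdom c \<and> dual_closed g X c" using dual_closed_lift_iff[OF c(1)] C(3) c by blast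
    qed
  qed
  then show ?thesis
    using douglas_randers_iff[OF g_riemannian vector_field_X less]
      T.douglas_randers_iff[OF gt_riemannian vector_field_vertical_lift[OF vector_field_X] less_lift]
    by simp
qed

end

theorem lemma2p4:
  fixes G :: "'a monoid"
    and A :: "('a, 'e::euclidean_space) chart set"
    and g :: "('a, 'e) tvec \<Rightarrow> ('a, 'e) tvec \<Rightarrow> real"
    and gt :: "(('a, 'e) tvec, 'e \<times> 'e) tvec \<Rightarrow> (('a, 'e) tvec, 'e \<times> 'e) tvec \<Rightarrow> real"
    and X :: "'a \<Rightarrow> ('a, 'e) tvec"
  assumes "lie_group G A"
    and "connected_space (atlas_topology A)"
    and "left_invariant_metric G A g"
    and "left_invariant_field G A X"
    and "\<forall>p\<in>carrier G. sqrt (g (X p) (X p)) < 1"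
    and "lifted_metric G A g gt"
  shows "douglas_metric A (randers g X) \<longleftrightarrow>
         douglas_metric (tangent_atlas A) (randers gt (vertical_lift A X))"
proof -
  interpret lie_group_atlas G A by (rule lie_group_lie_group_atlas[OF assms(1)])
  interpret lifted_metric_data G A g gt X
    by standard (use assms points_carrier in \<open>auto simp: real_sqrt_lt_1_iff\<close>)
  show ?thesis by (rule douglas_lift_iff)
qed

end
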